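(* Let $0<\varrho<1$. If $a\in L^{\infty}S^{-n(1-\varrho)}_{\varrho}$, then there is a constant $C$ such that $$M^{\sharp}(T^{*}_{a}f)(x)\leq C\, Mf(x)$$ for all $f\in\mathscr{S}(\mathbb{R}^n)$ and all $x\in\mathbb{R}^n$.
   Context: For $m\in\mathbb{R}$ and $0\le\varrho\le1$, the rough Hörmander class $L^\infty S^m_\varrho$ is the set of measurable functions $a(x,\xi)$ on $\mathbb{R}^n\times\mathbb{R}^n$, smooth in $\xi$, with $\|\partial_\xi^\alpha a(\cdot,\xi)\|_{L^\infty(\mathbb{R}^n)}\le C_\alpha\langle\xi\rangle^{m-\varrho|\alpha|}$ for all multi-indices $\alpha$, where $\langle\xi\rangle=(1+|\xi|^2)^{1/2}$ (no regularity in $x$ is assumed). The operator $T_a^*$ is $$T^{*}_{a}u(x)=\frac{1}{(2\pi)^n}\int\int e^{ i \langle x-y,\xi\rangle}a(y,\xi)u(y)\,dy\,d\xi,$$ i.e. $T_a^*u$ is the tempered distribution whose Fourier transform is $\xi\mapsto\int e^{-i\langle y,\xi\rangle}a(y,\xi)u(y)\,dy$. For $u\in L^1_{loc}(\mathbb{R}^n)$, $$M^{\sharp}u(x)=\sup_{Q\ni x}\inf_{c\in\mathbb{C}}\frac{1}{|Q|}\int_{Q}|u(y)-c|\,dy,\qquad Mu(x)=\sup_{Q\ni x}\frac{1}{|Q|}\int_{Q}|u(y)|\,dy,$$ the suprema over all cubes $Q$ containing $x$ with sides parallel to the axes. $\mathscr{S}(\mathbb{R}^n)$ is the Schwartz space.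 *)

theory Defs
  imports "HOL-Analysis.Analysis" "HOL-Probability.Essential_Supremum"
begin

section \<open>Partial derivatives and smooth functions\<close>

definition partial_deriv :: "'n::finite \<Rightarrow> (real^'n \<Rightarrow> complex) \<Rightarrow> real^'n \<Rightarrow> complex" where
  "partial_deriv i f x = vector_derivative (\<lambda>t. f (x + t *\<^sub>R axis i 1)) (at 0)"

text \<open>All iterated partial derivatives, in any order, exist and are (Frechet) differentiable;
  in particular they are all continuous, so this is the class of C-infinity functions.\<close>

definition smooth_fun :: "(real^'n::finite \<Rightarrow> complex) \<Rightarrow> bool" where
  "smooth_fun f \<longleftrightarrow> (\<forall>is x. foldr partial_deriv is f differentiable (at x))"

text \<open>A multi-index is a function from coordinates to naturals. The index type carries no order,
  so the derivative of multi-index \<open>\<alpha>\<close> is taken along an arbitrary but fixed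
  enumeration of the coordinates (irrelevant for smooth functions).\<close>

definition coord_list :: "'n::finite list" where
  "coord_list = (SOME is. distinct is \<and> set is = UNIV)"

definition multi_deriv ::
  "('n::finite \<Rightarrow> nat) \<Rightarrow> (real^'n \<Rightarrow> complex) \<Rightarrow> real^'n \<Rightarrow> complex" where
  "multi_deriv \<alpha> f = foldr (\<lambda>i g. (partial_deriv i ^^ \<alpha> i) g) coord_list f"

definition multi_size :: "('n::finite \<Rightarrow> nat) \<Rightarrow> nat" where
  "multi_size \<alpha> = (\<Sum>i\<in>UNIV. \<alpha> i)"

definition schwartz_fun :: "(real^'n::finite \<Rightarrow> complex) \<Rightarrow> bool" where
  "schwartz_fun f \<longleftrightarrow> smooth_fun f \<and>
     (\<forall>\<alpha> \<beta>. \<exists>C. \<forall>x. norm ((\<Prod>i\<in>UNIV. (x $ i) ^ \<beta> i) *\<^sub>R multi_deriv \<alpha> f x) \<le> C)"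

definition test_fun :: "(real^'n::finite \<Rightarrow> complex) \<Rightarrow> bool" where
  "test_fun f \<longleftrightarrow> smooth_fun f \<and> compact (closure {x. f x \<noteq> 0})"

section \<open>Rough Hoermander classes\<close>

definition japanese :: "real^'n::finite \<Rightarrow> real" where
  "japanese \<xi> = sqrt (1 + (norm \<xi>)\<^sup>2)"

text \<open>\<open>esssup\<close> is infinite on non-measurable functions.\<close>

definition Linf_norm :: "(real^'n::finite \<Rightarrow> complex) \<Rightarrow> ereal" where
  "Linf_norm f = esssup lebesgue (\<lambda>x. ereal (norm (f x)))"

definition rough_symbols ::
  "real \<Rightarrow> real \<Rightarrow> (real^'n::finite \<Rightarrow> real^'n \<Rightarrow> complex) set" where
  "rough_symbols m \<rho> = {a.
     (\<lambda>(x, \<xi>). a x \<xi>) \<in> borel_measurable lebesgue \<and>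
     (\<forall>x. smooth_fun (a x)) \<and>
     (\<forall>\<alpha>. \<exists>C. \<forall>\<xi>. Linf_norm (\<lambda>x. multi_deriv \<alpha> (a x) \<xi>)
                     \<le> ereal (C * japanese \<xi> powr (m - \<rho> * real (multi_size \<alpha>))))}"

section \<open>Tempered distributions and the adjoint operator\<close>

text \<open>A tempered distribution is represented by the functional \<open>\<phi> \<mapsto> T \<phi>\<close>;
  only its values on Schwartz functions matter.\<close>

type_synonym 'n distrib = "(real^'n \<Rightarrow> complex) \<Rightarrow> complex"

definition distrib_of_fun :: "(real^'n::finite \<Rightarrow> complex) \<Rightarrow> 'n distrib" where
  "distrib_of_fun g \<phi> = (LINT x|lebesgue. g x * \<phi> x)"

definition inv_fourier :: "(real^'n::finite \<Rightarrow> complex) \<Rightarrow> real^'n \<Rightarrow> complex" where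
  "inv_fourier \<phi> \<xi> = complex_of_real (1 / (2 * pi) ^ CARD('n)) *
     (LINT x|lebesgue. exp (\<i> * complex_of_real (x \<bullet> \<xi>)) * \<phi> x)"

definition inv_fourier_distrib :: "'n::finite distrib \<Rightarrow> 'n distrib" where
  "inv_fourier_distrib T \<phi> = T (inv_fourier \<phi>)"

definition adjoint_fourier ::
  "(real^'n::finite \<Rightarrow> real^'n \<Rightarrow> complex) \<Rightarrow> (real^'n \<Rightarrow> complex) \<Rightarrow> real^'n \<Rightarrow> complex" where
  "adjoint_fourier a u \<xi> =
     (LINT y|lebesgue. exp (- \<i> * complex_of_real (y \<bullet> \<xi>)) * a y \<xi> * u y)"

text \<open>\<open>adjoint_op a u\<close> is the tempered distribution with Fourier transform
  \<open>adjoint_fourier a u\<close>. The iterated integral formally defining it need not converge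
  absolutely in the frequency variable.\<close>

definition adjoint_op ::
  "(real^'n::finite \<Rightarrow> real^'n \<Rightarrow> complex) \<Rightarrow> (real^'n \<Rightarrow> complex) \<Rightarrow> 'n distrib" where
  "adjoint_op a u = inv_fourier_distrib (distrib_of_fun (adjoint_fourier a u))"

definition locally_integrable :: "(real^'n::finite \<Rightarrow> complex) \<Rightarrow> bool" where
  "locally_integrable u \<longleftrightarrow> (\<forall>K. compact K \<longrightarrow> set_integrable lebesgue K u)"

text \<open>The distribution \<open>T\<close> is (given by) the locally integrable function \<open>u\<close>. Testing is
  against compactly supported smooth functions, since the product of a merely locally integrable
  function with a Schwartz function need not be integrable.\<close>

definition represented_by :: "'n::finite distrib \<Rightarrow> (real^'n \<Rightarrow> complex) \<Rightarrow> bool" where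
  "represented_by T u \<longleftrightarrow> locally_integrable u \<and>
     (\<forall>\<phi>. test_fun \<phi> \<longrightarrow> T \<phi> = distrib_of_fun u \<phi>)"

section \<open>Maximal functions\<close>

text \<open>Cubes are closed and nondegenerate.\<close>

definition cubes_through :: "real^'n::finite \<Rightarrow> (real^'n) set set" where
  "cubes_through x = {Q. \<exists>p l. 0 < l \<and> Q = cbox p (p + (\<chi> i. l)) \<and> x \<in> Q}"

definition cube_mean :: "(real^'n::finite) set \<Rightarrow> (real^'n \<Rightarrow> complex) \<Rightarrow> ennreal" where
  "cube_mean Q u = (\<integral>\<^sup>+y\<in>Q. ennreal (norm (u y)) \<partial>lebesgue) / emeasure lebesgue Q"

definition sharp_maximal :: "(real^'n::finite \<Rightarrow> complex) \<Rightarrow> real^'n \<Rightarrow> ennreal" where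
  "sharp_maximal u x = (SUP Q\<in>cubes_through x. INF c. cube_mean Q (\<lambda>y. u y - c))"

definition maximal :: "(real^'n::finite \<Rightarrow> complex) \<Rightarrow> real^'n \<Rightarrow> ennreal" where
  "maximal u x = (SUP Q\<in>cubes_through x. cube_mean Q u)"

end

theory Submission
  imports Defs "HOL-Probability.Characteristic_Functions" "HOL-Probability.Sinc_Integral"
    "HOL-Real_Asymp.Real_Asymp" "HOL-Computational_Algebra.Polynomial"
begin

text \<open>
  With \<open>\<lambda> = 2^j\<close>, the order \<open>-n(1 - \<rho>)\<close> makes the kernel \<open>K\<^sub>j\<close> of the frequency piece
  \<open>|\<xi>| ~ \<lambda>\<close> of the operator an \<open>L\<^sup>1\<close>-normalised bump at scale \<open>\<lambda>^(-\<rho>)\<close>, so each piece is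
  bounded by \<open>Mf\<close>; the point is to gain decay in \<open>j\<close>. Fix a cube of side \<open>l\<close>. If \<open>\<lambda> l \<le> 1\<close>,
  subtracting the value of the piece at one point of the cube and using
  \<open>|\<nabla>K\<^sub>j(z)| \<lesssim> \<lambda>^(1 + n\<rho>) (1 + \<lambda>^\<rho> |z|)^(-N)\<close> gains \<open>\<lambda> l\<close>. Otherwise Cauchy--Schwarz on the
  cube together with the weighted Bessel bound
  \<open>\<integral> |K\<^sub>j|\<^sup>2 (1 + \<lambda>^\<rho> |z|)^(2N) dz \<lesssim> \<lambda>^(n(2\<rho> - 1))\<close> gains
  \<open>(\<lambda> l)^(-n/2) + \<lambda>^(-n(1 - \<rho>)/2)\<close>, which is summable because \<open>\<rho> < 1\<close>. The pieces themselves
  sum in \<open>L\<^sup>1\<close> for integrable \<open>f\<close>, which yields the function representing the distribution.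
\<close>

section \<open>Gaussian Fourier integrals and Bessel inequality\<close>

text \<open>No regularity is available in the first variable of the symbol, so no argument may vary
  it. For the adjoint this costs nothing: the kernel of a piece is
  \<open>dyadic_ker j (a y) (x - y)\<close>, with the symbol frozen at the integration variable, and
  after Tonelli one integrates over \<open>x\<close> for fixed \<open>y\<close>. Hence all kernel
  bounds concern one symbol of \<xi> alone, uniformly. The two gains on a cube of side l with
  \<lambda> l > 1 arise as follows. Cauchy--Schwarz bounds the mass of the kernel there by the root
  of \<lambda>^(n(2\<rho> - 1)) min(l^n, \<lambda>^(-n\<rho>)), and f is seen at the scale s =
  max(l, \<lambda>^(-\<rho>)), contributing s^n Mf. Division by l^n leaves (\<lambda> l)^(-n/2) if l
  \<le> \<lambda>^(-\<rho>) and \<lambda>^(-n(1 - \<rho>)/2) otherwise. A second obstacle is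
  measurability: the symbol is only Lebesgue measurable on the product, and its bounds may fail on a
  null set of \<open>y\<close> that varies with \<xi>. It is replaced by a Borel version that obeys
  them for every \<open>y\<close>. Finally, the claim concerns every function representing the
  distribution, so representatives must be shown unique almost everywhere.\<close>

lemma Basis_vec_eq: "(Basis :: (real^'n::finite) set) = range (\<lambda>i. axis i 1)"
  by (auto simp: Basis_vec_def)

lemma inj_axis_one: "inj (\<lambda>i::'n::finite. axis i (1::real))"
  by (auto simp: inj_on_def axis_eq_axis)

lemma prod_Basis_vec:
  "(\<Prod>b\<in>(Basis :: (real^'n::finite) set). F b) = (\<Prod>i\<in>UNIV. F (axis i 1))"
  unfolding Basis_vec_eq by (subst prod.reindex[OF inj_axis_one]) simp

lemma nn_integral_lborel_prod_vec:
  fixes f :: "'n::finite \<Rightarrow> real \<Rightarrow> ennreal"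
  assumes [measurable]: "\<And>i. f i \<in> borel_measurable borel"
  shows "(\<integral>\<^sup>+x. (\<Prod>i\<in>UNIV. f i (x $ i)) \<partial>(lborel :: (real^'n) measure))
       = (\<Prod>i\<in>UNIV. \<integral>\<^sup>+t. f i t \<partial>lborel)"
proof -
  \<comment> \<open>Labels the factors by basis vectors instead of coordinates, the indexing used by
    the product formula for \<open>lborel\<close>.\<close>
  define g where "g b = f (inv (\<lambda>i. axis i (1::real)) b)" for b :: "real^'n"
  have g: "g (axis i 1) = f i" for i
    unfolding g_def using inv_f_f[OF inj_axis_one] by metis
  have [measurable]: "g b \<in> borel_measurable borel" for b
    by (simp add: g_def)
  have "(\<integral>\<^sup>+x. (\<Prod>b\<in>Basis. g b (x \<bullet> b)) \<partial>(lborel :: (real^'n) measure)) = (\<Prod>b\<in>Basis. (\<integral>\<^sup>+x. g b x \<partial>lborel))"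
    by (rule nn_integral_lborel_prod) auto
  then show ?thesis
    by (simp add: prod_Basis_vec g inner_axis)
qed

lemma lborel_integral_prod_vec:
  fixes f :: "'n::finite \<Rightarrow> real \<Rightarrow> complex"
  assumes int: "\<And>i. integrable lborel (f i)"
  shows "(LINT x|(lborel :: (real^'n) measure). (\<Prod>i\<in>UNIV. f i (x $ i))) = (\<Prod>i\<in>UNIV. LINT t|lborel. f i t)"
proof -
  define g where "g b = f (inv (\<lambda>i. axis i (1::real)) b)" for b :: "real^'n"
  have g: "g (axis i 1) = f i" for i
    unfolding g_def using inv_f_f[OF inj_axis_one] by metis
  have gi: "integrable lborel (g b)" for b
    by (simp add: g_def int)
  then have [measurable]: "g b \<in> borel_measurable borel" for b
    using borel_measurable_integrable by force
  interpret product_sigma_finite "\<lambda>_::real^'n. lborel :: real measure" ..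
  have "(LINT x|(lborel :: (real^'n) measure). (\<Prod>b\<in>Basis. g b (x \<bullet> b))) = (\<Prod>b\<in>Basis. (LINT x|lborel. g b x))"
    by (subst lborel_eq[where 'a="real^'n"], subst integral_distr) (auto simp: product_integral_prod gi)
  then show ?thesis
    by (simp add: prod_Basis_vec g inner_axis)
qed

text \<open>This is the characteristic function of the standard normal distribution, stripped of its
  density constant and rescaled by \<open>L\<close>.\<close>

lemma integral_exp_gaussian_real:
  fixes L t :: real
  assumes L: "0 < L"
  shows "integrable lborel (\<lambda>x. exp (\<i> * complex_of_real (t * x)) * complex_of_real (exp (- (x\<^sup>2) / (2 * L\<^sup>2))))"
    and "(LINT x|lborel. exp (\<i> * complex_of_real (t * x)) * complex_of_real (exp (- (x\<^sup>2) / (2 * L\<^sup>2))))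
      = complex_of_real (L * sqrt (2 * pi) * exp (- (L\<^sup>2 * t\<^sup>2) / 2))"
proof -
  let ?h = "\<lambda>s x. exp (\<i> * complex_of_real (s * x)) * complex_of_real (exp (- (x\<^sup>2) / 2))"
  have snd: "complex_of_real (exp (- (x\<^sup>2) / 2)) = complex_of_real (sqrt (2 * pi)) * complex_of_real (std_normal_density x)" for x
    by (simp add: std_normal_density_def)
  have int0: "integrable lborel (\<lambda>x. exp (- (x\<^sup>2) / 2) :: real)"
    using integrable_mult_right[OF integrable_normal_density[of 1 0], of "sqrt (2*pi)"]
    by (simp add: normal_density_def)
  have inth: "integrable lborel (?h s)" for s
    by (rule Bochner_Integration.integrable_bound[OF int0]) (auto simp: norm_mult)
  have I: "(LINT x|lborel. ?h s x) = complex_of_real (sqrt (2 * pi) * exp (- (s\<^sup>2) / 2))" for s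
  proof -
    have "char std_normal_distribution s = (LINT x|lborel. std_normal_density x *\<^sub>R exp (\<i> * complex_of_real (s * x)))"
      unfolding char_def by (subst integral_density) (auto simp: normal_density_nonneg)
    then have e: "(LINT x|lborel. std_normal_density x *\<^sub>R exp (\<i> * complex_of_real (s * x))) = complex_of_real (exp (- (s\<^sup>2) / 2))"
      by (simp add: char_std_normal_distribution)
    have "(LINT x|lborel. ?h s x) = (LINT x|lborel. complex_of_real (sqrt (2 * pi)) * (std_normal_density x *\<^sub>R exp (\<i> * complex_of_real (s * x))))"
      by (intro Bochner_Integration.integral_cong refl) (simp only: snd scaleR_conv_of_real mult_ac)
    also have "\<dots> = complex_of_real (sqrt (2 * pi)) * complex_of_real (exp (- (s\<^sup>2) / 2))"
      by (subst integral_mult_right_zero) (simp only: e)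
    finally show ?thesis by simp
  qed
  have sc: "?h (L * t) (0 + (1/L) * x) = exp (\<i> * complex_of_real (t * x)) * complex_of_real (exp (- (x\<^sup>2) / (2 * L\<^sup>2)))" for x
    using L by (simp add: power_divide field_simps)
  show "integrable lborel (\<lambda>x. exp (\<i> * complex_of_real (t * x)) * complex_of_real (exp (- (x\<^sup>2) / (2 * L\<^sup>2))))"
    using lborel_integrable_real_affine[OF inth[of "L * t"], of "1/L" 0] L unfolding sc by simp
  have "(LINT x|lborel. ?h (L*t) x) = (1/L) *\<^sub>R (LINT x|lborel. exp (\<i> * complex_of_real (t * x)) * complex_of_real (exp (- (x\<^sup>2) / (2 * L\<^sup>2))))"
    using lborel_integral_real_affine[of "1/L" "?h (L*t)" 0] L unfolding sc by simp
  then have "(LINT x|lborel. exp (\<i> * complex_of_real (t * x)) * complex_of_real (exp (- (x\<^sup>2) / (2 * L\<^sup>2)))) = L *\<^sub>R (LINT x|lborel. ?h (L*t) x)"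
    using L by simp
  then show "(LINT x|lborel. exp (\<i> * complex_of_real (t * x)) * complex_of_real (exp (- (x\<^sup>2) / (2 * L\<^sup>2))))
      = complex_of_real (L * sqrt (2 * pi) * exp (- (L\<^sup>2 * t\<^sup>2) / 2))"
    unfolding I by (simp add: scaleR_conv_of_real power_mult_distrib)
qed

lemma norm_vec_sq: "(norm (x::real^'n::finite))\<^sup>2 = (\<Sum>i\<in>UNIV. (x $ i)\<^sup>2)"
  by (simp add: norm_vec_def L2_set_def sum_nonneg)

lemma inner_vec_real: "(x::real^'n::finite) \<bullet> y = (\<Sum>i\<in>UNIV. x $ i * y $ i)"
  by (simp add: inner_vec_def)

section \<open>Gaussian weights and the Fourier integral\<close>

definition gauss :: "real \<Rightarrow> real^'n::finite \<Rightarrow> real" where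
  "gauss L w = exp (- (norm w)\<^sup>2 / (2 * L\<^sup>2))"

lemma gauss_prod: "gauss L w = (\<Prod>i\<in>UNIV. exp (- ((w $ i)\<^sup>2) / (2 * L\<^sup>2)))"
  unfolding gauss_def norm_vec_sq by (subst exp_sum[symmetric]) (simp_all add: sum_negf sum_divide_distrib)

lemma borel_measurable_cnj' [measurable]: "cnj \<in> borel_measurable borel"
  by (intro borel_measurable_continuous_onI continuous_intros)

lemma gauss_measurable [measurable]: "gauss L \<in> borel_measurable borel"
  unfolding gauss_def by measurable

lemma gauss_pos: "0 < gauss L w" and gauss_le_1: "gauss L w \<le> 1"
  by (auto simp: gauss_def divide_nonpos_nonneg)

lemma nn_integral_gauss:
  assumes L: "0 < L"
  shows "(\<integral>\<^sup>+w. gauss L (w :: real^'n::finite) \<partial>lborel) = ennreal ((L * sqrt (2 * pi)) ^ CARD('n))"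
proof -
  have i1: "integrable lborel (\<lambda>x::real. exp (- (x\<^sup>2) / (2 * L\<^sup>2)))"
    using integrable_norm[OF integral_exp_gaussian_real(1)[OF L, of 0]] by simp
  have "complex_of_real (LINT x|lborel. exp (- (x\<^sup>2) / (2 * L\<^sup>2))) = complex_of_real (L * sqrt (2 * pi))"
    using integral_exp_gaussian_real(2)[OF L, of 0] by simp
  then have "(LINT x|lborel. exp (- (x\<^sup>2) / (2 * L\<^sup>2))) = L * sqrt (2 * pi)"
    using of_real_eq_iff by blast
  then have "(\<integral>\<^sup>+x. exp (- (x\<^sup>2) / (2 * L\<^sup>2)) \<partial>lborel) = ennreal (L * sqrt (2 * pi))"
    using nn_integral_eq_integral[OF i1] by simp
  then show ?thesis
    unfolding gauss_prod using nn_integral_lborel_prod_vec[of "\<lambda>_::'n. \<lambda>x. ennreal (exp (- (x\<^sup>2) / (2 * L\<^sup>2)))"] L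
    by (simp add: prod_ennreal ennreal_power)
qed

lemma integrable_gauss: "0 < L \<Longrightarrow> integrable lborel (gauss L :: real^'n::finite \<Rightarrow> real)"
  by (rule integrableI_bounded) (auto simp: nn_integral_gauss gauss_pos less_imp_le)

text \<open>Phase and weight both factor over the coordinates, so the one-dimensional formula
  applies in each of them.\<close>

lemma fourier_gauss:
  fixes w :: "real^'n::finite"
  assumes L: "0 < L"
  shows "(LINT z|lborel. exp (\<i> * complex_of_real (z \<bullet> w)) * complex_of_real (gauss L z))
    = complex_of_real ((L * sqrt (2 * pi)) ^ CARD('n) * gauss (1 / L) w)"
proof -
  have eq: "exp (\<i> * complex_of_real (z \<bullet> w)) * complex_of_real (gauss L z)
     = (\<Prod>i\<in>UNIV. exp (\<i> * complex_of_real (w $ i * z $ i)) * complex_of_real (exp (- ((z $ i)\<^sup>2) / (2 * L\<^sup>2))))" for z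
  proof -
    have "exp (\<i> * complex_of_real (z \<bullet> w)) = (\<Prod>i\<in>UNIV. exp (\<i> * complex_of_real (w $ i * z $ i)))"
      unfolding inner_vec_real by (simp add: exp_sum sum_distrib_left mult_ac)
    then show ?thesis
      unfolding gauss_prod prod.distrib by simp
  qed
  have "(LINT z|lborel. exp (\<i> * complex_of_real (z \<bullet> w)) * complex_of_real (gauss L z))
    = (\<Prod>i\<in>UNIV. complex_of_real (L * sqrt (2 * pi) * exp (- (L\<^sup>2 * (w $ i)\<^sup>2) / 2)))"
    unfolding eq
    by (subst lborel_integral_prod_vec) (use integral_exp_gaussian_real[OF L] in auto)
  also have "\<dots> = complex_of_real (\<Prod>i\<in>UNIV. L * sqrt (2 * pi) * exp (- (L\<^sup>2 * (w $ i)\<^sup>2) / 2))"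
    by simp
  also have "(\<Prod>i\<in>UNIV. L * sqrt (2 * pi) * exp (- (L\<^sup>2 * (w $ i)\<^sup>2) / 2)) = (L * sqrt (2 * pi)) ^ CARD('n) * gauss (1 / L) w"
    unfolding gauss_prod prod.distrib by (simp add: power_divide field_simps)
  finally show ?thesis .
qed

text \<open>Unnormalised, with the sign of the inverse transform.\<close>

definition FT :: "(real^'n::finite \<Rightarrow> complex) \<Rightarrow> real^'n \<Rightarrow> complex" where
  "FT g z = (LINT \<xi>|lborel. exp (\<i> * complex_of_real (z \<bullet> \<xi>)) * g \<xi>)"

lemma FT_measurable [measurable]:
  assumes [measurable]: "g \<in> borel_measurable borel"
  shows "FT g \<in> borel_measurable borel"
  unfolding FT_def by measurable

lemma FT_integrable:
  assumes "integrable lborel g"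
  shows "integrable lborel (\<lambda>\<xi>. exp (\<i> * complex_of_real (z \<bullet> \<xi>)) * g \<xi>)"
proof -
  have [measurable]: "g \<in> borel_measurable borel" using assms by auto
  show ?thesis
    by (rule Bochner_Integration.integrable_bound[OF assms]) (auto simp: norm_mult)
qed

lemma norm_FT_le: "norm (FT g z) \<le> (LINT \<xi>|lborel. norm (g \<xi>))"
  unfolding FT_def by (rule order_trans[OF integral_norm_bound]) (simp add: norm_mult)

lemma integrable_prod_tensor:
  fixes f :: "'a::euclidean_space \<Rightarrow> complex" and g :: "'b::euclidean_space \<Rightarrow> complex"
  assumes f: "integrable lborel f" and g: "integrable lborel g"
  shows "integrable (lborel \<Otimes>\<^sub>M lborel) (\<lambda>p. f (fst p) * g (snd p))"
proof -
  have [measurable]: "f \<in> borel_measurable borel" "g \<in> borel_measurable borel" using f g by auto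
  show ?thesis
  proof (rule lborel_pair.Fubini_integrable)
    show "integrable lborel (\<lambda>x. LINT y|lborel. norm (f (fst (x, y)) * g (snd (x, y))))"
      using f by (simp add: norm_mult)
    show "AE x in lborel. integrable lborel (\<lambda>y. f (fst (x, y)) * g (snd (x, y)))"
      using g by simp
  qed measurable
qed

text \<open>Inserting a Gaussian weight makes all integrals absolutely convergent; the resulting
  positive kernel has mass \<open>(2\<pi>)\<^sup>n\<close>, so the Schur test applies uniformly in the weight.\<close>

lemma FT_bessel:
  fixes g :: "real^'n::finite \<Rightarrow> complex"
  assumes g: "integrable lborel g"
  shows "(\<integral>\<^sup>+z. ennreal ((norm (FT g z))\<^sup>2) \<partial>lborel) \<le> ennreal ((2 * pi) ^ CARD('n)) * (\<integral>\<^sup>+\<xi>. ennreal ((norm (g \<xi>))\<^sup>2) \<partial>lborel)"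
proof -
  let ?P = "lborel \<Otimes>\<^sub>M lborel :: ((real^'n) \<times> (real^'n)) measure"
  let ?B = "ennreal ((2 * pi) ^ CARD('n)) * (\<integral>\<^sup>+\<xi>. ennreal ((norm (g \<xi>))\<^sup>2) \<partial>lborel)"
  have gm [measurable]: "g \<in> borel_measurable borel" using g by auto
  define H where "H p = g (fst p) * cnj (g (snd p))" for p :: "(real^'n) \<times> (real^'n)"
  have gc: "integrable lborel (\<lambda>x. cnj (g x))" using g by simp
  have H: "integrable ?P H"
    unfolding H_def by (rule integrable_prod_tensor[OF g gc])
  have Hm [measurable]: "H \<in> borel_measurable (borel \<Otimes>\<^sub>M borel)"
    unfolding H_def by measurable
  define e :: "real^'n \<Rightarrow> real^'n \<Rightarrow> complex" where "e z w = exp (\<i> * complex_of_real (z \<bullet> w))" for z w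
  have ecnj: "cnj (e z w) = e z (- w)" for z w by (simp add: e_def exp_cnj)
  have eadd: "e z v * e z w = e z (v + w)" for z v w
    by (simp add: e_def inner_add_right distrib_left flip: exp_add)
  have ne: "norm (e z w) = 1" for z w by (simp add: e_def)
  have em [measurable]: "(\<lambda>x. e (f x) (h x)) \<in> borel_measurable M"
    if [measurable]: "f \<in> borel_measurable M" "h \<in> borel_measurable M" for f h and M :: "'b measure"
    unfolding e_def by measurable
  \<comment> \<open>In this double integral \<open>z\<close> survives only in the phase of the
    frequency difference, so integrating against the Gaussian weight replaces the phase by the
    positive kernel \<open>G\<close>.\<close>
  have sq: "complex_of_real ((norm (FT g z))\<^sup>2) = (LINT p|?P. e z (fst p - snd p) * H p)" for z
  proof -
    have i1: "integrable lborel (\<lambda>\<xi>. e z \<xi> * g \<xi>)" using FT_integrable[OF g] by (simp add: e_def)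
    have "complex_of_real ((norm (FT g z))\<^sup>2) = FT g z * cnj (FT g z)"
      by (rule complex_norm_square)
    also have "\<dots> = (LINT \<xi>|lborel. e z \<xi> * g \<xi>) * (LINT \<eta>|lborel. cnj (e z \<eta> * g \<eta>))"
      unfolding FT_def e_def by (simp only: Bochner_Integration.integral_cnj)
    also have "\<dots> = (LINT \<xi>|lborel. LINT \<eta>|lborel. (e z \<xi> * g \<xi>) * cnj (e z \<eta> * g \<eta>))"
      by simp
    also have "\<dots> = (LINT p|?P. (e z (fst p) * g (fst p)) * cnj (e z (snd p) * g (snd p)))"
      using lborel_pair.integral_fst[of "\<lambda>\<xi> \<eta>. (e z \<xi> * g \<xi>) * cnj (e z \<eta> * g \<eta>)"]
        integrable_prod_tensor[OF i1, of "\<lambda>\<eta>. cnj (e z \<eta> * g \<eta>)"] i1 by (simp add: case_prod_unfold del: complex_cnj_mult)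
    also have "\<dots> = (LINT p|?P. e z (fst p - snd p) * H p)"
    proof (rule Bochner_Integration.integral_cong[OF refl])
      fix p :: "(real^'n) \<times> (real^'n)"
      have "(e z (fst p) * g (fst p)) * cnj (e z (snd p) * g (snd p)) = (e z (fst p) * e z (- snd p)) * H p"
        by (simp add: H_def ecnj)
      then show "(e z (fst p) * g (fst p)) * cnj (e z (snd p) * g (snd p)) = e z (fst p - snd p) * H p"
        by (simp add: eadd)
    qed
    finally show ?thesis .
  qed
  have main: "(\<integral>\<^sup>+z. ennreal ((norm (FT g z))\<^sup>2 * gauss L z) \<partial>lborel) \<le> ?B" if L: "0 < L" for L
  proof -
    let ?K = "(L * sqrt (2 * pi)) ^ CARD('n)"
    define G where "G w = ?K * gauss (1 / L) w" for w :: "real^'n"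
    have Gn: "0 \<le> G w" for w using L by (simp add: G_def gauss_pos less_imp_le)
    have Gm [measurable]: "G \<in> borel_measurable borel" unfolding G_def by measurable
    \<comment> \<open>The widths \<open>L\<close> and \<open>1 / L\<close> cancel, so the mass is
      the same for every weight; this makes the final bound independent of \<open>L\<close>.\<close>
    have Gi: "(\<integral>\<^sup>+w. ennreal (G w) \<partial>lborel) = ennreal ((2 * pi) ^ CARD('n))"
    proof -
      have "(\<integral>\<^sup>+w. ennreal (G w) \<partial>lborel) = ennreal ?K * (\<integral>\<^sup>+w. ennreal (gauss (1/L) (w :: real^'n)) \<partial>lborel)"
        unfolding G_def using L by (simp add: ennreal_mult' nn_integral_cmult)
      also have "\<dots> = ennreal (?K * ((1/L) * sqrt (2 * pi)) ^ CARD('n))"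
        using L by (simp add: nn_integral_gauss ennreal_mult')
      also have "?K * ((1/L) * sqrt (2 * pi)) ^ CARD('n) = (2 * pi) ^ CARD('n)"
      proof -
        have "(L * sqrt (2 * pi)) * ((1/L) * sqrt (2 * pi)) = 2 * pi"
          using L by (simp add: mult.assoc[symmetric])
        then show ?thesis by (metis power_mult_distrib)
      qed
      finally show ?thesis .
    qed
    \<comment> \<open>The inequality of arithmetic and geometric means splits the product into
      summands depending on one frequency each, so that the other frequency can be integrated out
      against \<open>G\<close>.\<close>
    have Pb: "ennreal (norm (H p * complex_of_real (G (fst p - snd p)))) \<le> ennreal (((norm (g (fst p)))\<^sup>2 + (norm (g (snd p)))\<^sup>2) / 2 * G (fst p - snd p))" for p
    proof -
      have "norm (g (fst p)) * norm (g (snd p)) \<le> ((norm (g (fst p)))\<^sup>2 + (norm (g (snd p)))\<^sup>2) / 2"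
        using sum_squares_bound[of "norm (g (fst p))" "norm (g (snd p))"] by simp
      from mult_right_mono[OF this Gn[of "fst p - snd p"]] show ?thesis
        by (intro ennreal_leI) (simp only: H_def norm_mult norm_of_real complex_mod_cnj abs_of_nonneg[OF Gn])
    qed
    have trip: "integrable (lborel \<Otimes>\<^sub>M ?P) (\<lambda>(z, p). (e z (fst p - snd p) * H p) * complex_of_real (gauss L z))"
    proof -
      have "integrable (lborel \<Otimes>\<^sub>M (lborel :: ((real^'n) \<times> (real^'n)) measure)) (\<lambda>q. complex_of_real (gauss L (fst q)) * H (snd q))"
        by (rule integrable_prod_tensor) (use H in \<open>auto simp: integrable_gauss L lborel_prod\<close>)
      then have i: "integrable (lborel \<Otimes>\<^sub>M ?P) (\<lambda>q. complex_of_real (gauss L (fst q)) * H (snd q))"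
        by (simp add: lborel_prod)
      show ?thesis
        by (rule Bochner_Integration.integrable_bound[OF i]) (auto simp: norm_mult ne case_prod_unfold)
    qed
    interpret PP: pair_sigma_finite "lborel :: (real^'n) measure" ?P
      unfolding lborel_prod by (rule lborel_pair.pair_sigma_finite_axioms)
    have fin: "integrable lborel (\<lambda>z. complex_of_real ((norm (FT g z))\<^sup>2 * gauss L z))"
    proof -
      have "integrable lborel (\<lambda>z. LINT p|?P. (e z (fst p - snd p) * H p) * complex_of_real (gauss L z))"
        using PP.integrable_fst'[OF trip] by (simp add: case_prod_unfold)
      then show ?thesis by (simp only: of_real_mult sq integral_mult_left_zero)
    qed
    have "complex_of_real (LINT z|lborel. (norm (FT g z))\<^sup>2 * gauss L z)
        = (LINT z|lborel. complex_of_real ((norm (FT g z))\<^sup>2 * gauss L z))"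
      by (rule integral_complex_of_real[symmetric])
    also have "\<dots> = (LINT z|lborel. LINT p|?P. (e z (fst p - snd p) * H p) * complex_of_real (gauss L z))"
      by (simp only: of_real_mult sq integral_mult_left_zero)
    also have "\<dots> = (LINT p|?P. LINT z|lborel. (e z (fst p - snd p) * H p) * complex_of_real (gauss L z))"
      using PP.Fubini_integral[OF trip] by simp
    also have "\<dots> = (LINT p|?P. H p * complex_of_real (G (fst p - snd p)))"
    proof (rule Bochner_Integration.integral_cong[OF refl])
      fix p :: "(real^'n) \<times> (real^'n)"
      have "(LINT z|lborel. (e z (fst p - snd p) * H p) * complex_of_real (gauss L z))
          = (LINT z|lborel. H p * (e z (fst p - snd p) * complex_of_real (gauss L z)))"
        by (simp add: mult_ac)
      also have "\<dots> = H p * (LINT z|lborel. e z (fst p - snd p) * complex_of_real (gauss L z))"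
        by (rule integral_mult_right_zero)
      finally show "(LINT z|lborel. (e z (fst p - snd p) * H p) * complex_of_real (gauss L z)) = H p * complex_of_real (G (fst p - snd p))"
        unfolding e_def fourier_gauss[OF L] G_def .
    qed
    finally have eq: "complex_of_real (LINT z|lborel. (norm (FT g z))\<^sup>2 * gauss L z) = (LINT p|?P. H p * complex_of_real (G (fst p - snd p)))" .
    have r: "integrable lborel (\<lambda>z. (norm (FT g z))\<^sup>2 * gauss L z)"
      using fin by (simp only: complex_of_real_integrable_eq)
    have "(\<integral>\<^sup>+z. ennreal ((norm (FT g z))\<^sup>2 * gauss L z) \<partial>lborel) = ennreal (LINT z|lborel. (norm (FT g z))\<^sup>2 * gauss L z)"
      by (rule nn_integral_eq_integral[OF r]) (simp add: gauss_pos less_imp_le)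
    also have "\<dots> \<le> ennreal (norm (complex_of_real (LINT z|lborel. (norm (FT g z))\<^sup>2 * gauss L z)))"
      by (rule ennreal_leI) simp
    also have "\<dots> = ennreal (norm (LINT p|?P. H p * complex_of_real (G (fst p - snd p))))"
      by (simp only: eq)
    also have "\<dots> \<le> (\<integral>\<^sup>+p. ennreal (norm (H p * complex_of_real (G (fst p - snd p)))) \<partial>?P)"
    \<comment> \<open>Without integrability the Bochner integral is 0 by convention, and the
      inequality is trivial.\<close>
    proof (cases "integrable ?P (\<lambda>p. H p * complex_of_real (G (fst p - snd p)))")
      case True then show ?thesis by (rule integral_norm_bound_ennreal)
    next
      case False then show ?thesis by (simp add: not_integrable_integral_eq)
    qed
    also have "\<dots> \<le> (\<integral>\<^sup>+p. ennreal (((norm (g (fst p)))\<^sup>2 + (norm (g (snd p)))\<^sup>2) / 2 * G (fst p - snd p)) \<partial>?P)"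
      by (intro nn_integral_mono Pb)
    also have "\<dots> = (\<integral>\<^sup>+p. ennreal ((norm (g (fst p)))\<^sup>2 / 2) * ennreal (G (fst p - snd p)) + ennreal ((norm (g (snd p)))\<^sup>2 / 2) * ennreal (G (fst p - snd p)) \<partial>?P)"
      by (intro nn_integral_cong) (simp add: Gn add_divide_distrib distrib_right flip: ennreal_mult' ennreal_plus)
    also have "\<dots> = (\<integral>\<^sup>+p. ennreal ((norm (g (fst p)))\<^sup>2 / 2) * ennreal (G (fst p - snd p)) \<partial>?P) + (\<integral>\<^sup>+p. ennreal ((norm (g (snd p)))\<^sup>2 / 2) * ennreal (G (fst p - snd p)) \<partial>?P)"
      by (rule nn_integral_add) measurable
    also have "(\<integral>\<^sup>+p. ennreal ((norm (g (fst p)))\<^sup>2 / 2) * ennreal (G (fst p - snd p)) \<partial>?P) = (\<integral>\<^sup>+x. (\<integral>\<^sup>+y. ennreal ((norm (g x))\<^sup>2 / 2) * ennreal (G (x - y)) \<partial>lborel) \<partial>lborel)"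
      by (subst lborel.nn_integral_fst[symmetric]) auto
    also have "\<dots> = (\<integral>\<^sup>+x. ennreal ((norm (g x))\<^sup>2 / 2) * ennreal ((2 * pi) ^ CARD('n)) \<partial>lborel)"
    proof (intro nn_integral_cong)
      fix x
      have "(\<integral>\<^sup>+y. ennreal (G (x - y)) \<partial>lborel) = (\<integral>\<^sup>+y. ennreal (G y) \<partial>lborel)"
        using lborel_distr_plus[of x]
        by (subst lborel_affine[of "-1" x, THEN trans, OF _ refl]) (auto simp: nn_integral_density nn_integral_distr)
      then show "(\<integral>\<^sup>+y. ennreal ((norm (g x))\<^sup>2 / 2) * ennreal (G (x - y)) \<partial>lborel) = ennreal ((norm (g x))\<^sup>2 / 2) * ennreal ((2 * pi) ^ CARD('n))"
        by (simp add: nn_integral_cmult Gi)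
    qed
    also have "(\<integral>\<^sup>+p. ennreal ((norm (g (snd p)))\<^sup>2 / 2) * ennreal (G (fst p - snd p)) \<partial>?P) = (\<integral>\<^sup>+y. (\<integral>\<^sup>+x. ennreal ((norm (g y))\<^sup>2 / 2) * ennreal (G (x - y)) \<partial>lborel) \<partial>lborel)"
      by (subst lborel_pair.nn_integral_snd[symmetric]) auto
    also have "\<dots> = (\<integral>\<^sup>+x. ennreal ((norm (g x))\<^sup>2 / 2) * ennreal ((2 * pi) ^ CARD('n)) \<partial>lborel)"
    proof (intro nn_integral_cong)
      fix y
      have "(\<integral>\<^sup>+x. ennreal (G (x - y)) \<partial>lborel) = (\<integral>\<^sup>+x. ennreal (G x) \<partial>lborel)"
        by (subst lborel_affine[of 1 y, THEN trans, OF _ refl]) (auto simp: nn_integral_density nn_integral_distr)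
      then show "(\<integral>\<^sup>+x. ennreal ((norm (g y))\<^sup>2 / 2) * ennreal (G (x - y)) \<partial>lborel) = ennreal ((norm (g y))\<^sup>2 / 2) * ennreal ((2 * pi) ^ CARD('n))"
        by (simp add: nn_integral_cmult Gi)
    qed
    also have "(\<integral>\<^sup>+x. ennreal ((norm (g x))\<^sup>2 / 2) * ennreal ((2 * pi) ^ CARD('n)) \<partial>lborel) + (\<integral>\<^sup>+x. ennreal ((norm (g x))\<^sup>2 / 2) * ennreal ((2 * pi) ^ CARD('n)) \<partial>lborel)
       = (\<integral>\<^sup>+x. ennreal ((norm (g x))\<^sup>2 / 2) * ennreal ((2 * pi) ^ CARD('n)) + ennreal ((norm (g x))\<^sup>2 / 2) * ennreal ((2 * pi) ^ CARD('n)) \<partial>lborel)"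
      by (rule nn_integral_add[symmetric]) measurable
    also have "\<dots> = (\<integral>\<^sup>+x. ennreal ((2 * pi) ^ CARD('n)) * ennreal ((norm (g x))\<^sup>2) \<partial>lborel)"
      by (intro nn_integral_cong) (simp flip: ennreal_mult ennreal_plus)
    also have "\<dots> = ?B"
      by (rule nn_integral_cmult) measurable
    finally show ?thesis .
  qed
  have "(\<integral>\<^sup>+z. ennreal ((norm (FT g z))\<^sup>2) \<partial>lborel) = (\<integral>\<^sup>+z. liminf (\<lambda>k. ennreal ((norm (FT g z))\<^sup>2 * gauss (real (Suc k)) z)) \<partial>lborel)"
  proof (intro nn_integral_cong)
    fix z :: "real^'n"
    have "(\<lambda>k. exp (- (norm z)\<^sup>2 / (2 * (real (Suc k))\<^sup>2))) \<longlonglongrightarrow> exp 0"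
      by (intro tendsto_intros) real_asymp
    then have "(\<lambda>k. ennreal ((norm (FT g z))\<^sup>2 * gauss (real (Suc k)) z)) \<longlonglongrightarrow> ennreal ((norm (FT g z))\<^sup>2 * exp 0)"
      unfolding gauss_def by (intro tendsto_ennrealI tendsto_mult tendsto_const)
    then show "ennreal ((norm (FT g z))\<^sup>2) = liminf (\<lambda>k. ennreal ((norm (FT g z))\<^sup>2 * gauss (real (Suc k)) z))"
      by (simp add: lim_imp_Liminf)
  qed
  \<comment> \<open>Fatou's lemma removes the weight along the widths \<open>Suc k\<close>, which
    are positive as \<open>main\<close> demands.\<close>
  also have "\<dots> \<le> liminf (\<lambda>k. \<integral>\<^sup>+z. ennreal ((norm (FT g z))\<^sup>2 * gauss (real (Suc k)) z) \<partial>lborel)"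
    by (rule nn_integral_liminf) measurable
  also have "\<dots> \<le> ?B"
    by (intro Liminf_le always_eventually allI main) auto
  finally show ?thesis .
qed

section \<open>Symbols in one frequency direction\<close>

lemma japanese_ge_1: "1 \<le> japanese \<xi>"
  by (simp add: japanese_def)

lemma japanese_pos: "0 < japanese \<xi>"
  using japanese_ge_1[of \<xi>] by linarith

lemma japanese_neq_0 [simp]: "japanese \<xi> \<noteq> 0"
  using japanese_pos[of \<xi>] by simp

lemma japanese_sq: "(japanese \<xi>)\<^sup>2 = 1 + (norm \<xi>)\<^sup>2"
  by (simp add: japanese_def)

lemma norm_le_japanese: "norm \<xi> \<le> japanese \<xi>"
  unfolding japanese_def by (rule real_le_rsqrt) simp

lemma continuous_on_japanese [continuous_intros]:
  "continuous_on S f \<Longrightarrow> continuous_on S (\<lambda>x. japanese (f x))"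
  unfolding japanese_def by (intro continuous_intros)

lemma japanese_measurable [measurable]: "japanese \<in> borel_measurable borel"
  unfolding japanese_def by measurable

lemma japanese_powr_mono: "a \<le> b \<Longrightarrow> japanese \<xi> powr a \<le> japanese \<xi> powr b"
  by (rule powr_mono[OF _ japanese_ge_1])

lemma integrable_inverse_one_plus_square: "integrable lborel (\<lambda>x::real. 1 / (1 + x\<^sup>2))"
proof -
  define F where "F x = indicator {0<..} x * (1 / (1 + x\<^sup>2))" for x :: real
  have F: "integrable lborel F"
    using integrable_I0i_1_div_plus_square
    by (simp add: interval_lebesgue_integrable_def set_integrable_def F_def[abs_def] einterval_eq zero_ereal_def)
  then have F': "integrable lborel (\<lambda>x. F (0 + (-1) * x))"
    by (intro lborel_integrable_real_affine) auto
  \<comment> \<open>\<open>F\<close> lives on the open half line; its reflection covers the other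
    half and the indicator supplies the origin.\<close>
  have "integrable lborel (\<lambda>x::real. F x + F (0 + (-1) * x) + indicator {0} x)"
    by (intro Bochner_Integration.integrable_add F F') (auto intro!: integrable_real_indicator)
  then show ?thesis
    by (rule Bochner_Integration.integrable_bound) (auto simp: F_def indicator_def)
qed

text \<open>With this exponent the decay splits over the coordinates: (1 + |\<xi>|^2)^(-n) is at
  most the product of the 1/(1 + \<xi>_i^2). Order -2n is the standard integrable decay from here
  on.\<close>

lemma integrable_japanese_powr:
  "integrable lborel (\<lambda>\<xi>::real^'n::finite. japanese \<xi> powr (- 2 * real CARD('n)))"
proof (rule integrableI_bounded)
  have bd: "japanese \<xi> powr (- 2 * real CARD('n)) \<le> (\<Prod>i\<in>UNIV. 1 / (1 + (\<xi> $ i)\<^sup>2))" for \<xi> :: "real^'n"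
  proof -
    have "japanese \<xi> powr (- 2 * real CARD('n)) = ((japanese \<xi>)\<^sup>2) powr (- real CARD('n))"
      using japanese_pos[of \<xi>] by (simp add: powr_powr flip: powr_numeral)
    also have "\<dots> = (\<Prod>i\<in>(UNIV::'n set). 1 / (1 + (norm \<xi>)\<^sup>2))"
      unfolding japanese_sq by (simp add: powr_minus powr_realpow add_pos_nonneg divide_inverse power_inverse)
    also have "\<dots> \<le> (\<Prod>i\<in>UNIV. 1 / (1 + (\<xi> $ i)\<^sup>2))"
    proof (intro prod_mono conjI)
      fix i
      have "(\<xi> $ i)\<^sup>2 \<le> (norm \<xi>)\<^sup>2"
        using component_le_norm_cart[of \<xi> i] by (simp add: abs_le_square_iff[symmetric])
      then show "1 / (1 + (norm \<xi>)\<^sup>2) \<le> 1 / (1 + (\<xi> $ i)\<^sup>2)"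
        by (intro divide_left_mono) (auto simp: add_pos_nonneg)
    qed auto
    finally show ?thesis .
  qed
  have "(\<integral>\<^sup>+\<xi>. ennreal (norm (japanese \<xi> powr (- 2 * real CARD('n)))) \<partial>(lborel :: (real^'n) measure))
     \<le> (\<integral>\<^sup>+\<xi>. (\<Prod>i\<in>UNIV. ennreal (1 / (1 + (\<xi> $ i)\<^sup>2))) \<partial>(lborel :: (real^'n) measure))"
    by (intro nn_integral_mono) (use bd in \<open>simp add: prod_ennreal ennreal_leI\<close>)
  also have "\<dots> = (\<Prod>i\<in>(UNIV::'n set). \<integral>\<^sup>+t. ennreal (1 / (1 + t\<^sup>2)) \<partial>lborel)"
    by (rule nn_integral_lborel_prod_vec[of "\<lambda>_ t. ennreal (1 / (1 + t\<^sup>2))"]) measurable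
  also have "\<dots> < \<infinity>"
    using integrable_inverse_one_plus_square
    by (simp add: integrable_iff_bounded power_less_top_ennreal)
  finally show "(\<integral>\<^sup>+\<xi>. ennreal (norm (japanese \<xi> powr (- 2 * real CARD('n)))) \<partial>(lborel :: (real^'n) measure)) < \<infinity>" .
qed measurable

lemma has_vector_derivative_at_0_iff:
  fixes f :: "real \<Rightarrow> complex"
  shows "(f has_vector_derivative d) (at 0) \<longleftrightarrow> ((\<lambda>t. (f t - f 0) /\<^sub>R t) \<longlongrightarrow> d) (at 0)"
  by (simp add: has_vector_derivative_complex_iff has_field_derivative_iff tendsto_complex_iff divide_inverse mult.commute)

text \<open>Differentiation under the integral sign: by the mean value bound \<open>w\<close>
  dominates every difference quotient, and dominated convergence is applied along sequences tending
  to 0. The domination is asked for |t| < 1 only, since symbols are comparable under bounded shifts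
  but not under all shifts.\<close>

lemma has_vector_derivative_integral:
  fixes h h' :: "real \<Rightarrow> 'a::euclidean_space \<Rightarrow> complex"
  assumes der: "\<And>t x. \<bar>t\<bar> < 1 \<Longrightarrow> ((\<lambda>s. h s x) has_vector_derivative h' t x) (at t)"
    and bd: "\<And>t x. \<bar>t\<bar> < 1 \<Longrightarrow> norm (h' t x) \<le> w x"
    and w: "integrable lborel w"
    and h: "\<And>t. \<bar>t\<bar> < 1 \<Longrightarrow> integrable lborel (h t)"
    and m: "h' 0 \<in> borel_measurable lborel"
  shows "((\<lambda>t. LINT x|lborel. h t x) has_vector_derivative (LINT x|lborel. h' 0 x)) (at 0)"
proof -
  let ?S = "{-1<..<1::real}"
  let ?F = "\<lambda>t. LINT x|lborel. h t x"
  have lip: "norm (h s x - h 0 x) \<le> w x * \<bar>s\<bar>" if s: "s \<in> ?S" for s x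
  proof -
    have "norm (h s x - h 0 x) \<le> w x * norm (s - 0)"
    proof (rule differentiable_bound[where S="?S" and f'="\<lambda>t r. r *\<^sub>R h' t x"])
      fix t assume "t \<in> ?S"
      then have "\<bar>t\<bar> < 1" by auto
      from der[OF this, of x] show "((\<lambda>s. h s x) has_derivative (\<lambda>r. r *\<^sub>R h' t x)) (at t within ?S)"
        unfolding has_vector_derivative_def by (rule has_derivative_at_withinI)
      show "onorm (\<lambda>r. r *\<^sub>R h' t x) \<le> w x"
        using bd[OF \<open>\<bar>t\<bar> < 1\<close>, of x] by (intro onorm_le) (simp add: mult.commute mult_left_mono)
    qed (use s in auto)
    then show ?thesis by simp
  qed
  have "((\<lambda>t. (?F t - ?F 0) /\<^sub>R (t - 0)) \<longlongrightarrow> (LINT x|lborel. h' 0 x)) (at 0 within ?S)"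
    unfolding tendsto_at_iff_sequentially
  proof (intro allI impI)
    fix X :: "nat \<Rightarrow> real" assume X: "\<forall>i. X i \<in> ?S - {0}" and X0: "X \<longlonglongrightarrow> 0"
    have Xi: "\<bar>X i\<bar> < 1" "X i \<noteq> 0" "X i \<in> ?S" for i using X[rule_format, of i] by auto
    have "(\<lambda>i. LINT x|lborel. (h (X i) x - h 0 x) /\<^sub>R X i) \<longlonglongrightarrow> (LINT x|lborel. h' 0 x)"
    proof (rule integral_dominated_convergence[where w=w])
      show "AE x in lborel. (\<lambda>i. (h (X i) x - h 0 x) /\<^sub>R X i) \<longlonglongrightarrow> h' 0 x"
      proof (rule AE_I2)
        fix x
        have "((\<lambda>t. (h t x - h 0 x) /\<^sub>R (t - 0)) \<longlongrightarrow> h' 0 x) (at 0)"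
          using der[of 0 x] by (simp add: has_vector_derivative_at_0_iff)
        then show "(\<lambda>i. (h (X i) x - h 0 x) /\<^sub>R X i) \<longlonglongrightarrow> h' 0 x"
          unfolding tendsto_at_iff_sequentially using Xi X0 by (auto simp: o_def)
      qed
      show "AE x in lborel. norm ((h (X i) x - h 0 x) /\<^sub>R X i) \<le> w x" for i
        using lip[OF Xi(3)[of i]] Xi(2)[of i] by (intro AE_I2) (simp add: divide_simps)
      have [measurable]: "h t \<in> borel_measurable lborel" if "\<bar>t\<bar> < 1" for t using h[OF that] by auto
      show "(\<lambda>x. (h (X i) x - h 0 x) /\<^sub>R X i) \<in> borel_measurable lborel" for i
        using Xi(1)[of i] by (intro borel_measurable_scaleR borel_measurable_diff borel_measurable_const) auto
    qed (use w m in auto)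
    moreover have "(LINT x|lborel. (h (X i) x - h 0 x) /\<^sub>R X i) = (?F (X i) - ?F 0) /\<^sub>R (X i - 0)" for i
      using h[OF Xi(1)[of i]] h[of 0] by simp
    ultimately show "((\<lambda>t. (?F t - ?F 0) /\<^sub>R (t - 0)) \<circ> X) \<longlonglongrightarrow> (LINT x|lborel. h' 0 x)"
      by (simp only: o_def)
  qed
  then have "((\<lambda>t. (?F t - ?F 0) /\<^sub>R (t - 0)) \<longlongrightarrow> (LINT x|lborel. h' 0 x)) (at 0)"
    by (subst (asm) at_within_open) auto
  then show ?thesis
    by (simp add: has_vector_derivative_at_0_iff)
qed

text \<open>Only derivatives along the axis \<open>i\<close> are controlled: the powers \<open>|z\<^sub>i|\<^sup>N\<close> obtained from them
  already dominate \<open>|z|\<^sup>N\<close>.\<close>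

primrec symb :: "real \<Rightarrow> 'n::finite \<Rightarrow> nat \<Rightarrow> real \<Rightarrow> real \<Rightarrow> (real^'n \<Rightarrow> complex) \<Rightarrow> bool" where
  "symb \<rho> i 0 A \<mu> g \<longleftrightarrow> continuous_on UNIV g \<and> (\<forall>\<xi>. norm (g \<xi>) \<le> A * japanese \<xi> powr \<mu>)"
| "symb \<rho> i (Suc N) A \<mu> g \<longleftrightarrow> continuous_on UNIV g \<and> (\<forall>\<xi>. norm (g \<xi>) \<le> A * japanese \<xi> powr \<mu>) \<and>
     (\<forall>\<xi>. (\<lambda>t. g (\<xi> + t *\<^sub>R axis i 1)) differentiable (at 0)) \<and> symb \<rho> i N A (\<mu> - \<rho>) (partial_deriv i g)"

lemma symb_bound: "symb \<rho> i N A \<mu> g \<Longrightarrow> norm (g \<xi>) \<le> A * japanese \<xi> powr \<mu>"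
  by (cases N) auto

lemma symb_cont: "symb \<rho> i N A \<mu> g \<Longrightarrow> continuous_on UNIV g"
  by (cases N) auto

lemma symb_measurable: "symb \<rho> i N A \<mu> g \<Longrightarrow> g \<in> borel_measurable borel"
  by (intro borel_measurable_continuous_onI symb_cont)

lemma symb_nonneg:
  fixes g :: "real^'n::finite \<Rightarrow> complex"
  assumes "symb \<rho> i N A \<mu> g" shows "0 \<le> A"
proof -
  have "0 \<le> A * japanese (0 :: real^'n) powr \<mu>" using order_trans[OF norm_ge_zero symb_bound[OF assms, of 0]] .
  then show ?thesis by (simp add: japanese_def)
qed

lemma symb_mono:
  fixes g :: "real^'n::finite \<Rightarrow> complex"
  assumes "symb \<rho> i N A \<mu> g" "A \<le> B" "\<mu> \<le> \<nu>"
  shows "symb \<rho> i N B \<nu> g"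
proof -
  have le: "A * japanese \<xi> powr \<mu>' \<le> B * japanese \<xi> powr \<nu>'" if "\<mu>' \<le> \<nu>'" for \<xi> :: "real^'n" and \<mu>' \<nu>'
    using symb_nonneg[OF assms(1)] assms(2) that by (intro mult_mono japanese_powr_mono) auto
  show ?thesis using assms(1,3)
  proof (induction N arbitrary: g \<mu> \<nu>)
    case 0
    have "norm (g \<xi>) \<le> B * japanese \<xi> powr \<nu>" for \<xi>
      using symb_bound[OF 0(1)] le[OF 0(2)] by (rule order_trans)
    then show ?case using symb_cont[OF 0(1)] by simp
  next
    case (Suc N)
    then have "symb \<rho> i N B (\<nu> - \<rho>) (partial_deriv i g)" by (intro Suc.IH[of "\<mu> - \<rho>"]) auto
    moreover have "norm (g \<xi>) \<le> B * japanese \<xi> powr \<nu>" for \<xi>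
      using symb_bound[OF Suc.prems(1)] le[OF Suc.prems(2)] by (rule order_trans)
    ultimately show ?case using Suc.prems(1) by simp
  qed
qed

lemma symb_SucD: "symb \<rho> i (Suc N) A \<mu> g \<Longrightarrow> symb \<rho> i N A \<mu> g"
  by (induction N arbitrary: g \<mu>) auto

lemma symb_le: "symb \<rho> i N A \<mu> g \<Longrightarrow> M \<le> N \<Longrightarrow> symb \<rho> i M A \<mu> g"
proof (induction N)
  case (Suc N) then show ?case using symb_SucD[of \<rho> i N A \<mu> g] by (cases "M = Suc N") auto
qed auto

lemma symb_SucE:
  assumes "symb \<rho> i (Suc N) A \<mu> g"
  shows "((\<lambda>t. g (\<xi> + t *\<^sub>R axis i 1)) has_vector_derivative partial_deriv i g \<xi>) (at 0)"
    and "symb \<rho> i N A (\<mu> - \<rho>) (partial_deriv i g)"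
  using assms by (auto simp: partial_deriv_def vector_derivative_works)

lemma symb_SucI:
  assumes "continuous_on UNIV g" "\<And>\<xi>. norm (g \<xi>) \<le> A * japanese \<xi> powr \<mu>"
    and "\<And>\<xi>. ((\<lambda>t. g (\<xi> + t *\<^sub>R axis i 1)) has_vector_derivative g' \<xi>) (at 0)"
    and "symb \<rho> i N A (\<mu> - \<rho>) g'"
  shows "symb \<rho> i (Suc N) A \<mu> g"
proof -
  have "partial_deriv i g = g'"
    unfolding partial_deriv_def using assms(3) by (intro ext vector_derivative_at)
  moreover have "(\<lambda>t. g (\<xi> + t *\<^sub>R axis i 1)) differentiable (at 0)" for \<xi>
    using assms(3)[of \<xi>] by (rule differentiableI_vector)
  ultimately show ?thesis using assms by auto
qed

lemma symb_add:
  "symb \<rho> i N A \<mu> g \<Longrightarrow> symb \<rho> i N B \<mu> h \<Longrightarrow> symb \<rho> i N (A + B) \<mu> (\<lambda>\<xi>. g \<xi> + h \<xi>)"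
proof (induction N arbitrary: g h \<mu>)
  case 0
  then show ?case by (auto intro!: continuous_intros norm_triangle_le simp: distrib_right add_mono)
next
  case (Suc N)
  show ?case
  proof (rule symb_SucI[where g'="\<lambda>\<xi>. partial_deriv i g \<xi> + partial_deriv i h \<xi>"])
    show "symb \<rho> i N (A + B) (\<mu> - \<rho>) (\<lambda>\<xi>. partial_deriv i g \<xi> + partial_deriv i h \<xi>)"
      by (intro Suc.IH symb_SucE Suc.prems)
    show "norm (g \<xi> + h \<xi>) \<le> (A + B) * japanese \<xi> powr \<mu>" for \<xi>
      using symb_bound[OF Suc.prems(1), of \<xi>] symb_bound[OF Suc.prems(2), of \<xi>] norm_triangle_ineq[of "g \<xi>" "h \<xi>"]
      by (simp add: distrib_right)
    show "((\<lambda>t. g (\<xi> + t *\<^sub>R axis i 1) + h (\<xi> + t *\<^sub>R axis i 1)) has_vector_derivative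
         partial_deriv i g \<xi> + partial_deriv i h \<xi>) (at 0)" for \<xi>
      by (rule has_vector_derivative_add[OF symb_SucE(1)[OF Suc.prems(1)] symb_SucE(1)[OF Suc.prems(2)]])
    show "continuous_on UNIV (\<lambda>\<xi>. g \<xi> + h \<xi>)"
      by (intro continuous_intros symb_cont[OF Suc.prems(1)] symb_cont[OF Suc.prems(2)])
  qed
qed

text \<open>By the Leibniz rule every derivative doubles the number of terms; this is the factor
  \<open>2 ^ N\<close>. In each term the undifferentiated factor is used with one derivative
  less.\<close>

lemma symb_mult:
  "symb \<rho> i N A \<mu> g \<Longrightarrow> symb \<rho> i N B \<nu> h \<Longrightarrow> symb \<rho> i N (2 ^ N * A * B) (\<mu> + \<nu>) (\<lambda>\<xi>. g \<xi> * h \<xi>)"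
proof (induction N arbitrary: g h \<mu> \<nu>)
  case 0
  have "norm (g \<xi> * h \<xi>) \<le> A * B * japanese \<xi> powr (\<mu> + \<nu>)" for \<xi>
    using mult_mono'[OF symb_bound[OF 0(1), of \<xi>] symb_bound[OF 0(2), of \<xi>]]
    by (simp add: norm_mult powr_add mult_ac)
  then show ?case using 0 by (auto intro!: continuous_intros)
next
  case (Suc N)
  have AB: "0 \<le> A * B" using symb_nonneg[OF Suc.prems(1)] symb_nonneg[OF Suc.prems(2)] by simp
  show ?case
  proof (rule symb_SucI[where g'="\<lambda>\<xi>. g \<xi> * partial_deriv i h \<xi> + partial_deriv i g \<xi> * h \<xi>"])
    have "symb \<rho> i N (2 ^ N * A * B) (\<mu> + (\<nu> - \<rho>)) (\<lambda>\<xi>. g \<xi> * partial_deriv i h \<xi>)"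
      by (rule Suc.IH[OF symb_SucD[OF Suc.prems(1)] symb_SucE(2)[OF Suc.prems(2)]])
    moreover have "symb \<rho> i N (2 ^ N * A * B) ((\<mu> - \<rho>) + \<nu>) (\<lambda>\<xi>. partial_deriv i g \<xi> * h \<xi>)"
      by (rule Suc.IH[OF symb_SucE(2)[OF Suc.prems(1)] symb_SucD[OF Suc.prems(2)]])
    ultimately have "symb \<rho> i N (2 ^ N * A * B + 2 ^ N * A * B) (\<mu> + \<nu> - \<rho>) (\<lambda>\<xi>. g \<xi> * partial_deriv i h \<xi> + partial_deriv i g \<xi> * h \<xi>)"
      by (intro symb_add) (simp_all add: algebra_simps)
    then show "symb \<rho> i N (2 ^ Suc N * A * B) (\<mu> + \<nu> - \<rho>) (\<lambda>\<xi>. g \<xi> * partial_deriv i h \<xi> + partial_deriv i g \<xi> * h \<xi>)"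
      by (simp add: mult_ac)
    show "norm (g \<xi> * h \<xi>) \<le> 2 ^ Suc N * A * B * japanese \<xi> powr (\<mu> + \<nu>)" for \<xi>
    proof -
      have "norm (g \<xi> * h \<xi>) \<le> 1 * (A * B * japanese \<xi> powr (\<mu> + \<nu>))"
        using mult_mono'[OF symb_bound[OF Suc.prems(1), of \<xi>] symb_bound[OF Suc.prems(2), of \<xi>]]
        by (simp add: norm_mult powr_add mult_ac)
      also have "\<dots> \<le> 2 ^ Suc N * (A * B * japanese \<xi> powr (\<mu> + \<nu>))"
        using AB by (intro mult_right_mono one_le_power) auto
      finally show ?thesis by (simp add: mult_ac)
    qed
    show "((\<lambda>t. g (\<xi> + t *\<^sub>R axis i 1) * h (\<xi> + t *\<^sub>R axis i 1)) has_vector_derivative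
         g \<xi> * partial_deriv i h \<xi> + partial_deriv i g \<xi> * h \<xi>) (at 0)" for \<xi>
      using has_vector_derivative_mult[OF symb_SucE(1)[OF Suc.prems(1), of \<xi>] symb_SucE(1)[OF Suc.prems(2), of \<xi>]]
      by simp
    show "continuous_on UNIV (\<lambda>\<xi>. g \<xi> * h \<xi>)"
      by (intro continuous_intros symb_cont[OF Suc.prems(1)] symb_cont[OF Suc.prems(2)])
  qed
qed

lemma symb_const: "symb \<rho> i N (norm c) 0 (\<lambda>\<xi>. c)"
proof -
  have pd: "partial_deriv i (\<lambda>\<xi>. c) = (\<lambda>\<xi>. 0)" for c
    by (simp add: partial_deriv_def fun_eq_iff)
  have z: "symb \<rho> i N A \<mu> (\<lambda>\<xi>. 0)" if "0 \<le> A" for N \<mu> and A :: real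
    using that by (induction N arbitrary: \<mu>) (auto simp: pd)
  show ?thesis
  proof (cases N)
    case (Suc N')
    then show ?thesis using z[of "norm c" N' "0 - \<rho>"] japanese_pos by (auto simp: pd)
  qed (use japanese_pos in auto)
qed

text \<open>The factor \<open>2 ^ N\<close> is inherited from \<open>symb_mult\<close>, applied to
  the constant as a symbol of order 0.\<close>

lemma symb_cmult: "symb \<rho> i N A \<mu> g \<Longrightarrow> symb \<rho> i N (2 ^ N * norm c * A) \<mu> (\<lambda>\<xi>. c * g \<xi>)"
  using symb_mult[OF symb_const] by fastforce

lemma symb_diff:
  assumes "symb \<rho> i N A \<mu> g" "symb \<rho> i N B \<mu> h"
  shows "symb \<rho> i N (A + 2 ^ N * B) \<mu> (\<lambda>\<xi>. g \<xi> - h \<xi>)"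
  using symb_add[OF assms(1) symb_cmult[OF assms(2), of "-1"]] by simp

text \<open>The derivative of a coordinate is constant, of order 0; it fits into order 1 - \<rho>
  because \<rho> \<le> 1.\<close>

lemma symb_coord:
  fixes i k :: "'n::finite"
  assumes "\<rho> \<le> 1"
  shows "symb \<rho> i N 1 1 (\<lambda>\<xi>. complex_of_real (\<xi> $ k))"
proof -
  have b: "norm (complex_of_real (\<xi> $ k)) \<le> 1 * japanese \<xi> powr 1" for \<xi> :: "real^'n"
    using component_le_norm_cart[of \<xi> k] norm_le_japanese[of \<xi>] japanese_pos[of \<xi>] by simp
  have c: "continuous_on UNIV (\<lambda>\<xi>::real^'n. complex_of_real (\<xi> $ k))" by (intro continuous_intros)
  show ?thesis
  proof (cases N)
    case (Suc N')
    show ?thesis unfolding Suc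
    proof (rule symb_SucI[OF c b])
      show "symb \<rho> i N' 1 (1 - \<rho>) (\<lambda>\<xi>. complex_of_real (axis i 1 $ k))"
        by (rule symb_mono[OF symb_const]) (use assms in \<open>auto simp: axis_def\<close>)
      show "((\<lambda>t. complex_of_real ((\<xi> + t *\<^sub>R axis i 1) $ k)) has_vector_derivative complex_of_real (axis i 1 $ k)) (at 0)" for \<xi> :: "real^'n"
        by (auto intro!: derivative_eq_intros simp: has_vector_derivative_complex_iff)
    qed
  qed (use b c in auto)
qed

lemma symb_power:
  assumes "symb \<rho> i N A \<mu> g"
  shows "symb \<rho> i N ((2 ^ N) ^ M * A ^ Suc M) (real (Suc M) * \<mu>) (\<lambda>\<xi>. g \<xi> ^ Suc M)"
proof (induction M)
  case 0
  show ?case using assms by simp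
next
  case (Suc M)
  have "symb \<rho> i N (2 ^ N * A * ((2 ^ N) ^ M * A ^ Suc M)) (\<mu> + real (Suc M) * \<mu>) (\<lambda>\<xi>. g \<xi> * g \<xi> ^ Suc M)"
    by (intro symb_mult assms Suc)
  then show ?case by (simp add: algebra_simps)
qed

lemma symb_funpow_bound:
  assumes "symb \<rho> i N A \<mu> g" "k \<le> N"
  shows "norm ((partial_deriv i ^^ k) g \<xi>) \<le> A * japanese \<xi> powr (\<mu> - \<rho> * real k)"
  using assms
proof (induction N arbitrary: g \<mu> k)
  case 0 then show ?case by simp
next
  case (Suc N)
  show ?case
  proof (cases k)
    case 0 then show ?thesis using symb_bound[OF Suc.prems(1)] by simp
  next
    case (Suc k')
    then show ?thesis using Suc.IH[OF symb_SucE(2)[OF Suc.prems(1)], of k'] Suc.prems(2)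
      by (simp add: funpow_swap1 algebra_simps)
  qed
qed

lemma symb_funpow:
  assumes "symb \<rho> i N A \<mu> g" "k \<le> N"
  shows "symb \<rho> i (N - k) A (\<mu> - \<rho> * real k) ((partial_deriv i ^^ k) g)"
  using assms
proof (induction N arbitrary: g \<mu> k)
  case 0 then show ?case by simp
next
  case (Suc N)
  show ?case
  proof (cases k)
    case 0 then show ?thesis using Suc.prems(1) by simp
  next
    case (Suc k')
    then show ?thesis using Suc.IH[OF symb_SucE(2)[OF Suc.prems(1)], of k'] Suc.prems(2)
      by (simp add: funpow_swap1 algebra_simps)
  qed
qed

text \<open>Unrolls the recursion of \<open>symb\<close> into conditions on the iterated
  derivatives, the form in which smooth symbols and test functions supply them.\<close>

lemma symb_of_funpow:
  assumes "\<And>k. k \<le> N \<Longrightarrow> continuous_on UNIV ((partial_deriv i ^^ k) g)"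
    and "\<And>k \<xi>. k \<le> N \<Longrightarrow> norm ((partial_deriv i ^^ k) g \<xi>) \<le> A * japanese \<xi> powr (\<mu> - \<rho> * real k)"
    and "\<And>k \<xi>. k < N \<Longrightarrow> (\<lambda>t. (partial_deriv i ^^ k) g (\<xi> + t *\<^sub>R axis i 1)) differentiable (at 0)"
  shows "symb \<rho> i N A \<mu> g"
  using assms
proof (induction N arbitrary: g \<mu>)
  case 0 then show ?case using 0(1)[of 0] 0(2)[of 0] by simp
next
  case (Suc N)
  have "symb \<rho> i N A (\<mu> - \<rho>) (partial_deriv i g)"
  proof (rule Suc.IH)
    fix k assume "k \<le> N"
    then show "continuous_on UNIV ((partial_deriv i ^^ k) (partial_deriv i g))"
      using Suc.prems(1)[of "Suc k"] by (simp add: funpow_swap1)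
    show "norm ((partial_deriv i ^^ k) (partial_deriv i g) \<xi>) \<le> A * japanese \<xi> powr (\<mu> - \<rho> - \<rho> * real k)" for \<xi>
      using Suc.prems(2)[of "Suc k" \<xi>] \<open>k \<le> N\<close> by (simp add: funpow_swap1 algebra_simps)
  next
    fix k \<xi> assume "k < N"
    then show "(\<lambda>t. (partial_deriv i ^^ k) (partial_deriv i g) (\<xi> + t *\<^sub>R axis i 1)) differentiable (at 0)"
      using Suc.prems(3)[of "Suc k" \<xi>] by (simp add: funpow_swap1)
  qed
  then show ?case
    using Suc.prems(1)[of 0] Suc.prems(2)[of 0] Suc.prems(3)[of 0] by auto
qed

text \<open>Peetre's inequality for shifts of length at most 1 along an axis. It lets a single
  function dominate all shifted copies of a symbol under the integral.\<close>

lemma japanese_shift_le: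
  fixes \<xi> :: "real^'n::finite"
  assumes "\<bar>t\<bar> \<le> 1"
  shows "japanese \<xi> \<le> 2 * japanese (\<xi> + t *\<^sub>R axis i 1)"
proof -
  let ?e = "\<xi> + t *\<^sub>R axis i (1::real)"
  have n: "norm \<xi> \<le> norm ?e + 1"
    using norm_triangle_ineq4[of ?e "t *\<^sub>R axis i (1::real)"] assms by (simp add: norm_axis_1)
  have "(norm \<xi>)\<^sup>2 \<le> (norm ?e + 1)\<^sup>2" using n by (intro power_mono) auto
  also have "\<dots> \<le> 2 * (norm ?e)\<^sup>2 + 2"
    using sum_squares_bound[of "norm ?e" 1] by (simp add: power2_sum)
  moreover have "(2 * japanese ?e)\<^sup>2 = 4 + 4 * (norm ?e)\<^sup>2"
    by (simp add: japanese_sq power_mult_distrib)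
  ultimately have "(japanese \<xi>)\<^sup>2 \<le> (2 * japanese ?e)\<^sup>2"
    using zero_le_power2[of "norm ?e"] unfolding japanese_sq by linarith
  then show ?thesis by (rule power2_le_imp_le) (use japanese_pos[of ?e] in simp)
qed

section \<open>Derivatives of a symbol become multiplication by coordinates\<close>

lemma symb_integrable:
  fixes g :: "real^'n::finite \<Rightarrow> complex"
  assumes "symb \<rho> i N A \<mu> g" "\<mu> \<le> - 2 * real CARD('n)"
  shows "integrable lborel g"
proof (rule Bochner_Integration.integrable_bound)
  have s: "symb \<rho> i N A (- 2 * real CARD('n)) g" using symb_mono[OF assms(1) order_refl assms(2)] .
  show "integrable lborel (\<lambda>\<xi>::real^'n. A * japanese \<xi> powr (- 2 * real CARD('n)))"
    by (intro integrable_mult_right integrable_japanese_powr)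
  show "AE x in lborel. norm (g x) \<le> norm (A * japanese x powr (- 2 * real CARD('n)))"
    using symb_bound[OF s] symb_nonneg[OF s] by (intro AE_I2) simp
  show "g \<in> borel_measurable lborel" using symb_measurable[OF s] by simp
qed

lemma has_vector_derivative_shift:
  assumes "((\<lambda>s. f (t + s)) has_vector_derivative d) (at 0)"
  shows "(f has_vector_derivative d) (at (t::real))"
proof -
  have "((\<lambda>s. f (t + s)) \<circ> (\<lambda>s. s - t) has_vector_derivative 1 *\<^sub>R d) (at t)"
    by (rule vector_diff_chain_at) (use assms in \<open>auto intro!: derivative_eq_intros\<close>)
  then show ?thesis by (simp add: o_def)
qed

text \<open>Integration by parts without boundary terms: by invariance of Lebesgue measure,
  translating \<open>g\<close> by t along the axis multiplies its transform at z by exp(-i t z_i),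
  and both sides are differentiated at t = 0. The order bound makes \<open>g\<close> and its
  derivative integrable.\<close>

lemma FT_partial_deriv:
  fixes g :: "real^'n::finite \<Rightarrow> complex"
  assumes g: "symb \<rho> i (Suc N) A \<mu> g" and \<mu>: "\<mu> \<le> - 2 * real CARD('n)" and \<rho>: "0 \<le> \<rho>"
  shows "FT (partial_deriv i g) z = (- \<i> * complex_of_real (z $ i)) * FT g z"
proof -
  let ?e = "axis i (1::real) :: real^'n" and ?n = "- 2 * real CARD('n)"
  have g': "symb \<rho> i N A ?n (partial_deriv i g)"
    using symb_mono[OF symb_SucE(2)[OF g] order_refl, of ?n] \<mu> \<rho> by simp
  have A: "0 \<le> A" by (rule symb_nonneg[OF g])
  have [measurable]: "g \<in> borel_measurable borel" "partial_deriv i g \<in> borel_measurable borel"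
    using symb_measurable[OF g] symb_measurable[OF g'] by auto
  have gi: "integrable lborel g" by (rule symb_integrable[OF g \<mu>])
  define ex where "ex \<xi> = exp (\<i> * complex_of_real (z \<bullet> \<xi>))" for \<xi>
  have exn: "norm (ex \<xi>) = 1" for \<xi> by (simp add: ex_def)
  have [measurable]: "ex \<in> borel_measurable borel" unfolding ex_def by measurable
  define h where "h t \<xi> = g (\<xi> + t *\<^sub>R ?e) * ex \<xi>" for t \<xi>
  define h' where "h' t \<xi> = partial_deriv i g (\<xi> + t *\<^sub>R ?e) * ex \<xi>" for t \<xi>
  have tr: "(LINT x|lborel. F (x + c)) = (LINT x|lborel. F x)" if "F \<in> borel_measurable borel" for F :: "real^'n \<Rightarrow> complex" and c
    using that by (subst lborel_distr_plus[of c, symmetric], subst integral_distr) (auto simp: add.commute)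
  have "((\<lambda>t. LINT \<xi>|lborel. h t \<xi>) has_vector_derivative (LINT \<xi>|lborel. h' 0 \<xi>)) (at 0)"
  \<comment> \<open>The factor 2^(2n) is the price of Peetre's inequality at the power 2n.\<close>
  proof (rule has_vector_derivative_integral[where w="\<lambda>\<xi>. A * 2 powr (2 * real CARD('n)) * japanese \<xi> powr ?n"])
    fix t :: real and \<xi> :: "real^'n" assume t: "\<bar>t\<bar> < 1"
    have "((\<lambda>s. g (\<xi> + s *\<^sub>R ?e)) has_vector_derivative partial_deriv i g (\<xi> + t *\<^sub>R ?e)) (at t)"
      by (rule has_vector_derivative_shift) (use symb_SucE(1)[OF g, of "\<xi> + t *\<^sub>R ?e"] in \<open>simp add: algebra_simps\<close>)
    then show "((\<lambda>s. h s \<xi>) has_vector_derivative h' t \<xi>) (at t)"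
      unfolding h_def h'_def by (rule has_vector_derivative_mult_left)
    have "japanese (\<xi> + t *\<^sub>R ?e) powr ?n \<le> ((1/2) * japanese \<xi>) powr ?n"
      using japanese_shift_le[of t \<xi> i] t japanese_pos[of \<xi>] by (intro powr_mono2') auto
    also have "\<dots> = 2 powr (2 * real CARD('n)) * japanese \<xi> powr ?n"
      using japanese_pos[of \<xi>] by (simp add: powr_mult powr_divide powr_minus field_simps)
    finally have "A * japanese (\<xi> + t *\<^sub>R ?e) powr ?n \<le> A * (2 powr (2 * real CARD('n)) * japanese \<xi> powr ?n)"
      using A by (intro mult_left_mono)
    moreover have "norm (h' t \<xi>) \<le> A * japanese (\<xi> + t *\<^sub>R ?e) powr ?n"
      unfolding h'_def using symb_bound[OF g'] by (simp add: norm_mult exn)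
    ultimately show "norm (h' t \<xi>) \<le> A * 2 powr (2 * real CARD('n)) * japanese \<xi> powr ?n" by simp
  next
    show "integrable lborel (\<lambda>\<xi>::real^'n. A * 2 powr (2 * real CARD('n)) * japanese \<xi> powr ?n)"
      by (intro integrable_mult_right integrable_japanese_powr)
    show "h' 0 \<in> borel_measurable lborel" unfolding h'_def by measurable
    show "integrable lborel (h t)" for t
    proof -
      have "integrable (distr lborel borel ((+) (t *\<^sub>R ?e))) g" unfolding lborel_distr_plus by (rule gi)
      then have "integrable lborel (\<lambda>\<xi>. g (\<xi> + t *\<^sub>R ?e))" by (subst (asm) integrable_distr_eq) (auto simp: add.commute)
      then show ?thesis by (rule Bochner_Integration.integrable_bound) (auto simp: h_def[abs_def] norm_mult exn)
    qed
  qed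
  moreover have "(LINT \<xi>|lborel. h' 0 \<xi>) = FT (partial_deriv i g) z"
    by (simp add: h'_def FT_def ex_def mult.commute)
  moreover have "(LINT \<xi>|lborel. h t \<xi>) = exp (of_real t * (- \<i> * complex_of_real (z $ i))) * FT g z" for t
  proof -
    have sh: "ex \<xi> = exp (of_real t * (- \<i> * complex_of_real (z $ i))) * ex (\<xi> + t *\<^sub>R ?e)" for \<xi>
      by (simp add: ex_def inner_add_right inner_axis algebra_simps flip: exp_add)
    have "(LINT \<xi>|lborel. h t \<xi>) = (LINT \<xi>|lborel. exp (of_real t * (- \<i> * complex_of_real (z $ i))) * (ex (\<xi> + t *\<^sub>R ?e) * g (\<xi> + t *\<^sub>R ?e)))"
      unfolding h_def by (intro Bochner_Integration.integral_cong refl) (subst sh, simp)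
    also have "\<dots> = exp (of_real t * (- \<i> * complex_of_real (z $ i))) * (LINT \<xi>|lborel. ex (\<xi> + t *\<^sub>R ?e) * g (\<xi> + t *\<^sub>R ?e))"
      by (rule integral_mult_right_zero)
    also have "(LINT \<xi>|lborel. ex (\<xi> + t *\<^sub>R ?e) * g (\<xi> + t *\<^sub>R ?e)) = FT g z"
      using tr[of "\<lambda>\<xi>. ex \<xi> * g \<xi>"] by (simp add: FT_def ex_def)
    finally show ?thesis .
  qed
  ultimately have 1: "((\<lambda>t. exp (of_real t * (- \<i> * complex_of_real (z $ i))) * FT g z) has_vector_derivative FT (partial_deriv i g) z) (at 0)"
    by simp
  have "((\<lambda>t. exp (of_real t * (- \<i> * complex_of_real (z $ i)))) has_vector_derivative (- \<i> * complex_of_real (z $ i)) * exp (of_real 0 * (- \<i> * complex_of_real (z $ i)))) (at (0::real))"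
    using exp_scaleR_has_vector_derivative_right[of "- \<i> * complex_of_real (z $ i)" 0 UNIV]
    by (simp add: scaleR_conv_of_real)
  from has_vector_derivative_mult_left[OF this, of "FT g z"]
  have 2: "((\<lambda>t. exp (of_real t * (- \<i> * complex_of_real (z $ i))) * FT g z) has_vector_derivative (- \<i> * complex_of_real (z $ i)) * FT g z) (at 0)"
    by simp
  show ?thesis by (rule vector_derivative_unique_at[OF 1 2])
qed

lemma FT_funpow:
  fixes g :: "real^'n::finite \<Rightarrow> complex"
  assumes "symb \<rho> i N A \<mu> g" and "\<mu> \<le> - 2 * real CARD('n)" and "0 \<le> \<rho>"
  shows "FT ((partial_deriv i ^^ N) g) z = (- \<i> * complex_of_real (z $ i)) ^ N * FT g z"
  using assms
proof (induction N arbitrary: g \<mu>)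
  case (Suc N)
  have "FT ((partial_deriv i ^^ N) (partial_deriv i g)) z = (- \<i> * complex_of_real (z $ i)) ^ N * FT (partial_deriv i g) z"
    by (rule Suc.IH[OF symb_SucE(2)[OF Suc.prems(1)]]) (use Suc.prems in auto)
  then show ?case
    using FT_partial_deriv[OF Suc.prems] by (simp add: funpow_swap1)
qed simp

section \<open>Gaussian frequency cutoffs as symbols\<close>

definition gauss_symbol :: "real \<Rightarrow> real^'n::finite \<Rightarrow> complex" where
  "gauss_symbol l \<xi> = complex_of_real (exp (- ((japanese \<xi>)\<^sup>2 / l\<^sup>2)))"

lemma gauss_symbol_cont: "continuous_on UNIV (gauss_symbol l)"
  unfolding gauss_symbol_def japanese_sq divide_inverse by (intro continuous_intros)

lemma gauss_symbol_deriv: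
  fixes \<xi> :: "real^'n::finite"
  shows "((\<lambda>t. gauss_symbol l (\<xi> + t *\<^sub>R axis i 1)) has_vector_derivative - complex_of_real (2 / l\<^sup>2) * (complex_of_real (\<xi> $ i) * gauss_symbol l \<xi>)) (at 0)"
proof -
  have e: "(japanese (\<xi> + t *\<^sub>R axis i (1::real)))\<^sup>2 = (japanese \<xi>)\<^sup>2 + 2 * t * \<xi> $ i + t\<^sup>2" for t
    unfolding japanese_sq power2_norm_eq_inner
    by (simp add: inner_add_left inner_add_right inner_axis inner_axis' power2_eq_square algebra_simps)
  have "((\<lambda>t. exp (- (((japanese \<xi>)\<^sup>2 + 2 * t * \<xi> $ i + t\<^sup>2) / l\<^sup>2))) has_real_derivative
      - (2 / l\<^sup>2) * (\<xi> $ i * exp (- ((japanese \<xi>)\<^sup>2 / l\<^sup>2)))) (at 0)"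
    unfolding divide_inverse by (auto intro!: derivative_eq_intros)
  then show ?thesis
    unfolding gauss_symbol_def e has_vector_derivative_complex_iff by simp
qed

text \<open>The exponential beats every power: for s \<le> 1 the power is at most 1, and for s > 1 a
  single term of the exponential series is enough.\<close>

lemma exp_le_powr:
  fixes p :: real
  assumes "0 \<le> p"
  shows "\<exists>C\<ge>0. \<forall>s>0. exp (- s) \<le> C * s powr (- p)"
proof -
  obtain k where k: "p \<le> real k" using real_arch_simple by blast
  show ?thesis
  proof (intro exI conjI allI impI)
    show "0 \<le> (fact k :: real)" by simp
    fix s :: real assume s: "0 < s"
    have pw: "s powr p \<le> fact k * exp s"
    proof (cases "s \<le> 1")
      case True
      have "s powr p \<le> 1" using s True assms by (simp add: powr_le1)
      also have "\<dots> \<le> fact k * exp s" using s mult_mono[of 1 "fact k" 1 "exp s"] by simp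
      finally show ?thesis .
    next
      case False
      have "s powr p \<le> s ^ k" using False k by (subst powr_realpow[symmetric]) (auto intro: powr_mono)
      moreover have "s ^ k / fact k \<le> exp s"
      proof -
        have "(\<Sum>n\<in>{k}. s ^ n /\<^sub>R fact n) \<le> exp s"
          unfolding exp_def by (rule sum_le_suminf) (use s summable_exp_generic[of s] in auto)
        then show ?thesis by (simp add: divide_inverse mult.commute)
      qed
      ultimately show ?thesis by (simp add: field_simps)
    qed
    show "exp (- s) \<le> fact k * s powr (- p)"
      using pw s by (simp add: exp_minus powr_minus field_simps)
  qed
qed

lemma scale_powr:
  assumes "0 < l"
  shows "((japanese \<xi>)\<^sup>2 / l\<^sup>2) powr (\<sigma> / 2) = l powr (- \<sigma>) * japanese \<xi> powr \<sigma>"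
proof -
  have "((japanese \<xi>)\<^sup>2 / l\<^sup>2) powr (\<sigma> / 2) = ((japanese \<xi> / l) powr 2) powr (\<sigma> / 2)"
    using assms japanese_pos[of \<xi>] by (simp add: power_divide)
  also have "\<dots> = l powr (- \<sigma>) * japanese \<xi> powr \<sigma>"
    using assms japanese_pos[of \<xi>] unfolding powr_powr by (simp add: powr_divide powr_minus field_simps)
  finally show ?thesis .
qed

text \<open>Bookkeeping of one derivative: the coordinate costs order 1, the factor
  \<open>1 / l\<^sup>2\<close> is paid for by using the cutoff at order \<sigma> - 2, and the
  resulting order \<sigma> - 1 is at most \<sigma> - \<rho>. Later \<open>c\<close> is -2 for the
  cutoff and 2 for its complement.\<close>

lemma symb_deriv_gauss_symbol:
  fixes i :: "'n::finite"
  assumes E: "\<And>l. 0 < l \<Longrightarrow> symb \<rho> i N (C * l powr (- (\<sigma> - 2))) (\<sigma> - 2) (gauss_symbol l)" and \<rho>: "\<rho> \<le> 1" and l: "0 < l"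
  shows "symb \<rho> i N (2 ^ N * 2 ^ N * norm c * C * l powr (- \<sigma>)) (\<sigma> - \<rho>) (\<lambda>\<xi>. (c / complex_of_real (l\<^sup>2)) * (complex_of_real (\<xi> $ i) * gauss_symbol l \<xi>))"
proof -
  have "symb \<rho> i N (2 ^ N * norm (c / complex_of_real (l\<^sup>2)) * (2 ^ N * 1 * (C * l powr (- (\<sigma> - 2))))) (1 + (\<sigma> - 2)) (\<lambda>\<xi>. (c / complex_of_real (l\<^sup>2)) * (complex_of_real (\<xi> $ i) * gauss_symbol l \<xi>))"
    by (intro symb_cmult symb_mult symb_coord E l \<rho>)
  then have *: "symb \<rho> i N (2 ^ N * norm (c / complex_of_real (l\<^sup>2)) * (2 ^ N * 1 * (C * l powr (- (\<sigma> - 2))))) (\<sigma> - \<rho>) (\<lambda>\<xi>. (c / complex_of_real (l\<^sup>2)) * (complex_of_real (\<xi> $ i) * gauss_symbol l \<xi>))"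
    by (rule symb_mono) (use \<rho> in auto)
  have "2 ^ N * norm (c / complex_of_real (l\<^sup>2)) * (2 ^ N * 1 * (C * l powr (- (\<sigma> - 2)))) = 2 ^ N * 2 ^ N * norm c * C * l powr (- \<sigma>)"
    using l by (simp add: norm_divide norm_power powr_diff powr_minus field_simps)
  then show ?thesis using * by (simp only:)
qed

text \<open>The cutoff is a function of \<open>japanese \<xi> / l\<close> alone and decays in it
  faster than any power, which gives each order \<sigma> \<le> 0 at the price l^(-\<sigma>). The
  induction ranges over all \<sigma> at once, because a derivative at order \<sigma> consults the
  cutoff at order \<sigma> - 2.\<close>

lemma symb_gauss_symbol:
  fixes i :: "'n::finite"
  assumes \<rho>: "\<rho> \<le> 1" and \<sigma>: "\<sigma> \<le> 0"
  shows "\<exists>C\<ge>0. \<forall>l>0. symb \<rho> i N (C * l powr (- \<sigma>)) \<sigma> (gauss_symbol l)"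
  using \<sigma>
proof (induction N arbitrary: \<sigma>)
  case 0
  obtain C where C: "C \<ge> 0" "\<And>s. 0 < s \<Longrightarrow> exp (- s) \<le> C * s powr (\<sigma> / 2)"
    using exp_le_powr[of "- \<sigma> / 2"] 0 by auto
  show ?case
  proof (intro exI[of _ C] conjI allI impI C(1))
    fix l :: real assume "0 < l"
    then show "symb \<rho> i 0 (C * l powr (- \<sigma>)) \<sigma> (gauss_symbol l)"
      using C(2)[of "(japanese _)\<^sup>2 / l\<^sup>2"] gauss_symbol_cont by (auto simp: gauss_symbol_def scale_powr mult.assoc)
  qed
next
  case (Suc N)
  obtain C where C: "C \<ge> 0" "\<And>s. 0 < s \<Longrightarrow> exp (- s) \<le> C * s powr (\<sigma> / 2)"
    using exp_le_powr[of "- \<sigma> / 2"] Suc.prems by auto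
  obtain D where D: "D \<ge> 0" "\<And>l. 0 < l \<Longrightarrow> symb \<rho> i N (D * l powr (- (\<sigma> - 2))) (\<sigma> - 2) (gauss_symbol l)"
    using Suc.IH[of "\<sigma> - 2"] Suc.prems by auto
  define K where "K = C + 2 ^ N * 2 ^ N * norm (-2::complex) * D"
  have K: "C \<le> K" "2 ^ N * 2 ^ N * norm (-2::complex) * D \<le> K" using C(1) D(1) by (auto simp: K_def)
  show ?case
  proof (intro exI[of _ K] conjI allI impI)
    show "0 \<le> K" using C(1) D(1) by (simp add: K_def)
    fix l :: real assume l: "0 < l"
    show "symb \<rho> i (Suc N) (K * l powr (- \<sigma>)) \<sigma> (gauss_symbol l)"
    proof (rule symb_SucI[OF gauss_symbol_cont])
      fix \<xi> :: "real^'n"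
      have "norm (gauss_symbol l \<xi>) \<le> C * (l powr (- \<sigma>) * japanese \<xi> powr \<sigma>)"
        using C(2)[of "(japanese \<xi>)\<^sup>2 / l\<^sup>2"] l by (simp add: gauss_symbol_def scale_powr)
      also have "\<dots> \<le> K * (l powr (- \<sigma>) * japanese \<xi> powr \<sigma>)"
        using K by (intro mult_right_mono) auto
      finally show "norm (gauss_symbol l \<xi>) \<le> K * l powr (- \<sigma>) * japanese \<xi> powr \<sigma>" by (simp add: mult.assoc)
      show "((\<lambda>t. gauss_symbol l (\<xi> + t *\<^sub>R axis i 1)) has_vector_derivative (-2 / complex_of_real (l\<^sup>2)) * (complex_of_real (\<xi> $ i) * gauss_symbol l \<xi>)) (at 0)"
        using gauss_symbol_deriv[of l \<xi> i] by simp
    next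
      show "symb \<rho> i N (K * l powr (- \<sigma>)) (\<sigma> - \<rho>) (\<lambda>\<xi>. (-2 / complex_of_real (l\<^sup>2)) * (complex_of_real (\<xi> $ i) * gauss_symbol l \<xi>))"
        using symb_deriv_gauss_symbol[OF D(2) \<rho> l, of "-2"] by (rule symb_mono) (use K in \<open>auto intro!: mult_right_mono\<close>)
    qed
  qed
qed

text \<open>The chain 1 - exp(-s) \<le> min(1, s) \<le> s^(\<sigma>/2) is where 0 \<le> \<sigma>
  \<le> 2 comes from. The derivatives are those of the cutoff up to sign, estimated at the order
  \<sigma> - 2 \<le> 0.\<close>

lemma symb_one_minus_gauss_symbol:
  fixes i :: "'n::finite"
  assumes \<rho>: "\<rho> \<le> 1" and \<sigma>: "0 \<le> \<sigma>" "\<sigma> \<le> 2"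
  shows "\<exists>C\<ge>0. \<forall>l>0. symb \<rho> i N (C * l powr (- \<sigma>)) \<sigma> (\<lambda>\<xi>. 1 - gauss_symbol l \<xi>)"
proof -
  have b: "norm (1 - gauss_symbol l \<xi>) \<le> l powr (- \<sigma>) * japanese \<xi> powr \<sigma>" if l: "0 < l" for l and \<xi> :: "real^'n"
  proof -
    define s where "s = (japanese \<xi>)\<^sup>2 / l\<^sup>2"
    have s: "0 < s" using l japanese_pos[of \<xi>] by (simp add: s_def)
    have "norm (1 - gauss_symbol l \<xi>) = \<bar>1 - exp (- s)\<bar>"
      unfolding gauss_symbol_def s_def by (metis norm_of_real of_real_1 of_real_diff)
    also have "\<dots> = 1 - exp (- s)" using s by simp
    also have "\<dots> \<le> s powr (\<sigma> / 2)"
    proof (cases "s \<le> 1")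
      case True
      have "1 - exp (- s) \<le> s powr 1" using exp_ge_add_one_self[of "- s"] s by simp
      also have "\<dots> \<le> s powr (\<sigma> / 2)" using True s \<sigma> by (intro powr_mono') auto
      finally show ?thesis .
    next
      case False
      have "1 - exp (- s) \<le> 1" by simp
      also have "\<dots> \<le> s powr (\<sigma> / 2)" using False \<sigma> by (intro ge_one_powr_ge_zero) auto
      finally show ?thesis .
    qed
    finally show ?thesis using scale_powr[OF l, of \<xi> \<sigma>] by (simp add: s_def)
  qed
  have c: "continuous_on UNIV (\<lambda>\<xi>. 1 - gauss_symbol l \<xi> :: complex)" for l
    by (intro continuous_intros gauss_symbol_cont)
  show ?thesis
  proof (cases N)
    case 0
    then show ?thesis using b c by (intro exI[of _ 1]) auto
  next
    case (Suc N')
    obtain D where D: "D \<ge> 0" "\<And>l. 0 < l \<Longrightarrow> symb \<rho> i N' (D * l powr (- (\<sigma> - 2))) (\<sigma> - 2) (gauss_symbol l)"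
      using symb_gauss_symbol[OF \<rho>, of "\<sigma> - 2" i N'] \<sigma> by auto
    define K where "K = 1 + 2 ^ N' * 2 ^ N' * norm (2::complex) * D"
    have K: "1 \<le> K" "2 ^ N' * 2 ^ N' * norm (2::complex) * D \<le> K" using D(1) by (auto simp: K_def)
    show ?thesis unfolding Suc
    proof (intro exI[of _ K] conjI allI impI)
      show "0 \<le> K" using K by simp
      fix l :: real assume l: "0 < l"
      show "symb \<rho> i (Suc N') (K * l powr (- \<sigma>)) \<sigma> (\<lambda>\<xi>. 1 - gauss_symbol l \<xi>)"
      proof (rule symb_SucI[OF c])
        fix \<xi> :: "real^'n"
        have "norm (1 - gauss_symbol l \<xi>) \<le> 1 * (l powr (- \<sigma>) * japanese \<xi> powr \<sigma>)"
          using b[OF l] by simp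
        also have "\<dots> \<le> K * (l powr (- \<sigma>) * japanese \<xi> powr \<sigma>)"
          using K by (intro mult_right_mono) auto
        finally show "norm (1 - gauss_symbol l \<xi>) \<le> K * l powr (- \<sigma>) * japanese \<xi> powr \<sigma>" by (simp add: mult.assoc)
        show "((\<lambda>t. 1 - gauss_symbol l (\<xi> + t *\<^sub>R axis i 1)) has_vector_derivative (2 / complex_of_real (l\<^sup>2)) * (complex_of_real (\<xi> $ i) * gauss_symbol l \<xi>)) (at 0)"
          using has_vector_derivative_diff[OF has_vector_derivative_const gauss_symbol_deriv[of l \<xi> i], of 1] by simp
      next
        show "symb \<rho> i N' (K * l powr (- \<sigma>)) (\<sigma> - \<rho>) (\<lambda>\<xi>. (2 / complex_of_real (l\<^sup>2)) * (complex_of_real (\<xi> $ i) * gauss_symbol l \<xi>))"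
          using symb_deriv_gauss_symbol[OF D(2) \<rho> l, of "2"] by (rule symb_mono) (use K in \<open>auto intro!: mult_right_mono\<close>)
      qed
    qed
  qed
qed

section \<open>Kernel bounds for the dyadic pieces\<close>

text \<open>The power \<open>M\<close> makes \<open>1 - low_pass\<close> vanish to order \<open>2M\<close> in \<open>\<langle>\<xi>\<rangle>/l\<close>. Dyadic differences
  are thus concentrated near \<open>\<langle>\<xi>\<rangle> ~ l\<close> to any prescribed polynomial order, which replaces a
  compactly supported partition of unity.\<close>

definition low_pass :: "nat \<Rightarrow> real \<Rightarrow> real^'n::finite \<Rightarrow> complex" where
  "low_pass M l \<xi> = 1 - (1 - gauss_symbol l \<xi>) ^ M"

text \<open>Index 0 collects all low frequencies, so that the sum over j \<le> J telescopes to a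
  single low-pass factor.\<close>

definition dyadic_cut :: "nat \<Rightarrow> nat \<Rightarrow> real^'n::finite \<Rightarrow> complex" where
  "dyadic_cut M j \<xi> = (if j = 0 then low_pass M 1 \<xi> else low_pass M (2 ^ j) \<xi> - low_pass M (2 ^ (j - 1)) \<xi>)"

lemma sum_dyadic_cut: "(\<Sum>j\<le>J. dyadic_cut M j \<xi>) = low_pass M (2 ^ J) \<xi>"
  by (induction J) (auto simp: dyadic_cut_def)

lemma norm_one_minus_gauss_symbol_le: "norm (1 - gauss_symbol l \<xi>) \<le> 1"
proof -
  have "norm (1 - gauss_symbol l \<xi>) = \<bar>1 - exp (- ((japanese \<xi>)\<^sup>2 / l\<^sup>2))\<bar>"
    unfolding gauss_symbol_def by (metis norm_of_real of_real_1 of_real_diff)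
  then show ?thesis by simp
qed

lemma norm_low_pass_le: "norm (low_pass M l \<xi>) \<le> 2"
proof -
  have "norm (low_pass M l \<xi>) \<le> 1 + norm (1 - gauss_symbol l \<xi>) ^ M"
    unfolding low_pass_def by (metis norm_one norm_power norm_triangle_ineq4)
  also have "norm (1 - gauss_symbol l \<xi>) ^ M \<le> 1" by (rule power_le_one[OF norm_ge_zero norm_one_minus_gauss_symbol_le])
  finally show ?thesis by simp
qed

lemma low_pass_tendsto:
  assumes "1 \<le> M"
  shows "(\<lambda>J. low_pass M (2 ^ J) \<xi>) \<longlonglongrightarrow> 1"
proof -
  have "(\<lambda>J. (japanese \<xi>)\<^sup>2 / (2 ^ J)\<^sup>2) \<longlonglongrightarrow> 0"
    by real_asymp
  then have "(\<lambda>J. 1 - (1 - complex_of_real (exp (- ((japanese \<xi>)\<^sup>2 / (2 ^ J)\<^sup>2)))) ^ M) \<longlonglongrightarrow> 1 - (1 - complex_of_real (exp (- 0))) ^ M"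
    by (intro tendsto_intros)
  then show ?thesis using assms by (cases M) (auto simp: low_pass_def gauss_symbol_def)
qed

lemma symb_power_ex:
  fixes g :: "real \<Rightarrow> real^'n::finite \<Rightarrow> complex"
  assumes C: "0 \<le> C" and g: "\<And>l. 0 < l \<Longrightarrow> symb \<rho> i N (C * l powr (- \<sigma>)) \<sigma> (g l)"
  shows "\<exists>D\<ge>0. \<forall>l>0. symb \<rho> i N (D * l powr (- (real M * \<sigma>))) (real M * \<sigma>) (\<lambda>\<xi>. g l \<xi> ^ M)"
proof (cases M)
  case 0
  then show ?thesis using symb_const[of \<rho> i N 1] by (intro exI[of _ 1]) auto
next
  case (Suc M')
  show ?thesis
  proof (intro exI conjI allI impI)
    show "0 \<le> (2 ^ N) ^ M' * C ^ Suc M'" using C by simp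
    fix l :: real assume l: "0 < l"
    have "(C * l powr (- \<sigma>)) ^ Suc M' = C ^ Suc M' * (l powr (- \<sigma>)) powr (real (Suc M'))"
      using l by (subst powr_realpow) (simp_all add: power_mult_distrib)
    also have "\<dots> = C ^ Suc M' * l powr (- (real M * \<sigma>))"
      unfolding powr_powr Suc by (simp add: algebra_simps)
    finally show "symb \<rho> i N ((2 ^ N) ^ M' * C ^ Suc M' * l powr (- (real M * \<sigma>))) (real M * \<sigma>) (\<lambda>\<xi>. g l \<xi> ^ M)"
      using symb_power[OF g[OF l], of M'] by (simp only: Suc mult.assoc)
  qed
qed

text \<open>The order is shared equally by the M factors, each of which can carry an order \<sigma>
  / M between 0 and 2. For M = 0 only \<sigma> = 0 is left.\<close>

lemma symb_one_minus_low_pass: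
  fixes i :: "'n::finite"
  assumes \<rho>: "\<rho> \<le> 1" and \<sigma>: "0 \<le> \<sigma>" "\<sigma> \<le> 2 * real M"
  shows "\<exists>C\<ge>0. \<forall>l>0. symb \<rho> i N (C * l powr (- \<sigma>)) \<sigma> (\<lambda>\<xi>. (1 - gauss_symbol l \<xi>) ^ M)"
proof (cases "M = 0")
  case True
  then have "\<sigma> = 0" using \<sigma> by simp
  then show ?thesis using symb_const[of \<rho> i N 1] True by (intro exI[of _ 1]) auto
next
  case False
  have "0 \<le> \<sigma> / real M" "\<sigma> / real M \<le> 2" using \<sigma> False by (auto simp: field_simps)
  then obtain C where C: "C \<ge> 0" "\<forall>l>0. symb \<rho> i N (C * l powr (- (\<sigma> / real M))) (\<sigma> / real M) (\<lambda>\<xi>. 1 - gauss_symbol l \<xi>)"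
    using symb_one_minus_gauss_symbol[OF \<rho>] by blast
  then show ?thesis
    using symb_power_ex[of C \<rho> i N "\<sigma> / real M" "\<lambda>l \<xi>. 1 - gauss_symbol l \<xi>" M] False by simp
qed

text \<open>Writing G for the cutoff, the induction rests on 1 - (1 - G)^(M+1) = (1 - (1 - G)^M) + G
  (1 - G)^M: the factor G carries the negative order, while (1 - G)^M is a symbol of order 0
  uniformly in l.\<close>

lemma symb_low_pass:
  fixes i :: "'n::finite"
  assumes \<rho>: "\<rho> \<le> 1" and \<sigma>: "\<sigma> \<le> 0"
  shows "\<exists>C\<ge>0. \<forall>l>0. symb \<rho> i N (C * l powr (- \<sigma>)) \<sigma> (low_pass M l)"
proof (induction M)
  case 0
  have "symb \<rho> i N 0 \<sigma> (\<lambda>\<xi>. 0)"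
    using symb_cmult[of \<rho> i N 1 "\<sigma>" "\<lambda>\<xi>. 0" 0]
  proof -
    have "partial_deriv i (\<lambda>\<xi>. 0) = (\<lambda>\<xi>. 0)" by (simp add: partial_deriv_def fun_eq_iff)
    then show ?thesis by (induction N arbitrary: \<sigma>) auto
  qed
  then show ?case by (intro exI[of _ 0]) (simp add: low_pass_def[abs_def])
next
  case (Suc M)
  obtain C where C: "0 \<le> C" "\<And>l. 0 < l \<Longrightarrow> symb \<rho> i N (C * l powr (- \<sigma>)) \<sigma> (low_pass M l)" using Suc by blast
  obtain D where D: "0 \<le> D" "\<And>l. 0 < l \<Longrightarrow> symb \<rho> i N (D * l powr (- \<sigma>)) \<sigma> (gauss_symbol l)" using symb_gauss_symbol[OF \<rho> \<sigma>] by blast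
  obtain E where E: "0 \<le> E" "\<And>l. 0 < l \<Longrightarrow> symb \<rho> i N (E * l powr 0) 0 (\<lambda>\<xi>. (1 - gauss_symbol l \<xi>) ^ M)"
    using symb_one_minus_low_pass[OF \<rho>, of 0 M i N] by auto
  show ?case
  proof (intro exI conjI allI impI)
    show "0 \<le> C + 2 ^ N * D * E" using C D E by simp
    fix l :: real assume l: "0 < l"
    have "symb \<rho> i N (C * l powr (- \<sigma>) + 2 ^ N * (D * l powr (- \<sigma>)) * (E * l powr 0)) \<sigma> (\<lambda>\<xi>. low_pass M l \<xi> + gauss_symbol l \<xi> * (1 - gauss_symbol l \<xi>) ^ M)"
      using symb_add[OF C(2)[OF l]] symb_mult[OF D(2)[OF l] E(2)[OF l]] by simp
    moreover have "(\<lambda>\<xi>::real^'n. low_pass M l \<xi> + gauss_symbol l \<xi> * (1 - gauss_symbol l \<xi>) ^ M) = low_pass (Suc M) l"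
      by (simp add: low_pass_def fun_eq_iff algebra_simps)
    moreover have "C * l powr (- \<sigma>) + 2 ^ N * (D * l powr (- \<sigma>)) * (E * l powr 0) = (C + 2 ^ N * D * E) * l powr (- \<sigma>)"
      using l by (simp add: algebra_simps)
    ultimately show "symb \<rho> i N ((C + 2 ^ N * D * E) * l powr (- \<sigma>)) \<sigma> (low_pass (Suc M) l)" by (simp only:)
  qed
qed

text \<open>For \<sigma> \<le> 0 both low-pass terms decay by themselves. For \<sigma> > 0 the
  constants 1 cancel in the difference and the powers (1 - G)^M vanish to the required order, hence
  the limit 2M. The piece j = 0 has no partner, but at scale 1 raising the order is free because
  \<open>japanese\<close> is at least 1.\<close>

lemma symb_dyadic_cut:
  fixes i :: "'n::finite"
  assumes \<rho>: "\<rho> \<le> 1" and \<sigma>: "\<sigma> \<le> 2 * real M"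
  shows "\<exists>C\<ge>0. \<forall>j. symb \<rho> i N (C * (2 ^ j) powr (- \<sigma>)) \<sigma> (dyadic_cut M j)"
proof -
  have "\<exists>C0\<ge>0. symb \<rho> i N C0 \<sigma> (low_pass M 1)"
  proof -
    obtain C where C: "0 \<le> C" "\<And>l. 0 < l \<Longrightarrow> symb \<rho> i N (C * l powr (- min \<sigma> 0)) (min \<sigma> 0) (low_pass M l)"
      using symb_low_pass[OF \<rho>, of "min \<sigma> 0" i N M] by auto
    show ?thesis using C(1) C(2)[of 1] symb_mono[of \<rho> i N C "min \<sigma> 0" _ C \<sigma>] by auto
  qed
  then obtain C0 where C0: "0 \<le> C0" "symb \<rho> i N C0 \<sigma> (low_pass M 1)" by blast
  have "\<exists>C1\<ge>0. \<forall>l>0. symb \<rho> i N (C1 * l powr (- \<sigma>)) \<sigma> (\<lambda>\<xi>. low_pass M l \<xi> - low_pass M (l / 2) \<xi>)"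
  proof -
    have *: "\<exists>C1\<ge>0. \<forall>l>0. symb \<rho> i N (C1 * l powr (- \<sigma>)) \<sigma> (\<lambda>\<xi>. g l \<xi> - g (l / 2) \<xi>)"
      if ex: "\<exists>C\<ge>0. \<forall>l>0. symb \<rho> i N (C * l powr (- \<sigma>)) \<sigma> (g l)" for g
    proof -
      obtain C where C: "0 \<le> C" "\<And>l. 0 < l \<Longrightarrow> symb \<rho> i N (C * l powr (- \<sigma>)) \<sigma> (g l)" using ex by blast
      show ?thesis
      proof (intro exI conjI allI impI)
        show "0 \<le> C + 2 ^ N * C * 2 powr \<sigma>" using C by simp
        fix l :: real assume l: "0 < l"
        have "symb \<rho> i N (C * l powr (- \<sigma>) + 2 ^ N * (C * (l / 2) powr (- \<sigma>))) \<sigma> (\<lambda>\<xi>. g l \<xi> - g (l / 2) \<xi>)"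
          using l by (intro symb_diff C) auto
        moreover have "C * l powr (- \<sigma>) + 2 ^ N * (C * (l / 2) powr (- \<sigma>)) = (C + 2 ^ N * C * 2 powr \<sigma>) * l powr (- \<sigma>)"
          using l by (simp add: powr_divide powr_minus field_simps)
        ultimately show "symb \<rho> i N ((C + 2 ^ N * C * 2 powr \<sigma>) * l powr (- \<sigma>)) \<sigma> (\<lambda>\<xi>. g l \<xi> - g (l / 2) \<xi>)" by simp
      qed
    qed
    show ?thesis
    proof (cases "\<sigma> \<le> 0")
      case True
      show ?thesis by (rule *[OF symb_low_pass[OF \<rho> True]])
    next
      case False
      obtain C1 where C1: "C1 \<ge> 0" "\<And>l. 0 < l \<Longrightarrow> symb \<rho> i N (C1 * l powr (- \<sigma>)) \<sigma> (\<lambda>\<xi>. (1 - gauss_symbol l \<xi>) ^ M - (1 - gauss_symbol (l / 2) \<xi>) ^ M)"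
        using *[OF symb_one_minus_low_pass[OF \<rho> _ \<sigma>, of i N]] False by auto
      show ?thesis
      proof (intro exI conjI allI impI)
        show "0 \<le> 2 ^ N * C1" using C1 by simp
        fix l :: real assume l: "0 < l"
        have eq: "(\<lambda>\<xi>::real^'n. low_pass M l \<xi> - low_pass M (l / 2) \<xi>) = (\<lambda>\<xi>. (-1) * ((1 - gauss_symbol l \<xi>) ^ M - (1 - gauss_symbol (l / 2) \<xi>) ^ M))"
          by (simp add: low_pass_def fun_eq_iff)
        show "symb \<rho> i N (2 ^ N * C1 * l powr (- \<sigma>)) \<sigma> (\<lambda>\<xi>. low_pass M l \<xi> - low_pass M (l / 2) \<xi>)"
          unfolding eq using symb_cmult[OF C1(2)[OF l], of "-1"]
          by (simp only: norm_minus_cancel norm_one mult_1_right mult.assoc)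
      qed
    qed
  qed
  then obtain C1 where C1: "0 \<le> C1" "\<And>l. 0 < l \<Longrightarrow> symb \<rho> i N (C1 * l powr (- \<sigma>)) \<sigma> (\<lambda>\<xi>. low_pass M l \<xi> - low_pass M (l / 2) \<xi>)" by blast
  show ?thesis
  proof (intro exI conjI allI)
    show "0 \<le> C0 + C1" using C0 C1 by simp
    fix j
    show "symb \<rho> i N ((C0 + C1) * (2 ^ j) powr (- \<sigma>)) \<sigma> (dyadic_cut M j)"
    proof (cases j)
      case 0
      have "dyadic_cut M 0 = (low_pass M 1 :: real^'n \<Rightarrow> complex)" by (simp add: dyadic_cut_def fun_eq_iff)
      then show ?thesis using 0 C1(1) by (auto intro: symb_mono[OF C0(2)])
    next
      case (Suc k)
      have "dyadic_cut M j = (\<lambda>\<xi>::real^'n. low_pass M (2 ^ j) \<xi> - low_pass M (2 ^ j / 2) \<xi>)" by (simp add: dyadic_cut_def fun_eq_iff Suc)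
      then show ?thesis using C0(1) by (auto intro!: symb_mono[OF C1(2)] mult_right_mono)
    qed
  qed
qed

lemma symb_mult_dyadic_cut:
  fixes i :: "'n::finite"
  assumes \<rho>: "\<rho> \<le> 1" and \<sigma>: "\<sigma> \<le> 2 * real M"
  shows "\<exists>C\<ge>0. \<forall>j b. symb \<rho> i N A \<mu> b \<longrightarrow> symb \<rho> i N (C * (2 ^ j) powr (- \<sigma>)) (\<mu> + \<sigma>) (\<lambda>\<xi>. b \<xi> * dyadic_cut M j \<xi>)"
proof -
  obtain C where C: "0 \<le> C" "\<And>j. symb \<rho> i N (C * (2 ^ j) powr (- \<sigma>)) \<sigma> (dyadic_cut M j)"
    using symb_dyadic_cut[OF \<rho> \<sigma>] by blast
  show ?thesis
  proof (intro exI conjI allI impI)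
    \<comment> \<open>The modulus keeps the constant nonnegative even if no symbol with constant
      \<open>A\<close> exists.\<close>
    show "0 \<le> 2 ^ N * \<bar>A\<bar> * C" using C by simp
    fix j b assume b: "symb \<rho> i N A \<mu> b"
    show "symb \<rho> i N (2 ^ N * \<bar>A\<bar> * C * (2 ^ j) powr (- \<sigma>)) (\<mu> + \<sigma>) (\<lambda>\<xi>. b \<xi> * dyadic_cut M j \<xi>)"
      using symb_mult[OF b C(2)[of j]] symb_nonneg[OF b] by (simp add: mult.assoc)
  qed
qed

text \<open>Merges a bound that is good below frequency l with one that is good above it into a
  single rescaled decay. In both regimes \<open>(japanese (\<xi> /\<^sub>R l))\<^sup>2\<close> is at
  most twice the larger of 1 and \<open>(japanese \<xi> / l)\<^sup>2\<close>, whence 2^n.\<close>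

lemma min_one_le_japanese:
  fixes \<xi> :: "real^'n::finite"
  assumes l: "1 \<le> l" and x: "x \<le> D" "x \<le> D * (japanese \<xi> / l) powr (- 2 * real n)" and D: "0 \<le> D"
  shows "x \<le> D * 2 ^ n * japanese (\<xi> /\<^sub>R l) powr (- 2 * real n)"
proof -
  have J: "(japanese (\<xi> /\<^sub>R l))\<^sup>2 = 1 + (norm \<xi>)\<^sup>2 / l\<^sup>2"
    using l by (simp add: japanese_sq power_divide divide_inverse power_mult_distrib mult.commute power_inverse)
  have pw: "japanese \<eta> powr (- 2 * real n) = ((japanese \<eta>)\<^sup>2) powr (- real n)" for \<eta> :: "real^'n"
    using japanese_pos[of \<eta>] by (simp add: powr_powr flip: powr_numeral)
  have pos: "0 < (japanese (\<xi> /\<^sub>R l))\<^sup>2" using japanese_pos by simp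
  have two: "(2::real) ^ n = 2 powr real n" by (simp add: powr_realpow)
  show ?thesis
  proof (cases "japanese \<xi> \<le> l")
    case True
    have "(norm \<xi>)\<^sup>2 \<le> l\<^sup>2" using True norm_le_japanese[of \<xi>] by (intro power_mono) auto
    then have le: "(japanese (\<xi> /\<^sub>R l))\<^sup>2 \<le> 2" unfolding J using l by (simp add: divide_le_eq_1)
    have "1 = 2 ^ n * 2 powr (- real n)" unfolding two by (simp add: powr_minus)
    also have "\<dots> \<le> 2 ^ n * japanese (\<xi> /\<^sub>R l) powr (- 2 * real n)"
      unfolding pw using le pos by (intro mult_left_mono powr_mono2') auto
    finally have "D * 1 \<le> D * (2 ^ n * japanese (\<xi> /\<^sub>R l) powr (- 2 * real n))" using D by (rule mult_left_mono)
    then show ?thesis using x(1) by simp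
  next
    case False
    have "(norm \<xi>)\<^sup>2 \<le> (japanese \<xi>)\<^sup>2" by (simp add: japanese_sq)
    then have "(norm \<xi>)\<^sup>2 / l\<^sup>2 \<le> (japanese \<xi>)\<^sup>2 / l\<^sup>2" by (intro divide_right_mono) auto
    moreover have "1 \<le> (japanese \<xi>)\<^sup>2 / l\<^sup>2" using False l by (simp add: power_mono)
    ultimately have le: "(japanese (\<xi> /\<^sub>R l))\<^sup>2 \<le> 2 * (japanese \<xi> / l)\<^sup>2"
      unfolding J power_divide by linarith
    define q where "q = japanese \<xi> / l"
    have q: "0 < q" using l japanese_pos[of \<xi>] by (simp add: q_def)
    have "q powr (- 2 * real n) = (q\<^sup>2) powr (- real n)"
      using q by (simp add: powr_powr flip: powr_numeral)
    also have "\<dots> = 2 ^ n * (2 powr (- real n) * (q\<^sup>2) powr (- real n))"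
      unfolding two by (simp add: powr_minus)
    also have "\<dots> = 2 ^ n * (2 * q\<^sup>2) powr (- real n)"
      by (simp add: powr_mult)
    finally have "(japanese \<xi> / l) powr (- 2 * real n) = 2 ^ n * (2 * (japanese \<xi> / l)\<^sup>2) powr (- real n)"
      by (simp only: q_def)
    also have "\<dots> \<le> 2 ^ n * japanese (\<xi> /\<^sub>R l) powr (- 2 * real n)"
      unfolding pw using le pos by (intro mult_left_mono powr_mono2') auto
    finally have "D * (japanese \<xi> / l) powr (- 2 * real n) \<le> D * (2 ^ n * japanese (\<xi> /\<^sub>R l) powr (- 2 * real n))"
      using D by (rule mult_left_mono)
    then show ?thesis using x(2) by simp
  qed
qed

text \<open>The k-th derivative of the product has order \<mu> + \<sigma> - \<rho> k with \<sigma>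
  at our disposal. The choice \<open>s1\<close> makes this order 0 and gives the uniform bound;
  \<open>s2\<close>, smaller by 2n, gives decay beyond frequency 2^j. Together they describe a bump
  of frequency width 2^j.\<close>

lemma piece_bound:
  fixes i :: "'n::finite"
  assumes \<rho>: "\<rho> \<le> 1" and kN: "k \<le> N" and M: "\<rho> * real k - \<mu> \<le> 2 * real M"
  shows "\<exists>C\<ge>0. \<forall>j b \<xi>. symb \<rho> i N A \<mu> b \<longrightarrow>
     norm ((partial_deriv i ^^ k) (\<lambda>\<xi>. b \<xi> * dyadic_cut M j \<xi>) \<xi>) \<le> C * (2 ^ j) powr (\<mu> - \<rho> * real k) * japanese (\<xi> /\<^sub>R 2 ^ j) powr (- 2 * real CARD('n))"
proof -
  define s1 where "s1 = \<rho> * real k - \<mu>"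
  define s2 where "s2 = s1 - 2 * real CARD('n)"
  obtain C1 where C1: "0 \<le> C1" "\<And>j b. symb \<rho> i N A \<mu> b \<Longrightarrow> symb \<rho> i N (C1 * (2 ^ j) powr (- s1)) (\<mu> + s1) (\<lambda>\<xi>. b \<xi> * dyadic_cut M j \<xi>)"
    using symb_mult_dyadic_cut[OF \<rho>, of s1 M i N A \<mu>] M by (auto simp: s1_def)
  obtain C2 where C2: "0 \<le> C2" "\<And>j b. symb \<rho> i N A \<mu> b \<Longrightarrow> symb \<rho> i N (C2 * (2 ^ j) powr (- s2)) (\<mu> + s2) (\<lambda>\<xi>. b \<xi> * dyadic_cut M j \<xi>)"
    using symb_mult_dyadic_cut[OF \<rho>, of s2 M i N A \<mu>] M by (auto simp: s2_def s1_def)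
  define C where "C = max C1 C2"
  show ?thesis
  proof (intro exI conjI allI impI)
    show "0 \<le> C * 2 ^ CARD('n)" using C1 by (simp add: C_def)
    fix j b and \<xi> :: "real^'n" assume b: "symb \<rho> i N A \<mu> b"
    let ?l = "2 ^ j :: real" and ?x = "norm ((partial_deriv i ^^ k) (\<lambda>\<xi>. b \<xi> * dyadic_cut M j \<xi>) \<xi>)"
    have "?x \<le> C1 * ?l powr (- s1) * japanese \<xi> powr 0"
      using symb_funpow_bound[OF C1(2)[OF b, of j] kN, of \<xi>] by (simp add: s1_def)
    also have "\<dots> \<le> C * ?l powr (- s1)" by (simp add: C_def mult_right_mono)
    finally have x1: "?x \<le> C * ?l powr (- s1)" .
    have "?x \<le> C2 * ?l powr (- s2) * japanese \<xi> powr (- 2 * real CARD('n))"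
      using symb_funpow_bound[OF C2(2)[OF b, of j] kN, of \<xi>] by (simp add: s2_def s1_def)
    also have "\<dots> = C2 * (?l powr (- s1) * (japanese \<xi> / ?l) powr (- 2 * real CARD('n)))"
      using japanese_pos[of \<xi>] by (simp add: s2_def powr_divide powr_minus powr_add powr_diff field_simps)
    also have "\<dots> \<le> C * (?l powr (- s1) * (japanese \<xi> / ?l) powr (- 2 * real CARD('n)))"
      by (intro mult_right_mono) (auto simp: C_def)
    finally have x2: "?x \<le> (C * ?l powr (- s1)) * (japanese \<xi> / ?l) powr (- 2 * real CARD('n))" by (simp add: mult.assoc)
    have "?x \<le> (C * ?l powr (- s1)) * 2 ^ CARD('n) * japanese (\<xi> /\<^sub>R ?l) powr (- 2 * real CARD('n))"
      by (rule min_one_le_japanese[OF _ x1 x2]) (use C1 in \<open>auto simp: C_def\<close>)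
    then show "?x \<le> C * 2 ^ CARD('n) * ?l powr (\<mu> - \<rho> * real k) * japanese (\<xi> /\<^sub>R ?l) powr (- 2 * real CARD('n))"
      by (simp add: s1_def algebra_simps)
  qed
qed

section \<open>Supremum and weighted square bounds for the kernels\<close>

lemma nn_integral_lborel_affine:
  fixes h :: "real^'n::finite \<Rightarrow> ennreal"
  assumes [measurable]: "h \<in> borel_measurable borel" and c: "c \<noteq> 0"
  shows "(\<integral>\<^sup>+x. h x \<partial>lborel) = ennreal (\<bar>c\<bar> ^ CARD('n)) * (\<integral>\<^sup>+x. h (t + c *\<^sub>R x) \<partial>lborel)"
  by (subst lborel_affine[OF c, of t])
     (simp add: nn_integral_density nn_integral_distr nn_integral_cmult ennreal_power)

definition decay_mass :: "'n::finite itself \<Rightarrow> real" where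
  "decay_mass _ = (LINT \<xi>|lborel. japanese (\<xi> :: real^'n) powr (- 2 * real CARD('n)))"

lemma decay_mass_nonneg [simp]: "0 \<le> decay_mass TYPE('n::finite)"
  unfolding decay_mass_def by (rule Bochner_Integration.integral_nonneg) simp

lemma nn_integral_decay:
  assumes l: "0 < l"
  shows "(\<integral>\<^sup>+\<xi>. ennreal (japanese (\<xi> /\<^sub>R l) powr (- 2 * real CARD('n))) \<partial>(lborel :: (real^'n::finite) measure)) = ennreal (l ^ CARD('n) * decay_mass TYPE('n))"
proof -
  have "(\<integral>\<^sup>+\<xi>. ennreal (japanese \<xi> powr (- 2 * real CARD('n))) \<partial>(lborel :: (real^'n) measure)) = ennreal (decay_mass TYPE('n))"
    unfolding decay_mass_def by (rule nn_integral_eq_integral[OF integrable_japanese_powr]) simp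
  then show ?thesis
    using l by (subst nn_integral_lborel_affine[of _ l 0]) (auto simp: ennreal_mult decay_mass_nonneg)
qed

lemma nn_integral_cmult_decay:
  assumes l: "0 < l"
  shows "(\<integral>\<^sup>+\<xi>. c * ennreal (japanese (\<xi> /\<^sub>R l) powr (- 2 * real CARD('n))) \<partial>(lborel :: (real^'n::finite) measure)) = c * ennreal (l ^ CARD('n) * decay_mass TYPE('n))"
  unfolding nn_integral_decay[OF l, symmetric] by (rule nn_integral_cmult) measurable

text \<open>With k a coordinate of largest modulus, 1 + s |z| \<le> 2n max(1, s |z_k|). Passing from
  the maximum to the sum over all coordinates leaves quantities that derivatives along single axes
  control.\<close>

lemma one_plus_norm_power_le:
  fixes z :: "real^'n::finite"
  assumes s: "0 \<le> s"
  shows "(1 + s * norm z) ^ K \<le> (2 * real CARD('n)) ^ K * (1 + (\<Sum>i\<in>UNIV. (s * \<bar>z $ i\<bar>) ^ K))"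
proof -
  have "finite (range (\<lambda>i. \<bar>z $ i\<bar>))" "range (\<lambda>i. \<bar>z $ i\<bar>) \<noteq> {}" by auto
  from Max_in[OF this] obtain k where "Max (range (\<lambda>i. \<bar>z $ i\<bar>)) = \<bar>z $ k\<bar>" by (rule rangeE)
  then have k: "\<bar>z $ i\<bar> \<le> \<bar>z $ k\<bar>" for i
    using Max_ge[of "range (\<lambda>i. \<bar>z $ i\<bar>)" "\<bar>z $ i\<bar>"] by simp
  have n1: "1 \<le> real CARD('n)" using zero_less_card_finite[where 'a='n] by linarith
  define t where "t = s * \<bar>z $ k\<bar>"
  have t: "0 \<le> t" using s by (simp add: t_def)
  have "norm z \<le> (\<Sum>i\<in>UNIV. \<bar>z $ i\<bar>)" by (rule norm_le_l1_cart)
  also have "\<dots> \<le> real CARD('n) * \<bar>z $ k\<bar>" using sum_bounded_above[of UNIV "\<lambda>i. \<bar>z $ i\<bar>", OF k] by simp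
  finally have "s * norm z \<le> s * (real CARD('n) * \<bar>z $ k\<bar>)" using s by (rule mult_left_mono)
  moreover have "s * (real CARD('n) * \<bar>z $ k\<bar>) = real CARD('n) * t" by (simp add: t_def mult_ac)
  ultimately have "1 + s * norm z \<le> real CARD('n) * 1 + real CARD('n) * t" using n1 by linarith
  also have "\<dots> \<le> (2 * real CARD('n)) * max 1 t"
  proof -
    have "real CARD('n) * 1 \<le> real CARD('n) * max 1 t" "real CARD('n) * t \<le> real CARD('n) * max 1 t"
      by (intro mult_left_mono; simp)+
    then show ?thesis by linarith
  qed
  finally have "(1 + s * norm z) ^ K \<le> ((2 * real CARD('n)) * max 1 t) ^ K" using s by (intro power_mono) auto
  also have "\<dots> = (2 * real CARD('n)) ^ K * max 1 t ^ K" by (rule power_mult_distrib)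
  also have "max 1 t ^ K \<le> 1 + t ^ K" using t by (auto simp: max_def)
  also have "t ^ K \<le> (\<Sum>i\<in>UNIV. (s * \<bar>z $ i\<bar>) ^ K)"
    unfolding t_def using s by (intro member_le_sum) auto
  finally show ?thesis by simp
qed

lemma piece_FT_power:
  fixes b :: "real^'n::finite \<Rightarrow> complex"
  assumes \<rho>: "0 \<le> \<rho>" "\<rho> \<le> 1" and k: "k \<le> N" and M: "- \<mu> \<le> 2 * real M" and b: "symb \<rho> i N A \<mu> b"
  shows "integrable lborel ((partial_deriv i ^^ k) (\<lambda>\<xi>. b \<xi> * dyadic_cut M j \<xi>))"
    and "norm (FT (\<lambda>\<xi>. b \<xi> * dyadic_cut M j \<xi>) z) * \<bar>z $ i\<bar> ^ k = norm (FT ((partial_deriv i ^^ k) (\<lambda>\<xi>. b \<xi> * dyadic_cut M j \<xi>)) z)"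
proof -
  let ?n = "- 2 * real CARD('n)"
  \<comment> \<open>This \<sigma> brings the product down to order -2n, at which symbols are
    integrable.\<close>
  obtain C where C: "symb \<rho> i N (C * (2 ^ j) powr (- (?n - \<mu>))) ?n (\<lambda>\<xi>. b \<xi> * dyadic_cut M j \<xi>)"
    using symb_mult_dyadic_cut[OF \<rho>(2), of "?n - \<mu>" M i N A \<mu>] M b by auto
  note s = symb_le[OF C k]
  show "integrable lborel ((partial_deriv i ^^ k) (\<lambda>\<xi>. b \<xi> * dyadic_cut M j \<xi>))"
    using symb_integrable[OF symb_funpow[OF s order_refl]] \<rho> by simp
  show "norm (FT (\<lambda>\<xi>. b \<xi> * dyadic_cut M j \<xi>) z) * \<bar>z $ i\<bar> ^ k = norm (FT ((partial_deriv i ^^ k) (\<lambda>\<xi>. b \<xi> * dyadic_cut M j \<xi>)) z)"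
    using FT_funpow[OF s order_refl \<rho>(1), of z] by (simp add: norm_mult norm_power)
qed

lemma powr_real_power: "0 < (x::real) \<Longrightarrow> (x powr a) ^ k = x powr (a * real k)"
  by (simp add: powr_powr flip: powr_realpow)

text \<open>The transform is bounded by the L^1 norm: 2^(jn) is the volume of the frequencies
  involved, the k derivatives gain 2^(-j\<rho>k), and the weight consumes exactly that gain.\<close>

lemma piece_sup:
  fixes i :: "'n::finite"
  assumes \<rho>: "0 \<le> \<rho>" "\<rho> \<le> 1" and kN: "k \<le> N" and M: "- \<mu> \<le> 2 * real M" "\<rho> * real k - \<mu> \<le> 2 * real M"
  shows "\<exists>C\<ge>0. \<forall>j b z. symb \<rho> i N A \<mu> b \<longrightarrow>
     norm (FT (\<lambda>\<xi>. b \<xi> * dyadic_cut M j \<xi>) z) * ((2 ^ j) powr \<rho> * \<bar>z $ i\<bar>) ^ k \<le> C * (2 ^ j) powr (\<mu> + real CARD('n))"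
proof -
  obtain C where C: "0 \<le> C" "\<And>j b \<xi>. symb \<rho> i N A \<mu> b \<Longrightarrow>
     norm ((partial_deriv i ^^ k) (\<lambda>\<xi>. b \<xi> * dyadic_cut M j \<xi>) \<xi>) \<le> C * (2 ^ j) powr (\<mu> - \<rho> * real k) * japanese (\<xi> /\<^sub>R 2 ^ j) powr (- 2 * real CARD('n))"
    using piece_bound[OF \<rho>(2) kN M(2), of i A] by blast
  let ?D = "decay_mass TYPE('n)"
  show ?thesis
  proof (intro exI conjI allI impI)
    show "0 \<le> C * ?D" using C(1) by simp
    fix j b and z :: "real^'n" assume b: "symb \<rho> i N A \<mu> b"
    define l where "l = (2::real) ^ j"
    have l: "0 < l" by (simp add: l_def)
    let ?g = "(partial_deriv i ^^ k) (\<lambda>\<xi>. b \<xi> * dyadic_cut M j \<xi>)"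
    note int = piece_FT_power(1)[OF \<rho> kN M(1) b, of j]
    note eq = piece_FT_power(2)[OF \<rho> kN M(1) b, of j z]
    have "ennreal (norm (FT ?g z)) \<le> ennreal (LINT \<xi>|lborel. norm (?g \<xi>))"
      by (intro ennreal_leI norm_FT_le)
    also have "\<dots> = (\<integral>\<^sup>+\<xi>. ennreal (norm (?g \<xi>)) \<partial>lborel)"
      by (rule nn_integral_eq_integral[symmetric, OF integrable_norm[OF int]]) simp
    also have "\<dots> \<le> (\<integral>\<^sup>+\<xi>. ennreal (C * l powr (\<mu> - \<rho> * real k)) * ennreal (japanese (\<xi> /\<^sub>R l) powr (- 2 * real CARD('n))) \<partial>(lborel :: (real^'n) measure))"
      using C(2)[OF b, of j] C(1) by (intro nn_integral_mono) (auto simp: l_def ennreal_leI simp flip: ennreal_mult)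
    also have "\<dots> = ennreal (C * l powr (\<mu> - \<rho> * real k)) * ennreal (l ^ CARD('n) * ?D)"
      by (rule nn_integral_cmult_decay[OF l])
    also have "\<dots> = ennreal (C * l powr (\<mu> - \<rho> * real k) * (l ^ CARD('n) * ?D))"
      using C(1) l by (subst ennreal_mult) auto
    finally have le: "norm (FT ?g z) \<le> C * l powr (\<mu> - \<rho> * real k) * (l ^ CARD('n) * ?D)"
      using C(1) l by (subst (asm) ennreal_le_iff) auto
    have "norm (FT (\<lambda>\<xi>. b \<xi> * dyadic_cut M j \<xi>) z) * (l powr \<rho> * \<bar>z $ i\<bar>) ^ k = l powr (\<rho> * real k) * norm (FT ?g z)"
      using eq l by (simp add: power_mult_distrib powr_real_power mult_ac)
    also have "\<dots> \<le> l powr (\<rho> * real k) * (C * l powr (\<mu> - \<rho> * real k) * (l ^ CARD('n) * ?D))"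
      by (rule mult_left_mono[OF le]) simp
    also have "\<dots> = C * ?D * (l powr (\<rho> * real k) * l powr (\<mu> - \<rho> * real k) * l powr real CARD('n))"
      using l by (simp add: powr_realpow mult_ac)
    also have "\<dots> = C * ?D * l powr (\<mu> + real CARD('n))"
      by (simp flip: powr_add)
    finally show "norm (FT (\<lambda>\<xi>. b \<xi> * dyadic_cut M j \<xi>) z) * ((2 ^ j) powr \<rho> * \<bar>z $ i\<bar>) ^ k \<le> C * ?D * (2 ^ j) powr (\<mu> + real CARD('n))"
      by (simp add: l_def)
  qed
qed

text \<open>The same count with Bessel's inequality in place of the L^1 bound: the size of the
  symbol is squared, while the frequency volume 2^(jn) enters once.\<close>

lemma piece_L2:
  fixes i :: "'n::finite"
  assumes \<rho>: "0 \<le> \<rho>" "\<rho> \<le> 1" and kN: "k \<le> N" and M: "- \<mu> \<le> 2 * real M" "\<rho> * real k - \<mu> \<le> 2 * real M"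
  shows "\<exists>C\<ge>0. \<forall>j b. symb \<rho> i N A \<mu> b \<longrightarrow>
     (\<integral>\<^sup>+z. ennreal ((norm (FT (\<lambda>\<xi>. b \<xi> * dyadic_cut M j \<xi>) z))\<^sup>2 * ((2 ^ j) powr \<rho> * \<bar>z $ i\<bar>) ^ (2 * k)) \<partial>lborel) \<le> ennreal (C * (2 ^ j) powr (2 * \<mu> + real CARD('n)))"
proof -
  obtain C where C: "0 \<le> C" "\<And>j b \<xi>. symb \<rho> i N A \<mu> b \<Longrightarrow>
     norm ((partial_deriv i ^^ k) (\<lambda>\<xi>. b \<xi> * dyadic_cut M j \<xi>) \<xi>) \<le> C * (2 ^ j) powr (\<mu> - \<rho> * real k) * japanese (\<xi> /\<^sub>R 2 ^ j) powr (- 2 * real CARD('n))"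
    using piece_bound[OF \<rho>(2) kN M(2), of i A] by blast
  let ?D = "decay_mass TYPE('n)" and ?P = "(2 * pi) ^ CARD('n)"
  show ?thesis
  proof (intro exI conjI allI impI)
    show "0 \<le> ?P * C\<^sup>2 * ?D" using C(1) by simp
    fix j b assume b: "symb \<rho> i N A \<mu> b"
    define l where "l = (2::real) ^ j"
    have l: "0 < l" by (simp add: l_def)
    let ?g = "(partial_deriv i ^^ k) (\<lambda>\<xi>. b \<xi> * dyadic_cut M j \<xi>)" and ?n = "- 2 * real CARD('n)"
    note int = piece_FT_power(1)[OF \<rho> kN M(1) b, of j]
    note eq = piece_FT_power(2)[OF \<rho> kN M(1) b, of j]
    have [measurable]: "?g \<in> borel_measurable borel" using int by auto
    have sq: "(norm (?g \<xi>))\<^sup>2 \<le> (C * l powr (\<mu> - \<rho> * real k))\<^sup>2 * japanese (\<xi> /\<^sub>R l) powr ?n" for \<xi>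
    proof -
      have "(norm (?g \<xi>))\<^sup>2 \<le> (C * l powr (\<mu> - \<rho> * real k) * japanese (\<xi> /\<^sub>R l) powr ?n)\<^sup>2"
        using C(2)[OF b, of j \<xi>] by (intro power_mono) (auto simp: l_def)
      also have "\<dots> = (C * l powr (\<mu> - \<rho> * real k))\<^sup>2 * (japanese (\<xi> /\<^sub>R l) powr ?n * japanese (\<xi> /\<^sub>R l) powr ?n)"
        by (simp add: power2_eq_square mult_ac)
      \<comment> \<open>Squaring doubles the decay factor; one copy is bounded by 1 and the other
        keeps the integral finite.\<close>
      also have "\<dots> \<le> (C * l powr (\<mu> - \<rho> * real k))\<^sup>2 * (japanese (\<xi> /\<^sub>R l) powr ?n * 1)"
        using japanese_powr_mono[of ?n 0 "\<xi> /\<^sub>R l"] by (intro mult_left_mono) auto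
      finally show ?thesis by simp
    qed
    have "(\<integral>\<^sup>+z. ennreal ((norm (FT (\<lambda>\<xi>. b \<xi> * dyadic_cut M j \<xi>) z))\<^sup>2 * (l powr \<rho> * \<bar>z $ i\<bar>) ^ (2 * k)) \<partial>lborel)
      = (\<integral>\<^sup>+z. ennreal (l powr (2 * \<rho> * real k)) * ennreal ((norm (FT ?g z))\<^sup>2) \<partial>lborel)"
    proof (intro nn_integral_cong)
      fix z
      have "(norm (FT (\<lambda>\<xi>. b \<xi> * dyadic_cut M j \<xi>) z))\<^sup>2 * (l powr \<rho> * \<bar>z $ i\<bar>) ^ (2 * k) = (l powr \<rho>) ^ (2 * k) * (norm (FT (\<lambda>\<xi>. b \<xi> * dyadic_cut M j \<xi>) z) * \<bar>z $ i\<bar> ^ k)\<^sup>2"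
        by (simp add: power_mult_distrib power_mult[symmetric] mult_ac)
      also have "\<dots> = l powr (2 * \<rho> * real k) * (norm (FT ?g z))\<^sup>2"
        unfolding eq using l by (simp add: powr_real_power mult_ac)
      finally show "ennreal ((norm (FT (\<lambda>\<xi>. b \<xi> * dyadic_cut M j \<xi>) z))\<^sup>2 * (l powr \<rho> * \<bar>z $ i\<bar>) ^ (2 * k)) = ennreal (l powr (2 * \<rho> * real k)) * ennreal ((norm (FT ?g z))\<^sup>2)"
        by (simp add: ennreal_mult)
    qed
    also have "\<dots> = ennreal (l powr (2 * \<rho> * real k)) * (\<integral>\<^sup>+z. ennreal ((norm (FT ?g z))\<^sup>2) \<partial>lborel)"
      by (rule nn_integral_cmult) measurable
    also have "\<dots> \<le> ennreal (l powr (2 * \<rho> * real k)) * (ennreal ?P * (\<integral>\<^sup>+\<xi>. ennreal ((norm (?g \<xi>))\<^sup>2) \<partial>lborel))"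
      by (intro mult_left_mono FT_bessel[OF int]) simp
    also have "\<dots> \<le> ennreal (l powr (2 * \<rho> * real k)) * (ennreal ?P * (\<integral>\<^sup>+\<xi>. ennreal ((C * l powr (\<mu> - \<rho> * real k))\<^sup>2) * ennreal (japanese (\<xi> /\<^sub>R l) powr ?n) \<partial>(lborel :: (real^'n) measure)))"
      using sq by (intro mult_left_mono nn_integral_mono) (auto simp: ennreal_leI simp flip: ennreal_mult)
    also have "(\<integral>\<^sup>+\<xi>. ennreal ((C * l powr (\<mu> - \<rho> * real k))\<^sup>2) * ennreal (japanese (\<xi> /\<^sub>R l) powr ?n) \<partial>(lborel :: (real^'n) measure))
        = ennreal ((C * l powr (\<mu> - \<rho> * real k))\<^sup>2) * ennreal (l ^ CARD('n) * ?D)"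
      by (rule nn_integral_cmult_decay[OF l])
    also have "ennreal (l powr (2 * \<rho> * real k)) * (ennreal ?P * (ennreal ((C * l powr (\<mu> - \<rho> * real k))\<^sup>2) * ennreal (l ^ CARD('n) * ?D)))
        = ennreal (l powr (2 * \<rho> * real k) * (?P * ((C * l powr (\<mu> - \<rho> * real k))\<^sup>2 * (l ^ CARD('n) * ?D))))"
      using l by (simp add: ennreal_mult)
    also have "l powr (2 * \<rho> * real k) * (?P * ((C * l powr (\<mu> - \<rho> * real k))\<^sup>2 * (l ^ CARD('n) * ?D)))
        = ?P * C\<^sup>2 * ?D * (l powr (2 * \<rho> * real k) * l powr ((\<mu> - \<rho> * real k) * 2) * l powr real CARD('n))"
      using l powr_real_power[OF l, of "\<mu> - \<rho> * real k" 2] by (simp add: powr_realpow power_mult_distrib mult_ac)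
    also have "l powr (2 * \<rho> * real k) * l powr ((\<mu> - \<rho> * real k) * 2) * l powr real CARD('n) = l powr (2 * \<mu> + real CARD('n))"
      by (simp add: algebra_simps flip: powr_add)
    finally show "(\<integral>\<^sup>+z. ennreal ((norm (FT (\<lambda>\<xi>. b \<xi> * dyadic_cut M j \<xi>) z))\<^sup>2 * ((2 ^ j) powr \<rho> * \<bar>z $ i\<bar>) ^ (2 * k)) \<partial>lborel) \<le> ennreal (?P * C\<^sup>2 * ?D * (2 ^ j) powr (2 * \<mu> + real CARD('n)))"
      by (simp add: l_def)
  qed
qed

lemma kernel_sup:
  assumes \<rho>: "0 \<le> \<rho>" "\<rho> \<le> 1" and M: "- \<mu> \<le> 2 * real M" "\<rho> * real N - \<mu> \<le> 2 * real M"
  shows "\<exists>C\<ge>0. \<forall>j (b :: real^'n::finite \<Rightarrow> complex) z. (\<forall>i. symb \<rho> i N A \<mu> b) \<longrightarrow>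
     norm (FT (\<lambda>\<xi>. b \<xi> * dyadic_cut M j \<xi>) z) * (1 + (2 ^ j) powr \<rho> * norm z) ^ N \<le> C * (2 ^ j) powr (\<mu> + real CARD('n))"
proof -
  have "\<forall>i::'n. \<exists>C\<ge>0. \<forall>j b z. symb \<rho> i N A \<mu> b \<longrightarrow>
     norm (FT (\<lambda>\<xi>. b \<xi> * dyadic_cut M j \<xi>) z) * ((2 ^ j) powr \<rho> * \<bar>z $ i\<bar>) ^ N \<le> C * (2 ^ j) powr (\<mu> + real CARD('n))"
    using piece_sup[OF \<rho> order_refl M] by blast
  then obtain C where C: "\<And>i. 0 \<le> C i" "\<And>(i::'n) j b z. symb \<rho> i N A \<mu> b \<Longrightarrow>
     norm (FT (\<lambda>\<xi>. b \<xi> * dyadic_cut M j \<xi>) z) * ((2 ^ j) powr \<rho> * \<bar>z $ i\<bar>) ^ N \<le> C i * (2 ^ j) powr (\<mu> + real CARD('n))"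
    by metis
  \<comment> \<open>For k = 0 nothing is differentiated, so any direction serves and
    \<open>undefined\<close> just names one. This instance accounts for the summand 1 in
    \<open>one_plus_norm_power_le\<close>.\<close>
  obtain C0 where C0: "0 \<le> C0" "\<And>j b z. symb \<rho> (undefined::'n) N A \<mu> b \<Longrightarrow>
     norm (FT (\<lambda>\<xi>. b \<xi> * dyadic_cut M j \<xi>) z) \<le> C0 * (2 ^ j) powr (\<mu> + real CARD('n))"
    using piece_sup[OF \<rho> le0, of \<mu> M "undefined::'n" N A] M by auto
  let ?K = "(2 * real CARD('n)) ^ N"
  show ?thesis
  proof (intro exI conjI allI impI)
    show "0 \<le> ?K * (C0 + (\<Sum>i\<in>UNIV. C i))" using C C0 by (simp add: sum_nonneg)
    fix j and b :: "real^'n \<Rightarrow> complex" and z :: "real^'n" assume b: "\<forall>i. symb \<rho> i N A \<mu> b"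
    let ?F = "norm (FT (\<lambda>\<xi>. b \<xi> * dyadic_cut M j \<xi>) z)" and ?L = "(2 ^ j) powr (\<mu> + real CARD('n)) :: real"
    have "?F * (1 + (2 ^ j) powr \<rho> * norm z) ^ N \<le> ?F * (?K * (1 + (\<Sum>i\<in>UNIV. ((2 ^ j) powr \<rho> * \<bar>z $ i\<bar>) ^ N)))"
      by (intro mult_left_mono one_plus_norm_power_le) auto
    also have "\<dots> = ?K * (?F + (\<Sum>i\<in>UNIV. ?F * ((2 ^ j) powr \<rho> * \<bar>z $ i\<bar>) ^ N))"
      by (simp add: sum_distrib_left algebra_simps)
    also have "\<dots> \<le> ?K * (C0 * ?L + (\<Sum>i\<in>UNIV. C i * ?L))"
      using b by (intro mult_left_mono add_mono sum_mono C C0) auto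
    also have "\<dots> = ?K * (C0 + (\<Sum>i\<in>UNIV. C i)) * ?L"
    proof -
      have "C0 * ?L + (\<Sum>i\<in>UNIV. C i * ?L) = (C0 + (\<Sum>i\<in>UNIV. C i)) * ?L"
        by (simp add: sum_distrib_right distrib_right)
      then show ?thesis by (simp only: mult.assoc)
    qed
    finally show "?F * (1 + (2 ^ j) powr \<rho> * norm z) ^ N \<le> ?K * (C0 + (\<Sum>i\<in>UNIV. C i)) * ?L" .
  qed
qed

lemma kernel_L2:
  assumes \<rho>: "0 \<le> \<rho>" "\<rho> \<le> 1" and M: "- \<mu> \<le> 2 * real M" "\<rho> * real N - \<mu> \<le> 2 * real M"
  shows "\<exists>C\<ge>0. \<forall>j (b :: real^'n::finite \<Rightarrow> complex). (\<forall>i. symb \<rho> i N A \<mu> b) \<longrightarrow>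
     (\<integral>\<^sup>+z. ennreal ((norm (FT (\<lambda>\<xi>. b \<xi> * dyadic_cut M j \<xi>) z))\<^sup>2 * (1 + (2 ^ j) powr \<rho> * norm z) ^ (2 * N)) \<partial>lborel)
       \<le> ennreal (C * (2 ^ j) powr (2 * \<mu> + real CARD('n)))"
proof -
  have "\<forall>i::'n. \<exists>C\<ge>0. \<forall>j b. symb \<rho> i N A \<mu> b \<longrightarrow>
     (\<integral>\<^sup>+z. ennreal ((norm (FT (\<lambda>\<xi>. b \<xi> * dyadic_cut M j \<xi>) z))\<^sup>2 * ((2 ^ j) powr \<rho> * \<bar>z $ i\<bar>) ^ (2 * N)) \<partial>lborel) \<le> ennreal (C * (2 ^ j) powr (2 * \<mu> + real CARD('n)))"
    using piece_L2[OF \<rho> order_refl M] by blast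
  from choice[OF this] obtain C where C': "\<And>i::'n. 0 \<le> C i \<and> (\<forall>j b. symb \<rho> i N A \<mu> b \<longrightarrow>
     (\<integral>\<^sup>+z. ennreal ((norm (FT (\<lambda>\<xi>. b \<xi> * dyadic_cut M j \<xi>) z))\<^sup>2 * ((2 ^ j) powr \<rho> * \<bar>z $ i\<bar>) ^ (2 * N)) \<partial>lborel) \<le> ennreal (C i * (2 ^ j) powr (2 * \<mu> + real CARD('n))))"
    by blast
  then have C: "\<And>i. 0 \<le> C i" "\<And>(i::'n) j b. symb \<rho> i N A \<mu> b \<Longrightarrow>
     (\<integral>\<^sup>+z. ennreal ((norm (FT (\<lambda>\<xi>. b \<xi> * dyadic_cut M j \<xi>) z))\<^sup>2 * ((2 ^ j) powr \<rho> * \<bar>z $ i\<bar>) ^ (2 * N)) \<partial>lborel) \<le> ennreal (C i * (2 ^ j) powr (2 * \<mu> + real CARD('n)))"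
    by blast+
  obtain C0 where C0: "0 \<le> C0" "\<And>j b. symb \<rho> (undefined::'n) N A \<mu> b \<Longrightarrow>
     (\<integral>\<^sup>+z. ennreal ((norm (FT (\<lambda>\<xi>. b \<xi> * dyadic_cut M j \<xi>) z))\<^sup>2) \<partial>lborel) \<le> ennreal (C0 * (2 ^ j) powr (2 * \<mu> + real CARD('n)))"
    using piece_L2[OF \<rho> le0, of \<mu> M "undefined::'n" N A] M by auto
  let ?K = "(2 * real CARD('n)) ^ (2 * N)"
  show ?thesis
  proof (intro exI conjI allI impI)
    show "0 \<le> ?K * (C0 + (\<Sum>i\<in>UNIV. C i))" using C C0 by (simp add: sum_nonneg)
    fix j and b :: "real^'n \<Rightarrow> complex" assume b: "\<forall>i. symb \<rho> i N A \<mu> b"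
    let ?L = "(2 ^ j) powr (2 * \<mu> + real CARD('n)) :: real"
    define F where "F z = (norm (FT (\<lambda>\<xi>. b \<xi> * dyadic_cut M j \<xi>) z))\<^sup>2" for z
    define s where "s = (2 ^ j :: real) powr \<rho>"
    have s: "0 \<le> s" by (simp add: s_def)
    have F: "0 \<le> F z" for z by (simp add: F_def)
    have "(\<lambda>\<xi>. b \<xi> * dyadic_cut M j \<xi>) \<in> borel_measurable borel"
      using piece_FT_power(1)[OF \<rho> le0 M(1) spec[OF b, of undefined], of j] by auto
    then have Fm [measurable]: "F \<in> borel_measurable borel" unfolding F_def by measurable
    have le: "ennreal (F z * (1 + s * norm z) ^ (2 * N)) \<le> ennreal ?K * (ennreal (F z) + (\<Sum>i\<in>UNIV. ennreal (F z * (s * \<bar>z $ i\<bar>) ^ (2 * N))))" for z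
    proof -
      have "F z * (1 + s * norm z) ^ (2 * N) \<le> F z * (?K * (1 + (\<Sum>i\<in>UNIV. (s * \<bar>z $ i\<bar>) ^ (2 * N))))"
        by (intro mult_left_mono one_plus_norm_power_le F s)
      also have "\<dots> = ?K * (F z + (\<Sum>i\<in>UNIV. F z * (s * \<bar>z $ i\<bar>) ^ (2 * N)))"
        by (simp add: sum_distrib_left algebra_simps)
      finally have "ennreal (F z * (1 + s * norm z) ^ (2 * N)) \<le> ennreal (?K * (F z + (\<Sum>i\<in>UNIV. F z * (s * \<bar>z $ i\<bar>) ^ (2 * N))))"
        by (rule ennreal_leI)
      moreover have "ennreal (?K * (F z + (\<Sum>i\<in>UNIV. G i))) = ennreal ?K * (ennreal (F z) + (\<Sum>i\<in>UNIV. ennreal (G i)))"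
        if "\<And>i. 0 \<le> G i" for G :: "'n \<Rightarrow> real"
        using F[of z] that by (subst ennreal_mult) (simp_all add: sum_nonneg)
      ultimately show ?thesis using F s by simp
    qed
    have "(\<integral>\<^sup>+z. ennreal (F z * (1 + s * norm z) ^ (2 * N)) \<partial>lborel)
        \<le> (\<integral>\<^sup>+z. ennreal ?K * (ennreal (F z) + (\<Sum>i\<in>UNIV. ennreal (F z * (s * \<bar>z $ i\<bar>) ^ (2 * N)))) \<partial>lborel)"
      by (intro nn_integral_mono le)
    also have "\<dots> = ennreal ?K * ((\<integral>\<^sup>+z. ennreal (F z) \<partial>lborel) + (\<Sum>i\<in>UNIV. \<integral>\<^sup>+z. ennreal (F z * (s * \<bar>z $ i\<bar>) ^ (2 * N)) \<partial>lborel))"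
      by (simp add: nn_integral_cmult nn_integral_add nn_integral_sum)
    also have "\<dots> \<le> ennreal ?K * (ennreal (C0 * ?L) + (\<Sum>i\<in>UNIV. ennreal (C i * ?L)))"
      using b unfolding F_def s_def by (intro mult_left_mono add_mono sum_mono C C0) auto
    also have "\<dots> = ennreal (?K * (C0 + (\<Sum>i\<in>UNIV. C i)) * ?L)"
    proof -
      have "C0 * ?L + (\<Sum>i\<in>UNIV. C i * ?L) = (C0 + (\<Sum>i\<in>UNIV. C i)) * ?L"
        by (simp add: sum_distrib_right distrib_right)
      moreover have "ennreal (C0 * ?L) + (\<Sum>i\<in>UNIV. ennreal (C i * ?L)) = ennreal (C0 * ?L + (\<Sum>i\<in>UNIV. C i * ?L))"
        using C(1) C0(1) by (simp add: sum_nonneg)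
      ultimately show ?thesis
        using C(1) C0(1) by (simp add: ennreal_mult'[symmetric] mult.assoc)
    qed
    finally show "(\<integral>\<^sup>+z. ennreal ((norm (FT (\<lambda>\<xi>. b \<xi> * dyadic_cut M j \<xi>) z))\<^sup>2 * (1 + (2 ^ j) powr \<rho> * norm z) ^ (2 * N)) \<partial>lborel)
       \<le> ennreal (?K * (C0 + (\<Sum>i\<in>UNIV. C i)) * ?L)" by (simp only: F_def s_def)
  qed
qed

section \<open>Maximal function estimates\<close>

lemma emeasure_cube:
  fixes p :: "real^'n::finite"
  assumes "0 \<le> l"
  shows "emeasure lborel (cbox p (p + (\<chi> i. l))) = ennreal (l ^ CARD('n))"
proof -
  have "emeasure lborel (cbox p (p + (\<chi> i. l))) = (\<Prod>b\<in>Basis. (p + (\<chi> i. l) - p) \<bullet> b)"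
    by (rule emeasure_lborel_cbox) (auto simp: Basis_vec_eq inner_axis assms)
  also have "(\<Prod>b\<in>Basis. (p + (\<chi> i. l) - p) \<bullet> b) = l ^ CARD('n)"
    by (simp add: prod_Basis_vec inner_axis)
  finally show ?thesis .
qed

lemma nn_integral_cube_le_maximal:
  fixes f :: "real^'n::finite \<Rightarrow> complex"
  assumes l: "0 < l" and x: "x \<in> cbox p (p + (\<chi> i. l))"
  shows "(\<integral>\<^sup>+y\<in>cbox p (p + (\<chi> i. l)). ennreal (norm (f y)) \<partial>lborel) \<le> ennreal (l ^ CARD('n)) * maximal f x"
proof -
  let ?Q = "cbox p (p + (\<chi> i. l))"
  have Q: "?Q \<in> cubes_through x" using l x by (auto simp: cubes_through_def)
  have "cube_mean ?Q f \<le> maximal f x" unfolding maximal_def by (rule SUP_upper[OF Q])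
  moreover have "cube_mean ?Q f = (\<integral>\<^sup>+y\<in>?Q. ennreal (norm (f y)) \<partial>lborel) / ennreal (l ^ CARD('n))"
    unfolding cube_mean_def nn_integral_completion using emeasure_cube[of l p] l by simp
  ultimately have "(\<integral>\<^sup>+y\<in>?Q. ennreal (norm (f y)) \<partial>lborel) / ennreal (l ^ CARD('n)) * ennreal (l ^ CARD('n)) \<le> maximal f x * ennreal (l ^ CARD('n))"
    by (intro mult_right_mono) auto
  moreover have "X / ennreal (l ^ CARD('n)) * ennreal (l ^ CARD('n)) = X" for X
  proof -
    have "X / ennreal (l ^ CARD('n)) * ennreal (l ^ CARD('n)) = X * ennreal (l ^ CARD('n)) / ennreal (l ^ CARD('n))"
      by (simp add: ennreal_times_divide mult.commute)
    then show ?thesis using l by (simp add: mult_divide_eq_ennreal)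
  qed
  ultimately show ?thesis by (simp add: mult.commute)
qed

lemma ennreal_le_suminf: "F k \<le> (\<Sum>k. F k)" for F :: "nat \<Rightarrow> ennreal"
proof -
  have "sum F {k} \<le> (\<Sum>k. F k)" by (rule sum_le_suminf) auto
  then show ?thesis by simp
qed

text \<open>Let k be least with |y - x| \<le> 2^k s. Then y lies in the k-th cube, and minimality
  makes 1 + |y - x|/s at least 2^k / 2, which also holds for k = 0. The term of index k alone
  dominates the left-hand side.\<close>

lemma tail_weight_le_suminf:
  fixes y :: "real^'n::finite"
  assumes s: "0 < s"
  shows "ennreal (1 / (1 + norm (y - x) / s) ^ (n + 1))
    \<le> (\<Sum>k. ennreal (2 ^ (n + 1) / (2 ^ k) ^ (n + 1)) * indicator (cbox (x - (\<chi> i. 2 ^ k * s)) (x - (\<chi> i. 2 ^ k * s) + (\<chi> i. 2 * 2 ^ k * s))) y)"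
    (is "_ \<le> (\<Sum>k. ?F k)")
proof -
  obtain k0 where "norm (y - x) / s \<le> 2 ^ k0"
    using real_arch_pow[of 2 "norm (y - x) / s"] less_imp_le by auto
  then have ex: "\<exists>k. norm (y - x) \<le> 2 ^ k * s" using s by (auto simp: field_simps)
  define k where "k = (LEAST k. norm (y - x) \<le> 2 ^ k * s)"
  have k: "norm (y - x) \<le> 2 ^ k * s" unfolding k_def by (rule LeastI_ex[OF ex])
  have "y \<in> cbox (x - (\<chi> i. 2 ^ k * s)) (x - (\<chi> i. 2 ^ k * s) + (\<chi> i. 2 * 2 ^ k * s))"
    unfolding mem_box_cart
  proof (intro allI conjI)
    fix i
    have "\<bar>(y - x) $ i\<bar> \<le> 2 ^ k * s" using component_le_norm_cart[of "y - x" i] k by linarith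
    then show "(x - (\<chi> i. 2 ^ k * s)) $ i \<le> y $ i" "y $ i \<le> (x - (\<chi> i. 2 ^ k * s) + (\<chi> i. 2 * 2 ^ k * s)) $ i"
      by (auto simp: abs_le_iff algebra_simps)
  qed
  then have F: "?F k = ennreal (2 ^ (n + 1) / (2 ^ k) ^ (n + 1))" by simp
  have "2 ^ k / 2 \<le> 1 + norm (y - x) / s"
  proof (cases k)
    case 0 then show ?thesis using s by (simp add: add_increasing2)
  next
    case (Suc k')
    then have "\<not> norm (y - x) \<le> 2 ^ k' * s" unfolding k_def using not_less_Least[of k' "\<lambda>k. norm (y - x) \<le> 2 ^ k * s"] by simp
    then have "2 ^ k' \<le> norm (y - x) / s" using s by (simp add: field_simps)
    then show ?thesis by (simp add: Suc)
  qed
  then have "(2 ^ k / 2) ^ (n + 1) \<le> (1 + norm (y - x) / s) ^ (n + 1)" by (rule power_mono) simp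
  then have "1 / (1 + norm (y - x) / s) ^ (n + 1) \<le> 1 / (2 ^ k / 2) ^ (n + 1)"
    using s by (intro divide_left_mono mult_pos_pos zero_less_power) (auto simp: add_pos_nonneg)
  also have "1 / (2 ^ k / 2) ^ (n + 1) = (2 ^ (n + 1) / (2 ^ k) ^ (n + 1) :: real)" by (simp add: power_divide)
  finally have "ennreal (1 / (1 + norm (y - x) / s) ^ (n + 1)) \<le> ?F k" unfolding F by (rule ennreal_leI)
  also have "?F k \<le> (\<Sum>k. ?F k)" by (rule ennreal_le_suminf)
  finally show ?thesis .
qed

text \<open>The k-th cube has side 2^(k+1) s and contributes (2^(k+1) s)^n Mf, against a coefficient
  2^(n+1) 2^(-k(n+1)). The power n + 1 leaves 2 4^n s^n 2^(-k), and the geometric series doubles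
  this.\<close>

lemma tail_weight_maximal:
  fixes f :: "real^'n::finite \<Rightarrow> complex"
  assumes [measurable]: "f \<in> borel_measurable borel" and s: "0 < s"
  shows "(\<integral>\<^sup>+y. ennreal (norm (f y)) * ennreal (1 / (1 + norm (y - x) / s) ^ (CARD('n) + 1)) \<partial>lborel)
    \<le> ennreal (4 * 4 ^ CARD('n) * s ^ CARD('n)) * maximal f x"
proof -
  let ?n = "CARD('n)"
  let ?B = "\<lambda>k::nat. cbox (x - (\<chi> i. 2 ^ k * s)) (x - (\<chi> i. 2 ^ k * s) + (\<chi> i. 2 * 2 ^ k * s))"
  let ?c = "\<lambda>k::nat. 2 ^ (?n + 1) / (2 ^ k) ^ (?n + 1) :: real"
  have "(\<integral>\<^sup>+y. ennreal (norm (f y)) * ennreal (1 / (1 + norm (y - x) / s) ^ (?n + 1)) \<partial>lborel)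
     \<le> (\<integral>\<^sup>+y. (\<Sum>k. ennreal (?c k) * (ennreal (norm (f y)) * indicator (?B k) y)) \<partial>lborel)"
  proof (intro nn_integral_mono)
    fix y
    have "ennreal (norm (f y)) * ennreal (1 / (1 + norm (y - x) / s) ^ (?n + 1)) \<le> ennreal (norm (f y)) * (\<Sum>k. ennreal (?c k) * indicator (?B k) y)"
      by (intro mult_left_mono tail_weight_le_suminf s) simp
    also have "\<dots> = (\<Sum>k. ennreal (norm (f y)) * (ennreal (?c k) * indicator (?B k) y))" by simp
    finally show "ennreal (norm (f y)) * ennreal (1 / (1 + norm (y - x) / s) ^ (?n + 1)) \<le> (\<Sum>k. ennreal (?c k) * (ennreal (norm (f y)) * indicator (?B k) y))"
      by (simp only: mult.left_commute)
  qed
  also have "\<dots> = (\<Sum>k. \<integral>\<^sup>+y. ennreal (?c k) * (ennreal (norm (f y)) * indicator (?B k) y) \<partial>lborel)"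
    by (rule nn_integral_suminf) measurable
  also have "\<dots> = (\<Sum>k. ennreal (?c k) * (\<integral>\<^sup>+y\<in>?B k. ennreal (norm (f y)) \<partial>lborel))"
    by (intro suminf_cong nn_integral_cmult) measurable
  also have "\<dots> \<le> (\<Sum>k. ennreal (2 * 4 ^ ?n * s ^ ?n * (1 / 2) ^ k) * maximal f x)"
  proof (rule suminf_le)
    fix k :: nat
    have "(\<integral>\<^sup>+y\<in>?B k. ennreal (norm (f y)) \<partial>lborel) \<le> ennreal ((2 * 2 ^ k * s) ^ ?n) * maximal f x"
      by (rule nn_integral_cube_le_maximal) (use s in \<open>auto simp: mem_box_cart\<close>)
    then have "ennreal (?c k) * (\<integral>\<^sup>+y\<in>?B k. ennreal (norm (f y)) \<partial>lborel) \<le> ennreal (?c k) * (ennreal ((2 * 2 ^ k * s) ^ ?n) * maximal f x)"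
      by (rule mult_left_mono) simp
    also have "\<dots> = ennreal (?c k * (2 * 2 ^ k * s) ^ ?n) * maximal f x"
    proof -
      have "ennreal (?c k * (2 * 2 ^ k * s) ^ ?n) = ennreal (?c k) * ennreal ((2 * 2 ^ k * s) ^ ?n)"
        by (rule ennreal_mult) (use s in auto)
      then show ?thesis by (simp only: mult.assoc)
    qed
    also have "?c k * (2 * 2 ^ k * s) ^ ?n = 2 * (2 ^ ?n * 2 ^ ?n) * s ^ ?n * (1 / 2) ^ k"
    proof -
      have "2 ^ (?n + 1) / q ^ (?n + 1) * (2 * q * s) ^ ?n = 2 * (2 ^ ?n * 2 ^ ?n) * s ^ ?n * (1 / q)" if "0 < q" for q
        using that by (simp add: power_mult_distrib field_simps)
      from this[of "2 ^ k"] show ?thesis by (simp add: power_one_over)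
    qed
    also have "(2 ^ ?n * 2 ^ ?n :: real) = 4 ^ ?n" by (simp flip: power_mult_distrib)
    finally show "ennreal (?c k) * (\<integral>\<^sup>+y\<in>?B k. ennreal (norm (f y)) \<partial>lborel) \<le> ennreal (2 * 4 ^ ?n * s ^ ?n * (1 / 2) ^ k) * maximal f x" .
  qed auto
  also have "\<dots> = (\<Sum>k. ennreal (2 * 4 ^ ?n * s ^ ?n * (1 / 2) ^ k)) * maximal f x" by simp
  also have "(\<Sum>k. ennreal (2 * 4 ^ ?n * s ^ ?n * (1 / 2) ^ k)) = ennreal (\<Sum>k. 2 * 4 ^ ?n * s ^ ?n * (1 / 2) ^ k)"
    using s by (intro suminf_ennreal_eq summable_sums summable_mult summable_geometric) auto
  also have "(\<Sum>k. 2 * 4 ^ ?n * s ^ ?n * (1 / 2) ^ k) = 4 * 4 ^ ?n * s ^ ?n"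
    by (subst suminf_mult) (auto simp: suminf_geometric)
  finally show ?thesis .
qed

text \<open>Cauchy--Schwarz after multiplying and dividing by the weight (1 + w |z|)^N; by
  translation the first factor does not depend on y.\<close>

lemma kernel_CS:
  fixes F :: "real^'n::finite \<Rightarrow> complex"
  assumes [measurable]: "F \<in> borel_measurable borel" "S \<in> sets borel" and w: "0 \<le> w"
  shows "(\<integral>\<^sup>+x\<in>S. ennreal (norm (F (x - y))) \<partial>lborel)\<^sup>2 \<le>
    (\<integral>\<^sup>+z. ennreal ((norm (F z))\<^sup>2 * (1 + w * norm z) ^ (2 * N)) \<partial>lborel) * (\<integral>\<^sup>+x\<in>S. ennreal (1 / (1 + w * norm (x - y)) ^ (2 * N)) \<partial>lborel)"
proof -
  define W where "W z = (1 + w * norm z) ^ N" for z :: "real^'n"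
  have W: "0 < W z" for z using w by (auto simp: W_def add_pos_nonneg)
  have [measurable]: "W \<in> borel_measurable borel" unfolding W_def by measurable
  have W2: "(W z)\<^sup>2 = (1 + w * norm z) ^ (2 * N)" for z by (simp add: W_def power_mult[symmetric] mult.commute)
  have "(\<integral>\<^sup>+x\<in>S. ennreal (norm (F (x - y))) \<partial>lborel)\<^sup>2 = (\<integral>\<^sup>+x. ennreal (norm (F (x - y)) * W (x - y)) * (ennreal (1 / W (x - y)) * indicator S x) \<partial>lborel)\<^sup>2"
  proof (intro arg_cong[where f="\<lambda>t. t\<^sup>2"] nn_integral_cong)
    fix x
    have "ennreal (norm (F (x - y)) * W (x - y)) * ennreal (1 / W (x - y)) = ennreal (norm (F (x - y)) * W (x - y) * (1 / W (x - y)))"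
      using W[of "x - y"] by (subst ennreal_mult) (auto simp: less_imp_le)
    then show "ennreal (norm (F (x - y))) * indicator S x = ennreal (norm (F (x - y)) * W (x - y)) * (ennreal (1 / W (x - y)) * indicator S x)"
      using W[of "x - y"] by (simp flip: mult.assoc)
  qed
  also have "\<dots> \<le> (\<integral>\<^sup>+x. (ennreal (norm (F (x - y)) * W (x - y)))\<^sup>2 \<partial>lborel) * (\<integral>\<^sup>+x. (ennreal (1 / W (x - y)) * indicator S x)\<^sup>2 \<partial>lborel)"
    by (rule Cauchy_Schwarz_nn_integral) measurable
  also have "(\<integral>\<^sup>+x. (ennreal (norm (F (x - y)) * W (x - y)))\<^sup>2 \<partial>lborel) = (\<integral>\<^sup>+x. ennreal ((norm (F (x - y)))\<^sup>2 * (1 + w * norm (x - y)) ^ (2 * N)) \<partial>lborel)"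
    using W by (intro nn_integral_cong) (simp add: ennreal_power less_imp_le power_mult_distrib W2)
  also have "\<dots> = (\<integral>\<^sup>+z. ennreal ((norm (F z))\<^sup>2 * (1 + w * norm z) ^ (2 * N)) \<partial>lborel)"
    by (subst nn_integral_lborel_affine[of _ 1 "- y"]) auto
  also have "(\<integral>\<^sup>+x. (ennreal (1 / W (x - y)) * indicator S x)\<^sup>2 \<partial>lborel) = (\<integral>\<^sup>+x\<in>S. ennreal (1 / (1 + w * norm (x - y)) ^ (2 * N)) \<partial>lborel)"
    using W by (intro nn_integral_cong) (auto simp: ennreal_power less_imp_le power_divide W2 indicator_def)
  finally show ?thesis .
qed

lemma one_plus_inverse_power_le_japanese:
  fixes z :: "real^'n::finite"
  assumes "0 < w"
  shows "1 / (1 + w * norm z) ^ (2 * n) \<le> japanese (z /\<^sub>R inverse w) powr (- 2 * real n)"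
proof -
  have J: "japanese (z /\<^sub>R inverse w) = sqrt (1 + (w * norm z)\<^sup>2)" using assms by (simp add: japanese_def)
  have "japanese (z /\<^sub>R inverse w) \<le> 1 + w * norm z"
    unfolding J using assms by (intro real_le_lsqrt) (auto simp: power2_sum add_increasing2)
  then have "(japanese (z /\<^sub>R inverse w)) ^ (2 * n) \<le> (1 + w * norm z) ^ (2 * n)"
    using japanese_pos[of "z /\<^sub>R inverse w"] by (intro power_mono) auto
  then have "1 / (1 + w * norm z) ^ (2 * n) \<le> 1 / (japanese (z /\<^sub>R inverse w)) ^ (2 * n)"
    using japanese_pos[of "z /\<^sub>R inverse w"] assms by (intro divide_left_mono mult_pos_pos zero_less_power) (auto simp: add_pos_nonneg)
  also have "\<dots> = japanese (z /\<^sub>R inverse w) powr (- 2 * real n)"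
    using japanese_pos[of "z /\<^sub>R inverse w"] powr_realpow[of "japanese (z /\<^sub>R inverse w)" "2 * n"]
    by (simp add: powr_minus divide_inverse)
  finally show ?thesis .
qed

lemma nn_integral_inverse_weight:
  fixes y :: "real^'n::finite"
  assumes w: "0 < w" and N: "CARD('n) \<le> N"
  shows "(\<integral>\<^sup>+x. ennreal (1 / (1 + w * norm (x - y)) ^ (2 * N)) \<partial>lborel) \<le> ennreal (inverse w ^ CARD('n) * decay_mass TYPE('n))"
proof -
  have "(\<integral>\<^sup>+x. ennreal (1 / (1 + w * norm (x - y)) ^ (2 * N)) \<partial>lborel) = (\<integral>\<^sup>+x. ennreal (1 / (1 + w * norm (x :: real^'n)) ^ (2 * N)) \<partial>lborel)"
    by (subst (2) nn_integral_lborel_affine[of _ 1 "- y"]) auto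
  also have "\<dots> \<le> (\<integral>\<^sup>+x. ennreal (japanese (x /\<^sub>R inverse w) powr (- 2 * real CARD('n))) \<partial>(lborel :: (real^'n) measure))"
  proof (intro nn_integral_mono ennreal_leI)
    fix x :: "real^'n"
    have "1 / (1 + w * norm x) ^ (2 * N) \<le> 1 / (1 + w * norm x) ^ (2 * CARD('n))"
      using w N by (intro divide_left_mono power_increasing mult_pos_pos zero_less_power) (auto simp: add_pos_nonneg)
    also have "\<dots> \<le> japanese (x /\<^sub>R inverse w) powr (- 2 * real CARD('n))"
      by (rule one_plus_inverse_power_le_japanese[OF w])
    finally show "1 / (1 + w * norm x) ^ (2 * N) \<le> japanese (x /\<^sub>R inverse w) powr (- 2 * real CARD('n))" .
  qed
  also have "\<dots> = ennreal (inverse w ^ CARD('n) * decay_mass TYPE('n))"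
    by (rule nn_integral_decay) (use w in simp)
  finally show ?thesis .
qed

lemma cube_norm_diff:
  fixes x :: "real^'n::finite"
  assumes "x \<in> cbox p (p + (\<chi> i. l))" "y \<in> cbox p (p + (\<chi> i. l))"
  shows "norm (x - y) \<le> real CARD('n) * l"
proof -
  have "\<bar>(x - y) $ i\<bar> \<le> l" for i
    using assms by (auto simp: mem_box_cart abs_le_iff dest!: spec[of _ i])
  then have "(\<Sum>i\<in>UNIV. \<bar>(x - y) $ i\<bar>) \<le> real CARD('n) * l"
    using sum_bounded_above[of UNIV "\<lambda>i. \<bar>(x - y) $ i\<bar>" l] by simp
  then show ?thesis using norm_le_l1_cart[of "x - y"] by linarith
qed

text \<open>Moves the base point of a tail weight from a variable x to the fixed x0, and its scale
  from 1/w to the coarser s, at the price of a factor 1 + c.\<close>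

lemma one_plus_shift_le:
  fixes y :: "'a::real_normed_vector"
  assumes w: "0 < w" and s: "1 / w \<le> s" and c: "norm (x - x0) \<le> c * s" "0 \<le> c"
  shows "1 + norm (y - x0) / s \<le> (1 + c) * (1 + w * norm (x - y))"
proof -
  have s0: "0 < s" using w s by (meson less_le_trans zero_less_divide_1_iff)
  have "norm (y - x0) \<le> norm (x - y) + norm (x - x0)"
    using norm_triangle_ineq4[of "x - x0" "x - y"] by simp
  then have "norm (y - x0) / s \<le> (norm (x - y) + c * s) / s"
    using c s0 by (intro divide_right_mono) auto
  also have "\<dots> = norm (x - y) / s + c" using s0 by (simp add: add_divide_distrib)
  also have "norm (x - y) / s \<le> w * norm (x - y)"
  proof -
    have "1 / s \<le> w" using w s s0 by (simp add: field_simps)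
    then have "(1 / s) * norm (x - y) \<le> w * norm (x - y)" by (intro mult_right_mono) auto
    then show ?thesis by simp
  qed
  finally have "1 + norm (y - x0) / s \<le> (1 + w * norm (x - y)) + c * 1" by simp
  also have "\<dots> \<le> (1 + w * norm (x - y)) + c * (1 + w * norm (x - y))"
    using c w by (intro add_left_mono mult_left_mono) auto
  finally show ?thesis by (simp add: algebra_simps)
qed

text \<open>Of the 2(2n + 1) powers, 2(n + 1) are converted by \<open>one_plus_shift_le\<close> into
  the square of the tail weight around x0. The other 2n are integrated, either over the cube with
  integrand at most 1, which gives its volume, or over the whole space, which gives w^(-n); the
  smaller value is kept.\<close>

lemma nn_integral_inverse_weight_cube:
  fixes y :: "real^'n::finite"
  assumes w: "0 < w" and l: "0 < l" and x0: "x0 \<in> cbox p (p + (\<chi> i. l))"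
    and s: "l \<le> s" "1 / w \<le> s"
  shows "(\<integral>\<^sup>+x\<in>cbox p (p + (\<chi> i. l)). ennreal (1 / (1 + w * norm (x - y)) ^ (2 * (2 * CARD('n) + 1))) \<partial>lborel)
    \<le> ennreal ((1 + real CARD('n)) ^ (2 * (CARD('n) + 1)) * (1 + decay_mass TYPE('n)) * min (l ^ CARD('n)) (inverse w ^ CARD('n)) * (1 / (1 + norm (y - x0) / s) ^ (CARD('n) + 1))\<^sup>2)"
proof -
  let ?n = "CARD('n)" and ?Q = "cbox p (p + (\<chi> i. l))" and ?D = "decay_mass TYPE('n)"
  define t where "t = 1 + norm (y - x0) / s"
  have s0: "0 < s" using l s by simp
  have t: "0 < t" using s0 by (simp add: t_def add_pos_nonneg)
  define K where "K = (1 + real ?n) ^ (2 * (?n + 1)) * (1 / t ^ (?n + 1))\<^sup>2"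
  have K0: "0 \<le> K" by (simp add: K_def)
  have pt: "1 / (1 + w * norm (x - y)) ^ (2 * (2 * ?n + 1)) \<le> K * (1 / (1 + w * norm (x - y)) ^ (2 * ?n))" if x: "x \<in> ?Q" for x
  proof -
    define v where "v = 1 + w * norm (x - y)"
    have v: "0 < v" using w by (simp add: v_def add_pos_nonneg)
    have "norm (x - x0) \<le> real ?n * l" by (rule cube_norm_diff[OF x x0])
    also have "\<dots> \<le> real ?n * s" using s by (intro mult_left_mono) auto
    finally have "t \<le> (1 + real ?n) * v"
      unfolding t_def v_def by (intro one_plus_shift_le w s) auto
    then have "t ^ (2 * (?n + 1)) \<le> ((1 + real ?n) * v) ^ (2 * (?n + 1))" using t by (intro power_mono) auto
    then have "1 / v ^ (2 * (?n + 1)) \<le> (1 + real ?n) ^ (2 * (?n + 1)) * (1 / t ^ (2 * (?n + 1)))"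
    proof -
      have "1 / c1 \<le> c2 * (1 / c3)" if "c3 \<le> c2 * c1" "0 < c1" "0 < c3" for c1 c2 c3 :: real
        using that by (simp add: field_simps)
      then show ?thesis
        using \<open>t ^ _ \<le> _\<close> t v unfolding power_mult_distrib by (meson zero_less_power)
    qed
    also have "\<dots> = K" unfolding K_def by (simp only: power_divide power_one power_mult[symmetric] mult.commute)
    finally have "1 / v ^ (2 * (?n + 1)) * (1 / v ^ (2 * ?n)) \<le> K * (1 / v ^ (2 * ?n))"
      using v by (intro mult_right_mono) auto
    moreover have "1 / v ^ (2 * (?n + 1)) * (1 / v ^ (2 * ?n)) = 1 / v ^ (2 * (2 * ?n + 1))"
    proof -
      have "2 * (?n + 1) + 2 * ?n = 2 * (2 * ?n + 1)" by simp
      then show ?thesis by (simp only: times_divide_times_eq mult_1 power_add[symmetric])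
    qed
    ultimately show ?thesis by (simp only: v_def)
  qed
  have [measurable]: "?Q \<in> sets borel" by simp
  have I: "(\<integral>\<^sup>+x\<in>?Q. ennreal (1 / (1 + w * norm (x - y)) ^ (2 * ?n)) \<partial>lborel) \<le> ennreal ((1 + ?D) * min (l ^ ?n) (inverse w ^ ?n))"
  proof (cases "l ^ ?n \<le> inverse w ^ ?n")
    case True
    have "(\<integral>\<^sup>+x\<in>?Q. ennreal (1 / (1 + w * norm (x - y)) ^ (2 * ?n)) \<partial>lborel) \<le> (\<integral>\<^sup>+x\<in>?Q. 1 \<partial>lborel)"
    proof (intro nn_integral_mono mult_right_mono)
      fix x
      have "1 \<le> (1 + w * norm (x - y)) ^ (2 * ?n)" using w by (intro one_le_power) simp
      then have "1 / (1 + w * norm (x - y)) ^ (2 * ?n) \<le> 1" by simp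
      from ennreal_leI[OF this] show "ennreal (1 / (1 + w * norm (x - y)) ^ (2 * ?n)) \<le> 1" by simp
    qed simp
    also have "\<dots> = ennreal (1 * l ^ ?n)" using emeasure_cube[of l p] l by simp
    also have "\<dots> \<le> ennreal ((1 + ?D) * l ^ ?n)" using l by (intro ennreal_leI mult_right_mono) auto
    finally show ?thesis using True by (simp add: min_def)
  next
    case False
    have "(\<integral>\<^sup>+x\<in>?Q. ennreal (1 / (1 + w * norm (x - y)) ^ (2 * ?n)) \<partial>lborel) \<le> (\<integral>\<^sup>+x. ennreal (1 / (1 + w * norm (x - y)) ^ (2 * ?n)) \<partial>lborel)"
      by (intro nn_integral_mono) (auto simp: indicator_def)
    also have "\<dots> \<le> ennreal (inverse w ^ ?n * ?D)" by (rule nn_integral_inverse_weight[OF w order_refl])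
    also have "\<dots> \<le> ennreal ((1 + ?D) * inverse w ^ ?n)" using w by (intro ennreal_leI) (simp add: algebra_simps)
    finally show ?thesis using False by (simp add: min_def)
  qed
  have "(\<integral>\<^sup>+x\<in>?Q. ennreal (1 / (1 + w * norm (x - y)) ^ (2 * (2 * ?n + 1))) \<partial>lborel)
     \<le> (\<integral>\<^sup>+x. ennreal K * (ennreal (1 / (1 + w * norm (x - y)) ^ (2 * ?n)) * indicator ?Q x) \<partial>lborel)"
    using pt w K0 by (intro nn_integral_mono) (auto simp: indicator_def ennreal_leI simp flip: ennreal_mult' del: power_Suc)
  also have "\<dots> = ennreal K * (\<integral>\<^sup>+x\<in>?Q. ennreal (1 / (1 + w * norm (x - y)) ^ (2 * ?n)) \<partial>lborel)"
    by (rule nn_integral_cmult) measurable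
  also have "\<dots> \<le> ennreal K * ennreal ((1 + ?D) * min (l ^ ?n) (inverse w ^ ?n))"
    by (rule mult_left_mono[OF I]) simp
  also have "\<dots> = ennreal (K * ((1 + ?D) * min (l ^ ?n) (inverse w ^ ?n)))"
    using K0 by (rule ennreal_mult'[symmetric])
  also have "K * ((1 + ?D) * min (l ^ ?n) (inverse w ^ ?n)) = (1 + real ?n) ^ (2 * (?n + 1)) * (1 + ?D) * min (l ^ ?n) (inverse w ^ ?n) * (1 / t ^ (?n + 1))\<^sup>2"
    by (simp only: K_def mult_ac)
  finally show ?thesis by (simp only: t_def)
qed

section \<open>The kernel of one frozen symbol: mass on cubes, total mass and increments\<close>

lemma onorm_scaleR_le:
  fixes d :: "'a::real_normed_vector"
  assumes "norm d \<le> B"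
  shows "onorm (\<lambda>r. r *\<^sub>R d) \<le> B"
  using assms by (intro onorm_le) (auto simp: mult.commute[of B] intro: mult_left_mono)

lemma ennreal_le_of_sq_le:
  assumes "X\<^sup>2 \<le> ennreal (Y\<^sup>2)" "0 \<le> Y"
  shows "X \<le> ennreal Y"
proof (cases X)
  case (real x)
  then have "ennreal (x\<^sup>2) \<le> ennreal (Y\<^sup>2)" using assms by (simp add: ennreal_power)
  then have "x\<^sup>2 \<le> Y\<^sup>2" by (simp add: ennreal_le_iff)
  then have "x \<le> Y" using assms(2) by (rule power2_le_imp_le)
  then show ?thesis using real by (simp add: ennreal_leI)
next
  case top
  then show ?thesis using assms by (simp add: top_unique)
qed

text \<open>The parameters on which constants may depend. The symbol itself is not among them, since
  the bounds must later hold uniformly over all sections \<open>a y\<close>.\<close>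

locale scale_params =
  fixes dim_ty :: "'n::finite itself" and \<rho> A :: real
  assumes \<rho>: "0 < \<rho>" "\<rho> < 1"
begin

definition "m = - real CARD('n) * (1 - \<rho>)"
text \<open>The inverse weight needs n powers to be square integrable and n + 1 more to be paired
  with the maximal function, see \<open>nn_integral_inverse_weight_cube\<close>. The same number is
  the exponent of the low-pass factors; \<open>M_le\<close> checks that it is large enough.\<close>

definition "num_derivs = 2 * CARD('n) + 1"
definition dyadic_ker :: "nat \<Rightarrow> (real^'n \<Rightarrow> complex) \<Rightarrow> real^'n \<Rightarrow> complex" where
  "dyadic_ker j b = FT (\<lambda>\<xi>. b \<xi> * dyadic_cut num_derivs j \<xi>)"
definition good :: "(real^'n \<Rightarrow> complex) \<Rightarrow> bool" where
  "good b \<longleftrightarrow> (\<forall>i. symb \<rho> i num_derivs A m b)"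
text \<open>The second term is the gain on a cube of side at most the kernel width
  \<open>ker_scale j\<close>, the first one the gain on a larger cube. Adding them ends the case
  distinction.\<close>

definition cube_gain :: "nat \<Rightarrow> real \<Rightarrow> real" where
  "cube_gain j l = (2 ^ j) powr (- real CARD('n) * (1 - \<rho>) / 2) + (2 ^ j * l) powr (- real CARD('n) / 2)"
definition ker_scale :: "nat \<Rightarrow> real" where "ker_scale j = (2 ^ j) powr (- \<rho>)"

lemma m_eq:
  "2 * real CARD('n) + - real CARD('n) = real CARD('n)"
  "\<rho> * (2 * real CARD('n)) + - real CARD('n) = 2 * m + real CARD('n)"
  "2 * m + real CARD('n) + - \<rho> * real CARD('n) = - real CARD('n) * (1 - \<rho>)"
  by (simp_all add: m_def algebra_simps)

text \<open>The order m + 1 belongs to the gradient of the kernel, whose symbol carries an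
  additional coordinate.\<close>

lemma M_le:
  "- m \<le> 2 * real num_derivs" "\<rho> * real num_derivs - m \<le> 2 * real num_derivs"
  "- (m + 1) \<le> 2 * real num_derivs" "\<rho> * real num_derivs - (m + 1) \<le> 2 * real num_derivs"
proof -
  have "- m \<le> real CARD('n)" using \<rho> by (simp add: m_def algebra_simps)
  moreover have "\<rho> * real num_derivs \<le> 1 * real num_derivs" using \<rho> by (intro mult_right_mono) auto
  moreover have "real CARD('n) + 1 \<le> real num_derivs" by (simp add: num_derivs_def)
  ultimately show "- m \<le> 2 * real num_derivs" "\<rho> * real num_derivs - m \<le> 2 * real num_derivs"
    "- (m + 1) \<le> 2 * real num_derivs" "\<rho> * real num_derivs - (m + 1) \<le> 2 * real num_derivs" by linarith+
qed

lemma ker_scale_pos: "0 < ker_scale j" by (simp add: ker_scale_def)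
lemma ker_scale_inverse: "ker_scale j = inverse ((2 ^ j) powr \<rho>)" by (simp add: ker_scale_def powr_minus)

lemma good_integrable: "good b \<Longrightarrow> integrable lborel (\<lambda>\<xi>. b \<xi> * dyadic_cut num_derivs j \<xi>)"
  using piece_FT_power(1)[of \<rho> 0 num_derivs m num_derivs _ A b j] \<rho> M_le by (auto simp: good_def)

lemma dyadic_ker_measurable: "good b \<Longrightarrow> dyadic_ker j b \<in> borel_measurable borel"
  unfolding dyadic_ker_def by (intro FT_measurable) (use good_integrable in auto)

text \<open>The factor (l / s)^n, with s the maximum of l and the kernel width, is shaped for what
  follows: pairing the tail weight with f produces s^n Mf, so that l^n remains, the volume of the
  cube.\<close>

lemma dyadic_ker_cube:
  "\<exists>C\<ge>0. \<forall>j b p l x0 y. good b \<longrightarrow> 0 < l \<longrightarrow> x0 \<in> cbox p (p + (\<chi> i. l)) \<longrightarrow>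
    (\<integral>\<^sup>+x\<in>cbox p (p + (\<chi> i. l)). ennreal (norm (dyadic_ker j b (x - y))) \<partial>lborel)
     \<le> ennreal (C * ((l / max l (ker_scale j)) ^ CARD('n) * cube_gain j l * (1 / (1 + norm (y - x0) / max l (ker_scale j)) ^ (CARD('n) + 1))))"
proof -
  let ?n = "CARD('n)"
  obtain C1 where C1: "0 \<le> C1" "\<And>j (b :: real^'n \<Rightarrow> complex). (\<forall>i. symb \<rho> i num_derivs A m b) \<Longrightarrow>
     (\<integral>\<^sup>+z. ennreal ((norm (FT (\<lambda>\<xi>. b \<xi> * dyadic_cut num_derivs j \<xi>) z))\<^sup>2 * (1 + (2 ^ j) powr \<rho> * norm z) ^ (2 * num_derivs)) \<partial>lborel)
       \<le> ennreal (C1 * (2 ^ j) powr (2 * m + real ?n))"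
    using kernel_L2[OF _ _ M_le(1,2), where 'n='n and A=A] \<rho> by force
  define K where "K = (1 + real ?n) ^ (2 * (?n + 1)) * (1 + decay_mass TYPE('n))"
  have K: "0 \<le> K" by (simp add: K_def)
  show ?thesis
  proof (intro exI conjI allI impI)
    show "0 \<le> sqrt (C1 * K)" using C1 K by simp
    fix j and b :: "real^'n \<Rightarrow> complex" and p x0 y :: "real^'n" and l :: real
    assume b: "good b" and l: "0 < l" and x0: "x0 \<in> cbox p (p + (\<chi> i. l))"
    let ?Q = "cbox p (p + (\<chi> i. l))"
    define w where "w = (2 ^ j :: real) powr \<rho>"
    define s where "s = max l (ker_scale j)"
    define u where "u = 1 / (1 + norm (y - x0) / s) ^ (?n + 1)"
    have w: "0 < w" by (simp add: w_def)
    have iw: "inverse w = ker_scale j" by (simp add: w_def ker_scale_inverse)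
    have s: "l \<le> s" "1 / w \<le> s" "0 < s" using iw l by (auto simp: s_def divide_inverse)
    have u: "0 \<le> u" using s by (simp add: u_def)
    have [measurable]: "dyadic_ker j b \<in> borel_measurable borel" by (rule dyadic_ker_measurable[OF b])
    have cube_gain: "0 \<le> cube_gain j l" by (simp add: cube_gain_def)
    \<comment> \<open>After Cauchy--Schwarz only a comparison of exponents is left. If the cube is
      below the kernel width, l^n is taken from the minimum and s is \<lambda>^(-\<rho>); otherwise
      \<lambda>^(-n\<rho>) is taken and s is l.\<close>
    have sc: "(2 ^ j) powr (2 * m + real ?n) * min (l ^ ?n) (inverse w ^ ?n) \<le> ((l / s) ^ ?n * cube_gain j l)\<^sup>2"
    proof (cases "l \<le> ker_scale j")
      case True
      then have sd: "s = inverse w" by (simp add: s_def iw)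
      have "(2 ^ j) powr (2 * m + real ?n) * min (l ^ ?n) (inverse w ^ ?n) \<le> (2 ^ j) powr (2 * m + real ?n) * l ^ ?n"
        by (intro mult_left_mono) auto
      also have "\<dots> = ((l / s) ^ ?n * (2 ^ j * l) powr (- real ?n / 2))\<^sup>2"
      proof -
        have "((l / s) ^ ?n * (2 ^ j * l) powr (- real ?n / 2))\<^sup>2 = ((l * w) ^ ?n)\<^sup>2 * ((2 ^ j * l) powr (- real ?n / 2))\<^sup>2"
        proof -
          have "l / s = l * w" by (simp add: sd divide_inverse)
          then show ?thesis by (simp only: power_mult_distrib[of "_ ^ ?n"])
        qed
        also have "((2 ^ j * l) powr (- real ?n / 2))\<^sup>2 = (2 ^ j * l) powr (- real ?n)"
          using l powr_real_power[of "2 ^ j * l" "- real ?n / 2" 2] by simp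
        also have "((l * w) ^ ?n)\<^sup>2 = (l * w) powr (2 * real ?n)"
        proof -
          have "((l * w) ^ ?n)\<^sup>2 = (l * w) ^ (2 * ?n)" by (simp only: power_mult[symmetric] mult.commute)
          also have "\<dots> = (l * w) powr real (2 * ?n)" by (rule powr_realpow[symmetric]) (use l w in simp)
          finally show ?thesis by simp
        qed
        also have "(l * w) powr (2 * real ?n) * (2 ^ j * l) powr (- real ?n) = (l powr (2 * real ?n) * l powr (- real ?n)) * ((2 ^ j) powr (\<rho> * (2 * real ?n)) * (2 ^ j) powr (- real ?n))"
          using l by (simp add: powr_mult w_def powr_powr mult_ac)
        also have "\<dots> = l powr (real ?n) * (2 ^ j) powr (2 * m + real ?n)"
          by (simp only: powr_add[symmetric] m_eq)
        finally show ?thesis using l by (simp add: powr_realpow mult.commute)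
      qed
      also have "\<dots> \<le> ((l / s) ^ ?n * cube_gain j l)\<^sup>2"
        using l s by (intro power_mono mult_left_mono) (auto simp: cube_gain_def)
      finally show ?thesis .
    next
      case False
      then have sd: "s = l" by (simp add: s_def)
      have "(2 ^ j) powr (2 * m + real ?n) * min (l ^ ?n) (inverse w ^ ?n) \<le> (2 ^ j) powr (2 * m + real ?n) * inverse w ^ ?n"
        by (intro mult_left_mono) auto
      also have "(2 ^ j) powr (2 * m + real ?n) * inverse w ^ ?n = (2 ^ j :: real) powr (- real CARD('n) * (1 - \<rho>))"
      proof -
        have "inverse w ^ ?n = (2 ^ j) powr (- \<rho> * real ?n)"
          unfolding iw ker_scale_def by (rule powr_real_power) simp
        then show ?thesis by (simp only: powr_add[symmetric] m_eq)
      qed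
      also have "\<dots> = ((2 ^ j) powr (- real CARD('n) * (1 - \<rho>) / 2))\<^sup>2"
        by (subst powr_real_power) auto
      also have "\<dots> \<le> ((l / s) ^ ?n * cube_gain j l)\<^sup>2"
        using l by (intro power_mono) (auto simp: cube_gain_def sd)
      finally show ?thesis .
    qed
    have "(\<integral>\<^sup>+x\<in>?Q. ennreal (norm (dyadic_ker j b (x - y))) \<partial>lborel)\<^sup>2
      \<le> (\<integral>\<^sup>+z. ennreal ((norm (dyadic_ker j b z))\<^sup>2 * (1 + w * norm z) ^ (2 * num_derivs)) \<partial>lborel) * (\<integral>\<^sup>+x\<in>?Q. ennreal (1 / (1 + w * norm (x - y)) ^ (2 * num_derivs)) \<partial>lborel)"
      by (rule kernel_CS) (use w in auto)
    also have "\<dots> \<le> ennreal (C1 * (2 ^ j) powr (2 * m + real ?n)) * ennreal (K * min (l ^ ?n) (inverse w ^ ?n) * u\<^sup>2)"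
    proof (rule mult_mono)
      show "(\<integral>\<^sup>+z. ennreal ((norm (dyadic_ker j b z))\<^sup>2 * (1 + w * norm z) ^ (2 * num_derivs)) \<partial>lborel) \<le> ennreal (C1 * (2 ^ j) powr (2 * m + real ?n))"
        unfolding dyadic_ker_def w_def using C1(2) b by (simp add: good_def)
      show "(\<integral>\<^sup>+x\<in>?Q. ennreal (1 / (1 + w * norm (x - y)) ^ (2 * num_derivs)) \<partial>lborel) \<le> ennreal (K * min (l ^ ?n) (inverse w ^ ?n) * u\<^sup>2)"
        unfolding num_derivs_def K_def u_def by (rule nn_integral_inverse_weight_cube[OF w l x0 s(1,2)])
    qed auto
    also have "\<dots> = ennreal (C1 * (2 ^ j) powr (2 * m + real ?n) * (K * min (l ^ ?n) (inverse w ^ ?n) * u\<^sup>2))"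
      using C1 by (subst ennreal_mult') auto
    also have "C1 * (2 ^ j) powr (2 * m + real ?n) * (K * min (l ^ ?n) (inverse w ^ ?n) * u\<^sup>2) = (C1 * K * u\<^sup>2) * ((2 ^ j) powr (2 * m + real ?n) * min (l ^ ?n) (inverse w ^ ?n))"
      by (simp only: mult_ac)
    also have "ennreal \<dots> \<le> ennreal ((C1 * K * u\<^sup>2) * ((l / s) ^ ?n * cube_gain j l)\<^sup>2)"
      using C1 K by (intro ennreal_leI mult_left_mono sc) auto
    also have "(C1 * K * u\<^sup>2) * ((l / s) ^ ?n * cube_gain j l)\<^sup>2 = (sqrt (C1 * K) * ((l / s) ^ ?n * cube_gain j l * u))\<^sup>2"
      using C1 K by (simp add: power_mult_distrib)
    finally have "(\<integral>\<^sup>+x\<in>?Q. ennreal (norm (dyadic_ker j b (x - y))) \<partial>lborel) \<le> ennreal (sqrt (C1 * K) * ((l / s) ^ ?n * cube_gain j l * u))"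
      by (rule ennreal_le_of_sq_le) (use C1 K u cube_gain l s in simp)
    then show "(\<integral>\<^sup>+x\<in>?Q. ennreal (norm (dyadic_ker j b (x - y))) \<partial>lborel)
     \<le> ennreal (sqrt (C1 * K) * ((l / max l (ker_scale j)) ^ ?n * cube_gain j l * (1 / (1 + norm (y - x0) / max l (ker_scale j)) ^ (?n + 1))))"
      by (simp only: u_def s_def)
  qed
qed

text \<open>Cauchy--Schwarz on the whole space: \<lambda>^(2m + n) times the mass
  \<lambda>^(-n\<rho>) of the inverse weight is \<lambda>^(-n(1 - \<rho>)), whose root decays
  geometrically in j.\<close>

lemma dyadic_ker_L1:
  "\<exists>C\<ge>0. \<forall>j b y. good b \<longrightarrow>
    (\<integral>\<^sup>+x. ennreal (norm (dyadic_ker j b (x - y))) \<partial>lborel) \<le> ennreal (C * (2 ^ j) powr (- real CARD('n) * (1 - \<rho>) / 2))"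
proof -
  let ?n = "CARD('n)"
  obtain C1 where C1: "0 \<le> C1" "\<And>j (b :: real^'n \<Rightarrow> complex). (\<forall>i. symb \<rho> i num_derivs A m b) \<Longrightarrow>
     (\<integral>\<^sup>+z. ennreal ((norm (FT (\<lambda>\<xi>. b \<xi> * dyadic_cut num_derivs j \<xi>) z))\<^sup>2 * (1 + (2 ^ j) powr \<rho> * norm z) ^ (2 * num_derivs)) \<partial>lborel)
       \<le> ennreal (C1 * (2 ^ j) powr (2 * m + real ?n))"
    using kernel_L2[OF _ _ M_le(1,2), where 'n='n and A=A] \<rho> by force
  let ?D = "decay_mass TYPE('n)"
  show ?thesis
  proof (intro exI conjI allI impI)
    show "0 \<le> sqrt (C1 * ?D)" using C1 by simp
    fix j and b :: "real^'n \<Rightarrow> complex" and y :: "real^'n" assume b: "good b"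
    define w where "w = (2 ^ j :: real) powr \<rho>"
    have w: "0 < w" by (simp add: w_def)
    have iw: "inverse w = ker_scale j" by (simp add: w_def ker_scale_inverse)
    have [measurable]: "dyadic_ker j b \<in> borel_measurable borel" by (rule dyadic_ker_measurable[OF b])
    have "(\<integral>\<^sup>+x\<in>UNIV. ennreal (norm (dyadic_ker j b (x - y))) \<partial>lborel)\<^sup>2
      \<le> (\<integral>\<^sup>+z. ennreal ((norm (dyadic_ker j b z))\<^sup>2 * (1 + w * norm z) ^ (2 * num_derivs)) \<partial>lborel) * (\<integral>\<^sup>+x\<in>UNIV. ennreal (1 / (1 + w * norm (x - y)) ^ (2 * num_derivs)) \<partial>lborel)"
      by (rule kernel_CS) (use w in auto)
    also have "\<dots> \<le> ennreal (C1 * (2 ^ j) powr (2 * m + real ?n)) * ennreal (inverse w ^ ?n * ?D)"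
    proof (rule mult_mono)
      show "(\<integral>\<^sup>+z. ennreal ((norm (dyadic_ker j b z))\<^sup>2 * (1 + w * norm z) ^ (2 * num_derivs)) \<partial>lborel) \<le> ennreal (C1 * (2 ^ j) powr (2 * m + real ?n))"
        unfolding dyadic_ker_def w_def using C1(2) b by (simp add: good_def)
      show "(\<integral>\<^sup>+x\<in>UNIV. ennreal (1 / (1 + w * norm (x - y)) ^ (2 * num_derivs)) \<partial>lborel) \<le> ennreal (inverse w ^ ?n * ?D)"
        using nn_integral_inverse_weight[OF w, of num_derivs y] by (simp add: num_derivs_def)
    qed auto
    also have "\<dots> = ennreal (C1 * (2 ^ j) powr (2 * m + real ?n) * (inverse w ^ ?n * ?D))"
      using C1 by (subst ennreal_mult') auto
    also have "inverse w ^ ?n = (2 ^ j) powr (- \<rho> * real ?n)"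
      unfolding iw ker_scale_def by (rule powr_real_power) simp
    also have "C1 * (2 ^ j) powr (2 * m + real ?n) * ((2 ^ j) powr (- \<rho> * real ?n) * ?D) = (C1 * ?D) * ((2 ^ j) powr (2 * m + real ?n) * (2 ^ j) powr (- \<rho> * real ?n))"
      by (simp only: mult_ac)
    also have "(2 ^ j) powr (2 * m + real ?n) * (2 ^ j) powr (- \<rho> * real ?n) = (2 ^ j :: real) powr (- real CARD('n) * (1 - \<rho>))"
      by (simp only: powr_add[symmetric] m_eq)
    also have "\<dots> = ((2 ^ j) powr (- real CARD('n) * (1 - \<rho>) / 2))\<^sup>2"
      by (subst powr_real_power) auto
    also have "(C1 * ?D) * ((2 ^ j) powr (- real CARD('n) * (1 - \<rho>) / 2))\<^sup>2 = (sqrt (C1 * ?D) * (2 ^ j) powr (- real CARD('n) * (1 - \<rho>) / 2))\<^sup>2"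
      using C1 by (simp add: power_mult_distrib)
    finally have "(\<integral>\<^sup>+x\<in>UNIV. ennreal (norm (dyadic_ker j b (x - y))) \<partial>lborel) \<le> ennreal (sqrt (C1 * ?D) * (2 ^ j) powr (- real CARD('n) * (1 - \<rho>) / 2))"
      by (rule ennreal_le_of_sq_le) (use C1 in simp)
    then show "(\<integral>\<^sup>+x. ennreal (norm (dyadic_ker j b (x - y))) \<partial>lborel) \<le> ennreal (sqrt (C1 * ?D) * (2 ^ j) powr (- real CARD('n) * (1 - \<rho>) / 2))"
      by simp
  qed
qed

end

text \<open>The derivative in direction v is expanded over the coordinates because, for a symbol
  times a cut, each \<xi>_k g is again of this kind and \<open>kernel_sup\<close> applies to
  it.\<close>

lemma FT_has_vector_derivative:
  fixes g :: "real^'n::finite \<Rightarrow> complex"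
  assumes g: "integrable lborel g" and g1: "integrable lborel (\<lambda>\<xi>. norm \<xi> * norm (g \<xi>))"
  shows "((\<lambda>t. FT g (z + t *\<^sub>R v)) has_vector_derivative (\<Sum>k\<in>UNIV. \<i> * complex_of_real (v $ k) * FT (\<lambda>\<xi>. complex_of_real (\<xi> $ k) * g \<xi>) (z + t *\<^sub>R v))) (at t)"
proof -
  have [measurable]: "g \<in> borel_measurable borel" using g by auto
  have ik: "integrable lborel (\<lambda>\<xi>. complex_of_real (\<xi> $ k) * g \<xi>)" for k
  proof (rule Bochner_Integration.integrable_bound[OF g1])
    show "AE x in lborel. norm (complex_of_real (x $ k) * g x) \<le> norm (norm x * norm (g x))"
      using component_le_norm_cart[of _ k] by (intro AE_I2) (auto simp: norm_mult intro!: mult_right_mono)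
  qed measurable
  have at0: "((\<lambda>t. FT g (z + t *\<^sub>R v)) has_vector_derivative (\<Sum>k\<in>UNIV. \<i> * complex_of_real (v $ k) * FT (\<lambda>\<xi>. complex_of_real (\<xi> $ k) * g \<xi>) z)) (at 0)" for z
  proof -
    define h where "h t \<xi> = exp (\<i> * complex_of_real ((z + t *\<^sub>R v) \<bullet> \<xi>)) * g \<xi>" for t \<xi>
    define h' where "h' t \<xi> = (\<i> * complex_of_real (v \<bullet> \<xi>)) * (exp (\<i> * complex_of_real ((z + t *\<^sub>R v) \<bullet> \<xi>)) * g \<xi>)" for t \<xi>
    have "((\<lambda>t. LINT \<xi>|lborel. h t \<xi>) has_vector_derivative (LINT \<xi>|lborel. h' 0 \<xi>)) (at 0)"
    proof (rule has_vector_derivative_integral[where w="\<lambda>\<xi>. norm v * (norm \<xi> * norm (g \<xi>))"])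
      fix t :: real and \<xi> :: "real^'n"
      have "((\<lambda>s. exp (of_real s * (\<i> * complex_of_real (v \<bullet> \<xi>)))) has_vector_derivative (\<i> * complex_of_real (v \<bullet> \<xi>)) * exp (of_real t * (\<i> * complex_of_real (v \<bullet> \<xi>)))) (at t)"
        using exp_scaleR_has_vector_derivative_right[of "\<i> * complex_of_real (v \<bullet> \<xi>)" t UNIV]
        by (simp add: scaleR_conv_of_real mult.commute)
      from has_vector_derivative_mult_left[OF this, of "exp (\<i> * complex_of_real (z \<bullet> \<xi>)) * g \<xi>"]
      show "((\<lambda>s. h s \<xi>) has_vector_derivative h' t \<xi>) (at t)"
        by (simp add: h_def h'_def inner_add_left distrib_left exp_add mult_ac)
      have "norm (h' t \<xi>) = \<bar>v \<bullet> \<xi>\<bar> * norm (g \<xi>)" by (simp add: h'_def norm_mult)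
      also have "\<dots> \<le> (norm v * norm \<xi>) * norm (g \<xi>)" by (intro mult_right_mono Cauchy_Schwarz_ineq2) auto
      finally show "norm (h' t \<xi>) \<le> norm v * (norm \<xi> * norm (g \<xi>))" by (simp add: mult.assoc)
    next
      show "integrable lborel (h t)" for t unfolding h_def[abs_def] by (rule FT_integrable[OF g])
      show "h' 0 \<in> borel_measurable lborel" unfolding h'_def by measurable
      show "integrable lborel (\<lambda>\<xi>. norm v * (norm \<xi> * norm (g \<xi>)))" using g1 by simp
    qed
    moreover have "(LINT \<xi>|lborel. h' 0 \<xi>) = (\<Sum>k\<in>UNIV. \<i> * complex_of_real (v $ k) * FT (\<lambda>\<xi>. complex_of_real (\<xi> $ k) * g \<xi>) z)"
    proof -
      have "(LINT \<xi>|lborel. h' 0 \<xi>) = (LINT \<xi>|lborel. (\<Sum>k\<in>UNIV. (\<i> * complex_of_real (v $ k)) * (exp (\<i> * complex_of_real (z \<bullet> \<xi>)) * (complex_of_real (\<xi> $ k) * g \<xi>))))"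
        by (intro Bochner_Integration.integral_cong refl)
           (simp add: h'_def inner_vec_real[of v] sum_distrib_left sum_distrib_right mult_ac)
      also have "\<dots> = (\<Sum>k\<in>UNIV. LINT \<xi>|lborel. (\<i> * complex_of_real (v $ k)) * (exp (\<i> * complex_of_real (z \<bullet> \<xi>)) * (complex_of_real (\<xi> $ k) * g \<xi>)))"
        by (intro Bochner_Integration.integral_sum integrable_mult_right FT_integrable ik)
      also have "\<dots> = (\<Sum>k\<in>UNIV. (\<i> * complex_of_real (v $ k)) * FT (\<lambda>\<xi>. complex_of_real (\<xi> $ k) * g \<xi>) z)"
        unfolding FT_def by (intro sum.cong refl integral_mult_right_zero)
      finally show ?thesis .
    qed
    ultimately show ?thesis by (simp add: FT_def h_def)
  qed
  show ?thesis
    by (rule has_vector_derivative_shift) (use at0[of "z + t *\<^sub>R v"] in \<open>simp add: algebra_simps\<close>)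
qed

text \<open>Mean value bound along the segment from x0 - y to x - y. A derivative multiplies the
  symbol by a coordinate, raising its order to m + 1, and m + 1 + n = 1 + \<rho> n. The segment
  stays within n kernel widths of its start, so the weight can be based at x0 throughout.\<close>

lemma (in scale_params) dyadic_ker_diff:
  "\<exists>C\<ge>0. \<forall>j b x x0 y. good b \<longrightarrow> norm (x - x0) \<le> real CARD('n) * ker_scale j \<longrightarrow>
    norm (dyadic_ker j b (x - y) - dyadic_ker j b (x0 - y)) \<le> C * ((2 ^ j) powr (1 + \<rho> * real CARD('n)) * norm (x - x0) * (1 / (1 + norm (y - x0) / ker_scale j) ^ (CARD('n) + 1)))"
proof -
  let ?n = "CARD('n)"
  define A1 where "A1 = 2 ^ num_derivs * 1 * A"
  obtain C1 where C1: "0 \<le> C1" "\<And>j (b :: real^'n \<Rightarrow> complex) z. (\<forall>i. symb \<rho> i num_derivs A1 (m + 1) b) \<Longrightarrow>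
     norm (FT (\<lambda>\<xi>. b \<xi> * dyadic_cut num_derivs j \<xi>) z) * (1 + (2 ^ j) powr \<rho> * norm z) ^ num_derivs \<le> C1 * (2 ^ j) powr (m + 1 + real ?n)"
    using kernel_sup[OF _ _ M_le(3,4), where 'n='n and A=A1] \<rho> by force
  define c where "c = 1 + real ?n"
  define C where "C = real ?n * C1 * c ^ (?n + 1)"
  show ?thesis
  proof (intro exI conjI allI impI)
    show C: "0 \<le> C" using C1 by (simp add: C_def c_def)
    fix j and b :: "real^'n \<Rightarrow> complex" and x x0 y :: "real^'n"
    assume b: "good b" and x: "norm (x - x0) \<le> real ?n * ker_scale j"
    define w where "w = (2 ^ j :: real) powr \<rho>"
    have w: "0 < w" by (simp add: w_def)
    have sw: "ker_scale j = 1 / w" by (simp add: w_def ker_scale_inverse divide_inverse)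
    define L where "L = (2 ^ j) powr (1 + \<rho> * real ?n)"
    define U where "U = (1 + norm (y - x0) / ker_scale j) ^ (?n + 1)"
    have U: "0 < U" using ker_scale_pos[of j] by (simp add: U_def add_pos_nonneg)
    let ?G = "\<lambda>\<xi>. b \<xi> * dyadic_cut num_derivs j \<xi>"
    let ?v = "x - x0"
    have gk: "norm (FT (\<lambda>\<xi>. complex_of_real (\<xi> $ k) * ?G \<xi>) (x0 - y + t *\<^sub>R ?v)) \<le> C1 * c ^ (?n + 1) * L / U" if t: "t \<in> {0..1}" for k t
    proof -
      let ?F = "norm (FT (\<lambda>\<xi>. complex_of_real (\<xi> $ k) * ?G \<xi>) (x0 - y + t *\<^sub>R ?v))"
      define xt where "xt = x0 + t *\<^sub>R ?v"
      define V where "V = 1 + w * norm (xt - y)"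
      have V: "1 \<le> V" using w by (simp add: V_def)
      have "\<forall>i. symb \<rho> i num_derivs A1 (m + 1) (\<lambda>\<xi>. complex_of_real (\<xi> $ k) * b \<xi>)"
      proof
        fix i
        have "symb \<rho> i num_derivs (2 ^ num_derivs * 1 * A) (1 + m) (\<lambda>\<xi>. complex_of_real (\<xi> $ k) * b \<xi>)"
          by (rule symb_mult[OF symb_coord]) (use \<rho> b in \<open>auto simp: good_def\<close>)
        then show "symb \<rho> i num_derivs A1 (m + 1) (\<lambda>\<xi>. complex_of_real (\<xi> $ k) * b \<xi>)"
          by (simp only: A1_def add.commute)
      qed
      from C1(2)[OF this, of j "xt - y"]
      have "?F * V ^ num_derivs \<le> C1 * (2 ^ j) powr (m + 1 + real ?n)"
        by (simp add: V_def w_def xt_def mult.assoc algebra_simps)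
      also have "(2 ^ j) powr (m + 1 + real ?n) = L" by (simp add: m_def L_def algebra_simps)
      finally have F: "?F * V ^ num_derivs \<le> C1 * L" .
      have "norm (xt - x0) \<le> real ?n * (1 / w)"
      proof -
        have "norm (xt - x0) = t * norm ?v" using t by (simp add: xt_def)
        also have "\<dots> \<le> 1 * norm ?v" using t by (intro mult_right_mono) auto
        finally show ?thesis using x sw by simp
      qed
      then have "1 + norm (y - x0) / (1 / w) \<le> (1 + real ?n) * V"
        unfolding V_def by (intro one_plus_shift_le w) auto
      then have "U \<le> (c * V) ^ (?n + 1)"
        unfolding U_def sw c_def using w by (intro power_mono) auto
      also have "\<dots> = c ^ (?n + 1) * V ^ (?n + 1)" by (rule power_mult_distrib)
      \<comment> \<open>The tail weight asks for n + 1 powers of V \<ge> 1, and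
        \<open>num_derivs\<close> of them are available.\<close>
      also have "\<dots> \<le> c ^ (?n + 1) * V ^ num_derivs"
        using V by (intro mult_left_mono power_increasing) (auto simp: num_derivs_def c_def)
      finally have "?F * U \<le> ?F * (c ^ (?n + 1) * V ^ num_derivs)" by (rule mult_left_mono) simp
      also have "\<dots> = c ^ (?n + 1) * (?F * V ^ num_derivs)" by (simp only: mult_ac)
      also have "\<dots> \<le> c ^ (?n + 1) * (C1 * L)" by (rule mult_left_mono[OF F]) (simp add: c_def)
      finally show ?thesis using U by (simp only: pos_le_divide_eq mult_ac)
    qed
    have G: "integrable lborel ?G" by (rule good_integrable[OF b])
    have G1: "integrable lborel (\<lambda>\<xi>. norm \<xi> * norm (?G \<xi>))"
    proof -
      have s: "symb \<rho> undefined num_derivs A m b" using b by (simp add: good_def)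
      \<comment> \<open>One order below -2n leaves room for the factor |\<xi>| of the
        gradient.\<close>
      let ?s = "- 2 * real ?n - 1 - m"
      obtain C2 where "symb \<rho> undefined num_derivs (C2 * (2 ^ j) powr (- ?s)) (m + ?s) ?G"
        using symb_mult_dyadic_cut[of \<rho> ?s num_derivs undefined num_derivs A m] M_le \<rho> s by force
      then have s2: "norm (?G \<xi>) \<le> (C2 * (2 ^ j) powr (- ?s)) * japanese \<xi> powr (- 2 * real ?n - 1)" for \<xi>
        by (auto dest!: symb_bound)
      show ?thesis
      proof (rule Bochner_Integration.integrable_bound)
        show "integrable lborel (\<lambda>\<xi>::real^'n. (C2 * (2 ^ j) powr (- ?s)) * japanese \<xi> powr (- 2 * real ?n))"
          by (intro integrable_mult_right integrable_japanese_powr)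
        show "(\<lambda>\<xi>. norm \<xi> * norm (?G \<xi>)) \<in> borel_measurable lborel" using G by auto
        show "AE \<xi> in lborel. norm (norm \<xi> * norm (?G \<xi>)) \<le> norm ((C2 * (2 ^ j) powr (- ?s)) * japanese \<xi> powr (- 2 * real ?n))"
        proof (rule AE_I2)
          fix \<xi> :: "real^'n"
          have "norm \<xi> * norm (?G \<xi>) \<le> japanese \<xi> * ((C2 * (2 ^ j) powr (- ?s)) * japanese \<xi> powr (- 2 * real ?n - 1))"
            by (intro mult_mono norm_le_japanese s2) (auto simp: japanese_pos less_imp_le)
          also have "\<dots> = (C2 * (2 ^ j) powr (- ?s)) * japanese \<xi> powr (- 2 * real ?n)"
            using japanese_pos[of \<xi>] by (simp add: powr_diff)
          finally show "norm (norm \<xi> * norm (?G \<xi>)) \<le> norm ((C2 * (2 ^ j) powr (- ?s)) * japanese \<xi> powr (- 2 * real ?n))" by simp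
        qed
      qed
    qed
    let ?d = "\<lambda>t. \<Sum>k\<in>UNIV. \<i> * complex_of_real (?v $ k) * FT (\<lambda>\<xi>. complex_of_real (\<xi> $ k) * ?G \<xi>) (x0 - y + t *\<^sub>R ?v)"
    have "norm (FT ?G (x0 - y + 1 *\<^sub>R ?v) - FT ?G (x0 - y + 0 *\<^sub>R ?v)) \<le> (C * L * norm ?v / U) * norm (1 - 0 :: real)"
    proof (rule differentiable_bound[where S="{0..1}" and f'="\<lambda>t r. r *\<^sub>R ?d t"])
      fix t :: real assume t: "t \<in> {0..1}"
      show "((\<lambda>t. FT ?G (x0 - y + t *\<^sub>R ?v)) has_derivative (\<lambda>r. r *\<^sub>R ?d t)) (at t within {0..1})"
        using FT_has_vector_derivative[OF G G1, of "x0 - y" ?v t] unfolding has_vector_derivative_def by (rule has_derivative_at_withinI)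
      have "norm (?d t) \<le> (\<Sum>k\<in>(UNIV::'n set). norm ?v * (C1 * c ^ (?n + 1) * L / U))"
      proof (rule sum_norm_le)
        fix k :: 'n
        have "norm (\<i> * complex_of_real (?v $ k) * FT (\<lambda>\<xi>. complex_of_real (\<xi> $ k) * ?G \<xi>) (x0 - y + t *\<^sub>R ?v))
           = \<bar>?v $ k\<bar> * norm (FT (\<lambda>\<xi>. complex_of_real (\<xi> $ k) * ?G \<xi>) (x0 - y + t *\<^sub>R ?v))" by (simp only: norm_mult norm_ii norm_of_real mult_1)
        also have "\<dots> \<le> norm ?v * (C1 * c ^ (?n + 1) * L / U)"
          by (rule mult_mono[OF component_le_norm_cart gk[OF t]]) auto
        finally show "norm (\<i> * complex_of_real (?v $ k) * FT (\<lambda>\<xi>. complex_of_real (\<xi> $ k) * ?G \<xi>) (x0 - y + t *\<^sub>R ?v)) \<le> norm ?v * (C1 * c ^ (?n + 1) * L / U)" .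
      qed
      also have "\<dots> = C * L * norm ?v / U" by (simp add: C_def)
      finally have "norm (?d t) \<le> C * L * norm ?v / U" .
      then show "onorm (\<lambda>r. r *\<^sub>R ?d t) \<le> C * L * norm ?v / U"
        by (rule onorm_scaleR_le)
    qed auto
    then show "norm (dyadic_ker j b (x - y) - dyadic_ker j b (x0 - y)) \<le> C * ((2 ^ j) powr (1 + \<rho> * real ?n) * norm (x - x0) * (1 / (1 + norm (y - x0) / ker_scale j) ^ (?n + 1)))"
      by (simp add: dyadic_ker_def L_def U_def)
  qed
qed

section \<open>Summing the dyadic pieces\<close>

lemma ennreal_norm_integral_le:
  fixes f :: "'a \<Rightarrow> complex"
  shows "ennreal (norm (LINT x|M. f x)) \<le> (\<integral>\<^sup>+x. ennreal (norm (f x)) \<partial>M)"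
proof (cases "integrable M f")
  case True then show ?thesis by (rule integral_norm_bound_ennreal)
qed (simp add: not_integrable_integral_eq)

lemma gauss_symbol_measurable [measurable]: "gauss_symbol l \<in> borel_measurable borel"
  by (intro borel_measurable_continuous_onI gauss_symbol_cont)

lemma low_pass_measurable [measurable]: "low_pass M l \<in> borel_measurable borel"
  unfolding low_pass_def by measurable

lemma dyadic_cut_measurable [measurable]: "dyadic_cut M j \<in> borel_measurable borel"
  unfolding dyadic_cut_def by measurable

text \<open>The rough symbol after its replacement by a version that is jointly Borel and obeys the
  symbol bounds for every y instead of almost every y.\<close>

locale good_family = scale_params dim_ty \<rho> A
  for dim_ty :: "'n::finite itself" and \<rho> A :: real +
  fixes a :: "real^'n \<Rightarrow> real^'n \<Rightarrow> complex"
  assumes a_pair: "(\<lambda>p. a (fst p) (snd p)) \<in> borel_measurable (borel \<Otimes>\<^sub>M borel)"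
    and a_good: "\<And>y. good (a y)"
begin

lemma a_measurable [measurable (raw)]:
  assumes [measurable]: "f \<in> borel_measurable M" "g \<in> borel_measurable M"
  shows "(\<lambda>x. a (f x) (g x)) \<in> borel_measurable M"
  using measurable_compose[OF measurable_Pair[OF assms] a_pair] by simp

text \<open>The j-th frequency piece of the adjoint, given directly by its kernel;
  \<open>dyadic_cut_adj_symbol_integrable\<close> identifies it on the Fourier side.\<close>

definition dyadic_op :: "nat \<Rightarrow> (real^'n \<Rightarrow> complex) \<Rightarrow> real^'n \<Rightarrow> complex" where
  "dyadic_op j f x = complex_of_real (1 / (2 * pi) ^ CARD('n)) * (LINT y|lborel. dyadic_ker j (a y) (x - y) * f y)"

lemma dyadic_ker_pair_measurable [measurable (raw)]:
  assumes [measurable]: "f \<in> borel_measurable M" "g \<in> borel_measurable M"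
  shows "(\<lambda>x. dyadic_ker j (a (f x)) (g x)) \<in> borel_measurable M"
  unfolding dyadic_ker_def FT_def by measurable

lemma dyadic_op_measurable [measurable (raw)]:
  assumes [measurable]: "f \<in> borel_measurable borel"
  shows "dyadic_op j f \<in> borel_measurable borel"
  unfolding dyadic_op_def by measurable

definition "inv_const = 1 / (2 * pi) ^ CARD('n)"

lemma inv_const_nonneg: "0 \<le> inv_const" by (simp add: inv_const_def)

lemma dyadic_op_norm_le: "ennreal (norm (dyadic_op j f x)) \<le> ennreal inv_const * (\<integral>\<^sup>+y. ennreal (norm (f y)) * ennreal (norm (dyadic_ker j (a y) (x - y))) \<partial>lborel)"
proof -
  have "ennreal (norm (dyadic_op j f x)) = ennreal inv_const * ennreal (norm (LINT y|lborel. dyadic_ker j (a y) (x - y) * f y))"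
    unfolding dyadic_op_def inv_const_def[symmetric] norm_mult norm_of_real using inv_const_nonneg by (subst ennreal_mult') auto
  also have "\<dots> \<le> ennreal inv_const * (\<integral>\<^sup>+y. ennreal (norm (dyadic_ker j (a y) (x - y) * f y)) \<partial>lborel)"
    by (intro mult_left_mono ennreal_norm_integral_le) simp
  also have "(\<integral>\<^sup>+y. ennreal (norm (dyadic_ker j (a y) (x - y) * f y)) \<partial>lborel) = (\<integral>\<^sup>+y. ennreal (norm (f y)) * ennreal (norm (dyadic_ker j (a y) (x - y))) \<partial>lborel)"
    by (intro nn_integral_cong) (simp add: norm_mult mult.commute flip: ennreal_mult)
  finally show ?thesis .
qed

text \<open>Tonelli puts the integration over x inside, where the symbol is frozen at y. The inner
  integrals are exactly what the single-symbol estimates bound.\<close>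

lemma dyadic_op_integral_le:
  assumes [measurable]: "f \<in> borel_measurable borel" "S \<in> sets borel"
  shows "(\<integral>\<^sup>+x\<in>S. ennreal (norm (dyadic_op j f x)) \<partial>lborel) \<le>
    ennreal inv_const * (\<integral>\<^sup>+y. ennreal (norm (f y)) * (\<integral>\<^sup>+x\<in>S. ennreal (norm (dyadic_ker j (a y) (x - y))) \<partial>lborel) \<partial>lborel)"
proof -
  have "(\<integral>\<^sup>+x\<in>S. ennreal (norm (dyadic_op j f x)) \<partial>lborel) \<le>
     (\<integral>\<^sup>+x. ennreal inv_const * (\<integral>\<^sup>+y. ennreal (norm (f y)) * ennreal (norm (dyadic_ker j (a y) (x - y))) \<partial>lborel) * indicator S x \<partial>lborel)"
    by (intro nn_integral_mono mult_right_mono dyadic_op_norm_le) simp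
  also have "\<dots> = (\<integral>\<^sup>+x. ennreal inv_const * (\<integral>\<^sup>+y. ennreal (norm (f y)) * (ennreal (norm (dyadic_ker j (a y) (x - y))) * indicator S x) \<partial>lborel) \<partial>lborel)"
    by (intro nn_integral_cong) (simp add: indicator_def)
  also have "\<dots> = ennreal inv_const * (\<integral>\<^sup>+x. (\<integral>\<^sup>+y. ennreal (norm (f y)) * (ennreal (norm (dyadic_ker j (a y) (x - y))) * indicator S x) \<partial>lborel) \<partial>lborel)"
    by (rule nn_integral_cmult) measurable
  also have "(\<integral>\<^sup>+x. (\<integral>\<^sup>+y. ennreal (norm (f y)) * (ennreal (norm (dyadic_ker j (a y) (x - y))) * indicator S x) \<partial>lborel) \<partial>lborel)
     = (\<integral>\<^sup>+y. (\<integral>\<^sup>+x. ennreal (norm (f y)) * (ennreal (norm (dyadic_ker j (a y) (x - y))) * indicator S x) \<partial>lborel) \<partial>lborel)"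
    by (rule lborel_pair.Fubini') measurable
  also have "\<dots> = (\<integral>\<^sup>+y. ennreal (norm (f y)) * (\<integral>\<^sup>+x\<in>S. ennreal (norm (dyadic_ker j (a y) (x - y))) \<partial>lborel) \<partial>lborel)"
    by (intro nn_integral_cong nn_integral_cmult) measurable
  finally show ?thesis .
qed

lemma dyadic_op_cube:
  "\<exists>C\<ge>0. \<forall>j f p l x0. f \<in> borel_measurable borel \<longrightarrow> 0 < l \<longrightarrow> x0 \<in> cbox p (p + (\<chi> i. l)) \<longrightarrow>
    (\<integral>\<^sup>+x\<in>cbox p (p + (\<chi> i. l)). ennreal (norm (dyadic_op j f x)) \<partial>lborel) \<le> ennreal (C * (l ^ CARD('n) * cube_gain j l)) * maximal f x0"
proof -
  let ?n = "CARD('n)"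
  obtain C where C: "0 \<le> C" "\<And>j b p l x0 y. good b \<Longrightarrow> 0 < l \<Longrightarrow> x0 \<in> cbox p (p + (\<chi> i. l)) \<Longrightarrow>
    (\<integral>\<^sup>+x\<in>cbox p (p + (\<chi> i. l)). ennreal (norm (dyadic_ker j b (x - y))) \<partial>lborel)
     \<le> ennreal (C * ((l / max l (ker_scale j)) ^ CARD('n) * cube_gain j l * (1 / (1 + norm (y - x0) / max l (ker_scale j)) ^ (CARD('n) + 1))))"
    using dyadic_ker_cube by blast
  show ?thesis
  proof (intro exI conjI allI impI)
    show "0 \<le> inv_const * C * (4 * 4 ^ ?n)" using C inv_const_nonneg by simp
    fix j and f :: "real^'n \<Rightarrow> complex" and p x0 :: "real^'n" and l :: real
    assume [measurable]: "f \<in> borel_measurable borel" and l: "0 < l" and x0: "x0 \<in> cbox p (p + (\<chi> i. l))"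
    let ?Q = "cbox p (p + (\<chi> i. l))"
    define s where "s = max l (ker_scale j)"
    have s: "0 < s" using l by (simp add: s_def)
    define D where "D = C * ((l / s) ^ ?n * cube_gain j l)"
    have D: "0 \<le> D" using C l s by (simp add: D_def cube_gain_def)
    let ?wt = "\<lambda>y. 1 / (1 + norm (y - x0) / s) ^ (?n + 1)"
    have "(\<integral>\<^sup>+x\<in>?Q. ennreal (norm (dyadic_op j f x)) \<partial>lborel) \<le>
      ennreal inv_const * (\<integral>\<^sup>+y. ennreal (norm (f y)) * (\<integral>\<^sup>+x\<in>?Q. ennreal (norm (dyadic_ker j (a y) (x - y))) \<partial>lborel) \<partial>lborel)"
      by (rule dyadic_op_integral_le) auto
    also have "\<dots> \<le> ennreal inv_const * (\<integral>\<^sup>+y. ennreal (norm (f y)) * ennreal (D * ?wt y) \<partial>lborel)"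
      using C(2)[OF a_good l x0] by (intro mult_left_mono nn_integral_mono) (auto simp: D_def s_def mult.assoc)
    also have "(\<integral>\<^sup>+y. ennreal (norm (f y)) * ennreal (D * ?wt y) \<partial>lborel) = (\<integral>\<^sup>+y. ennreal D * (ennreal (norm (f y)) * ennreal (?wt y)) \<partial>lborel)"
      using D by (intro nn_integral_cong) (simp only: ennreal_mult' mult.left_commute)
    also have "\<dots> = ennreal D * (\<integral>\<^sup>+y. ennreal (norm (f y)) * ennreal (?wt y) \<partial>lborel)"
      by (rule nn_integral_cmult) measurable
    also have "ennreal inv_const * \<dots> \<le> ennreal inv_const * (ennreal D * (ennreal (4 * 4 ^ ?n * s ^ ?n) * maximal f x0))"
      by (intro mult_left_mono tail_weight_maximal s) auto
    also have "\<dots> = ennreal (inv_const * (D * (4 * 4 ^ ?n * s ^ ?n))) * maximal f x0"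
    proof -
      have "ennreal (inv_const * (D * (4 * 4 ^ ?n * s ^ ?n))) = ennreal inv_const * (ennreal D * ennreal (4 * 4 ^ ?n * s ^ ?n))"
        using D inv_const_nonneg s by (subst ennreal_mult, simp, simp, subst ennreal_mult, simp_all)
      then show ?thesis by (simp only: mult.assoc)
    qed
    also have "inv_const * (D * (4 * 4 ^ ?n * s ^ ?n)) = inv_const * C * (4 * 4 ^ ?n) * (l ^ ?n * cube_gain j l)"
      using s by (simp add: D_def power_divide)
    finally show "(\<integral>\<^sup>+x\<in>?Q. ennreal (norm (dyadic_op j f x)) \<partial>lborel) \<le> ennreal (inv_const * C * (4 * 4 ^ ?n) * (l ^ ?n * cube_gain j l)) * maximal f x0" .
  qed
qed

lemma dyadic_op_L1:
  "\<exists>C\<ge>0. \<forall>j f. f \<in> borel_measurable borel \<longrightarrow>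
    (\<integral>\<^sup>+x. ennreal (norm (dyadic_op j f x)) \<partial>lborel) \<le> ennreal (C * (2 ^ j) powr (- real CARD('n) * (1 - \<rho>) / 2)) * (\<integral>\<^sup>+y. ennreal (norm (f y)) \<partial>lborel)"
proof -
  obtain C where C: "0 \<le> C" "\<And>j b y. good b \<Longrightarrow>
    (\<integral>\<^sup>+x. ennreal (norm (dyadic_ker j b (x - y))) \<partial>lborel) \<le> ennreal (C * (2 ^ j) powr (- real CARD('n) * (1 - \<rho>) / 2))"
    using dyadic_ker_L1 by blast
  show ?thesis
  proof (intro exI conjI allI impI)
    show "0 \<le> inv_const * C" using C inv_const_nonneg by simp
    fix j and f :: "real^'n \<Rightarrow> complex" assume [measurable]: "f \<in> borel_measurable borel"
    define r where "r = C * (2 ^ j) powr (- real CARD('n) * (1 - \<rho>) / 2)"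
    have "(\<integral>\<^sup>+x\<in>UNIV. ennreal (norm (dyadic_op j f x)) \<partial>lborel) \<le>
      ennreal inv_const * (\<integral>\<^sup>+y. ennreal (norm (f y)) * (\<integral>\<^sup>+x\<in>UNIV. ennreal (norm (dyadic_ker j (a y) (x - y))) \<partial>lborel) \<partial>lborel)"
      by (rule dyadic_op_integral_le) auto
    also have "\<dots> \<le> ennreal inv_const * (\<integral>\<^sup>+y. ennreal r * ennreal (norm (f y)) \<partial>lborel)"
      using C(2)[OF a_good] by (intro mult_left_mono nn_integral_mono) (auto simp: r_def mult.commute intro!: mult_left_mono)
    also have "(\<integral>\<^sup>+y. ennreal r * ennreal (norm (f y)) \<partial>lborel) = ennreal r * (\<integral>\<^sup>+y. ennreal (norm (f y)) \<partial>lborel)"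
      by (rule nn_integral_cmult) measurable
    also have "ennreal inv_const * (ennreal r * (\<integral>\<^sup>+y. ennreal (norm (f y)) \<partial>lborel)) = ennreal (inv_const * r) * (\<integral>\<^sup>+y. ennreal (norm (f y)) \<partial>lborel)"
      using inv_const_nonneg by (simp only: ennreal_mult' mult.assoc)
    finally show "(\<integral>\<^sup>+x. ennreal (norm (dyadic_op j f x)) \<partial>lborel) \<le> ennreal (inv_const * C * (2 ^ j) powr (- real CARD('n) * (1 - \<rho>) / 2)) * (\<integral>\<^sup>+y. ennreal (norm (f y)) \<partial>lborel)"
      by (simp add: r_def mult.assoc)
  qed
qed

text \<open>A crude bound that serves to make the integrals defining the pieces converge.\<close>

lemma dyadic_ker_bounded: "\<exists>C\<ge>0. \<forall>j b z. good b \<longrightarrow> norm (dyadic_ker j b z) \<le> C * (2 ^ j) powr (m + real CARD('n))"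
proof -
  obtain C1 where C1: "0 \<le> C1" "\<And>j (b :: real^'n \<Rightarrow> complex) z. (\<forall>i. symb \<rho> i num_derivs A m b) \<Longrightarrow>
     norm (FT (\<lambda>\<xi>. b \<xi> * dyadic_cut num_derivs j \<xi>) z) * (1 + (2 ^ j) powr \<rho> * norm z) ^ num_derivs \<le> C1 * (2 ^ j) powr (m + real CARD('n))"
    using kernel_sup[OF _ _ M_le(1,2), where 'n='n and A=A] \<rho> by force
  show ?thesis
  proof (intro exI conjI allI impI)
    show "0 \<le> C1" by fact
    fix j b z assume "good b"
    have "norm (dyadic_ker j b z) * 1 \<le> norm (dyadic_ker j b z) * (1 + (2 ^ j) powr \<rho> * norm z) ^ num_derivs"
      by (intro mult_left_mono one_le_power) auto
    also have "\<dots> \<le> C1 * (2 ^ j) powr (m + real CARD('n))"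
      using C1(2) \<open>good b\<close> by (simp add: dyadic_ker_def good_def)
    finally show "norm (dyadic_ker j b z) \<le> C1 * (2 ^ j) powr (m + real CARD('n))" by simp
  qed
qed

lemma dyadic_ker_f_integrable:
  assumes f: "integrable lborel f"
  shows "integrable lborel (\<lambda>y. dyadic_ker j (a y) (x - y) * f y)"
proof -
  obtain C where C: "0 \<le> C" "\<And>j b z. good b \<Longrightarrow> norm (dyadic_ker j b z) \<le> C * (2 ^ j) powr (m + real CARD('n))"
    using dyadic_ker_bounded by blast
  let ?B = "C * (2 ^ j) powr (m + real CARD('n))"
  have [measurable]: "f \<in> borel_measurable borel" using f by auto
  show ?thesis
  proof (rule Bochner_Integration.integrable_bound)
    show "integrable lborel (\<lambda>y. ?B * norm (f y))" using f by simp
    show "AE y in lborel. norm (dyadic_ker j (a y) (x - y) * f y) \<le> norm (?B * norm (f y))"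
      using C(1) by (intro AE_I2) (auto simp: norm_mult intro!: mult_right_mono C(2) a_good)
  qed measurable
qed

text \<open>The bound is pointwise on the cube: a tail weight of width \<lambda>^(-\<rho>)
  contributes \<lambda>^(-n\<rho>) Mf, which reduces \<lambda>^(1 + n\<rho>) l to \<lambda> l.
  Integrability of f allows the two integrals to be subtracted under one sign.\<close>

lemma dyadic_op_diff:
  "\<exists>C\<ge>0. \<forall>j f p l x0. integrable lborel f \<longrightarrow> 0 < l \<longrightarrow> 2 ^ j * l \<le> 1 \<longrightarrow> x0 \<in> cbox p (p + (\<chi> i. l)) \<longrightarrow>
    (\<integral>\<^sup>+x\<in>cbox p (p + (\<chi> i. l)). ennreal (norm (dyadic_op j f x - dyadic_op j f x0)) \<partial>lborel) \<le> ennreal (C * (l ^ CARD('n) * (2 ^ j * l))) * maximal f x0"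
proof -
  let ?n = "CARD('n)"
  obtain C where C: "0 \<le> C" "\<And>j b x x0 y. good b \<Longrightarrow> norm (x - x0) \<le> real ?n * ker_scale j \<Longrightarrow>
    norm (dyadic_ker j b (x - y) - dyadic_ker j b (x0 - y)) \<le> C * ((2 ^ j) powr (1 + \<rho> * real ?n) * norm (x - x0) * (1 / (1 + norm (y - x0) / ker_scale j) ^ (?n + 1)))"
    using dyadic_ker_diff by blast
  define C' where "C' = inv_const * C * real ?n * (4 * 4 ^ ?n)"
  have C': "0 \<le> C'" using C inv_const_nonneg by (simp add: C'_def)
  show ?thesis
  proof (intro exI conjI allI impI)
    show "0 \<le> C'" by (rule C')
    fix j and f :: "real^'n \<Rightarrow> complex" and p x0 :: "real^'n" and l :: real
    assume f: "integrable lborel f" and l: "0 < l" and jl: "2 ^ j * l \<le> 1" and x0: "x0 \<in> cbox p (p + (\<chi> i. l))"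
    let ?Q = "cbox p (p + (\<chi> i. l))"
    have [measurable]: "f \<in> borel_measurable borel" using f by auto
    \<comment> \<open>Here l \<le> 1/\<lambda> \<le> \<lambda>^(-\<rho>), so the cube is below the
      kernel width and \<open>dyadic_ker_diff\<close> applies to all its points.\<close>
    have lscl: "l \<le> ker_scale j"
    proof -
      have "l \<le> 1 / 2 ^ j" using jl by (simp add: field_simps)
      also have "\<dots> = (2 ^ j) powr (- 1)" by (simp add: powr_minus divide_inverse)
      also have "\<dots> \<le> ker_scale j" unfolding ker_scale_def using \<rho> by (intro powr_mono) auto
      finally show ?thesis .
    qed
    define D where "D = C * ((2 ^ j) powr (1 + \<rho> * real ?n) * (real ?n * l))"
    have D: "0 \<le> D" using C l by (simp add: D_def)
    let ?wt = "\<lambda>y. 1 / (1 + norm (y - x0) / ker_scale j) ^ (?n + 1)"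
    have pt: "ennreal (norm (dyadic_op j f x - dyadic_op j f x0)) \<le> ennreal (C' * (2 ^ j * l)) * maximal f x0" if x: "x \<in> ?Q" for x
    proof -
      have nx: "norm (x - x0) \<le> real ?n * l" by (rule cube_norm_diff[OF x x0])
      then have nx': "norm (x - x0) \<le> real ?n * ker_scale j" using lscl by (meson mult_left_mono of_nat_0_le_iff order_trans)
      have "dyadic_op j f x - dyadic_op j f x0 = complex_of_real inv_const * ((LINT y|lborel. dyadic_ker j (a y) (x - y) * f y) - (LINT y|lborel. dyadic_ker j (a y) (x0 - y) * f y))"
        unfolding dyadic_op_def inv_const_def by (simp only: right_diff_distrib)
      also have "(LINT y|lborel. dyadic_ker j (a y) (x - y) * f y) - (LINT y|lborel. dyadic_ker j (a y) (x0 - y) * f y)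
         = (LINT y|lborel. (dyadic_ker j (a y) (x - y) - dyadic_ker j (a y) (x0 - y)) * f y)"
        using dyadic_ker_f_integrable[OF f, of j] by (simp add: left_diff_distrib)
      finally have "ennreal (norm (dyadic_op j f x - dyadic_op j f x0)) = ennreal inv_const * ennreal (norm (LINT y|lborel. (dyadic_ker j (a y) (x - y) - dyadic_ker j (a y) (x0 - y)) * f y))"
        using inv_const_nonneg by (simp add: norm_mult ennreal_mult')
      also have "\<dots> \<le> ennreal inv_const * (\<integral>\<^sup>+y. ennreal (norm ((dyadic_ker j (a y) (x - y) - dyadic_ker j (a y) (x0 - y)) * f y)) \<partial>lborel)"
        by (intro mult_left_mono ennreal_norm_integral_le) simp
      also have "\<dots> \<le> ennreal inv_const * (\<integral>\<^sup>+y. ennreal D * (ennreal (norm (f y)) * ennreal (?wt y)) \<partial>lborel)"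
      proof (intro mult_left_mono nn_integral_mono)
        fix y
        have "norm (dyadic_ker j (a y) (x - y) - dyadic_ker j (a y) (x0 - y)) \<le> C * ((2 ^ j) powr (1 + \<rho> * real ?n) * norm (x - x0) * ?wt y)"
          by (rule C(2)[OF a_good nx'])
        also have "\<dots> \<le> C * ((2 ^ j) powr (1 + \<rho> * real ?n) * (real ?n * l) * ?wt y)"
          using C(1) nx ker_scale_pos[of j] by (intro mult_left_mono mult_right_mono) auto
        finally have "norm (dyadic_ker j (a y) (x - y) - dyadic_ker j (a y) (x0 - y)) * norm (f y) \<le> D * ?wt y * norm (f y)"
          unfolding D_def by (intro mult_right_mono) (auto simp: mult.assoc)
        then have "ennreal (norm ((dyadic_ker j (a y) (x - y) - dyadic_ker j (a y) (x0 - y)) * f y)) \<le> ennreal (D * (norm (f y) * ?wt y))"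
          by (intro ennreal_leI) (simp only: norm_mult mult_ac)
        then show "ennreal (norm ((dyadic_ker j (a y) (x - y) - dyadic_ker j (a y) (x0 - y)) * f y)) \<le> ennreal D * (ennreal (norm (f y)) * ennreal (?wt y))"
          using D by (simp only: ennreal_mult' norm_ge_zero)
      qed simp
      also have "(\<integral>\<^sup>+y. ennreal D * (ennreal (norm (f y)) * ennreal (?wt y)) \<partial>lborel) = ennreal D * (\<integral>\<^sup>+y. ennreal (norm (f y)) * ennreal (?wt y) \<partial>lborel)"
        by (rule nn_integral_cmult) measurable
      also have "ennreal inv_const * \<dots> \<le> ennreal inv_const * (ennreal D * (ennreal (4 * 4 ^ ?n * ker_scale j ^ ?n) * maximal f x0))"
        by (intro mult_left_mono tail_weight_maximal ker_scale_pos) auto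
      also have "\<dots> = ennreal (inv_const * (D * (4 * 4 ^ ?n * ker_scale j ^ ?n))) * maximal f x0"
      proof -
        have "ennreal (inv_const * (D * (4 * 4 ^ ?n * ker_scale j ^ ?n))) = ennreal inv_const * (ennreal D * ennreal (4 * 4 ^ ?n * ker_scale j ^ ?n))"
          using D inv_const_nonneg ker_scale_pos[of j] by (simp only: ennreal_mult')
        then show ?thesis by (simp only: mult.assoc)
      qed
      also have "inv_const * (D * (4 * 4 ^ ?n * ker_scale j ^ ?n)) = C' * (2 ^ j * l)"
      proof -
        have "(2 ^ j) powr (1 + \<rho> * real ?n) * ker_scale j ^ ?n = (2 ^ j) powr (1 + \<rho> * real ?n) * (2 ^ j) powr (- \<rho> * real ?n)"
          unfolding ker_scale_def by (subst powr_real_power) auto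
        also have "\<dots> = 2 ^ j" by (simp flip: powr_add)
        finally have e: "(2 ^ j) powr (1 + \<rho> * real ?n) * ker_scale j ^ ?n = 2 ^ j" .
        have "inv_const * (D * (4 * 4 ^ ?n * ker_scale j ^ ?n)) = C' * (((2 ^ j) powr (1 + \<rho> * real ?n) * ker_scale j ^ ?n) * l)"
          unfolding D_def C'_def by (simp only: mult_ac)
        then show ?thesis by (simp only: e)
      qed
      finally show ?thesis .
    qed
    have "(\<integral>\<^sup>+x\<in>?Q. ennreal (norm (dyadic_op j f x - dyadic_op j f x0)) \<partial>lborel) \<le> (\<integral>\<^sup>+x. (ennreal (C' * (2 ^ j * l)) * maximal f x0) * indicator ?Q x \<partial>lborel)"
      using pt by (intro nn_integral_mono) (auto simp: indicator_def)
    also have "\<dots> = (ennreal (C' * (2 ^ j * l)) * maximal f x0) * ennreal (l ^ ?n)"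
      using emeasure_cube[of l p] l by (subst nn_integral_cmult_indicator) auto
    also have "\<dots> = (ennreal (C' * (2 ^ j * l)) * ennreal (l ^ ?n)) * maximal f x0"
      by (simp only: mult_ac)
    also have "ennreal (C' * (2 ^ j * l)) * ennreal (l ^ ?n) = ennreal ((C' * (2 ^ j * l)) * l ^ ?n)"
      using l C' by (subst ennreal_mult) auto
    also have "(C' * (2 ^ j * l)) * l ^ ?n = C' * (l ^ ?n * (2 ^ j * l))" by (simp only: mult_ac)
    finally show "(\<integral>\<^sup>+x\<in>?Q. ennreal (norm (dyadic_op j f x - dyadic_op j f x0)) \<partial>lborel) \<le> ennreal (C' * (l ^ ?n * (2 ^ j * l))) * maximal f x0" .
  qed
qed

end

text \<open>Both tails of \<open>j \<mapsto> 2\<^sup>j l\<close> are geometric, so the bound does not depend on \<open>l\<close>.\<close>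

lemma sum_scales_le:
  fixes h :: "real \<Rightarrow> real"
  assumes h: "\<And>t. h t = (if t \<le> 1 then t else t powr (- 1 / 2))" and l: "0 < l"
  shows "(\<Sum>j<J. h (2 ^ j * l)) \<le> 6"
proof -
  have shift: "(\<Sum>j<Suc J. h (2 ^ j * l)) = h l + (\<Sum>j<J. h (2 ^ j * (2 * l)))" for J l
    by (simp add: sum.lessThan_Suc_shift mult_ac del: sum.lessThan_Suc)
  \<comment> \<open>The ratio 3/4 is a rational number above 2^(-1/2), and it explains the constant
    4 = 1 / (1 - 3/4) in \<open>big\<close>.\<close>
  have half: "(2 * l) powr (- 1 / 2) \<le> (3 / 4) * l powr (- 1 / 2)" if "0 < l" for l :: real
  proof -
    have "(2::real) powr (- 1 / 2) = inverse (2 powr (1 / 2))" using powr_minus[of "2::real" "1 / 2"] by simp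
    also have "\<dots> = 1 / sqrt 2" by (simp add: powr_half_sqrt inverse_eq_divide)
    also have "\<dots> \<le> 3 / 4"
    proof -
      have "4 / 3 \<le> sqrt 2" by (rule real_le_rsqrt) (simp add: power2_eq_square)
      then show ?thesis by (simp add: field_simps)
    qed
    finally have "(2::real) powr (- 1 / 2) * l powr (- 1 / 2) \<le> (3 / 4) * l powr (- 1 / 2)" by (rule mult_right_mono) simp
    then show ?thesis using that by (simp add: powr_mult)
  qed
  have le1: "t powr (- 1 / 2) \<le> 1" if "1 \<le> t" for t :: real
    using powr_mono[of "- 1 / 2" 0 t] that by simp
  have big: "(\<Sum>j<J. h (2 ^ j * l)) \<le> 4 * l powr (- 1 / 2)" if "1 < l" for J l
    using that
  proof (induction J arbitrary: l)
    case (Suc J)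
    have "(\<Sum>j<J. h (2 ^ j * (2 * l))) \<le> 4 * (2 * l) powr (- 1 / 2)" using Suc by (intro Suc.IH) auto
    also have "\<dots> \<le> 4 * ((3 / 4) * l powr (- 1 / 2))" using half[of l] Suc.prems by simp
    finally show ?case unfolding shift using Suc.prems by (simp add: h)
  qed simp
  \<comment> \<open>The slack -l lets the induction close: l + (6 - 2l) = 6 - l while 2l \<le> 1,
    and l + 4 \<le> 6 - l at the crossing because l \<le> 1.\<close>
  have "(\<Sum>j<J. h (2 ^ j * l)) \<le> 6 - l" if "0 < l" "l \<le> 1" for l
    using that
  proof (induction J arbitrary: l)
    case (Suc J)
    show ?case
    proof (cases "2 * l \<le> 1")
      case True
      then have "(\<Sum>j<J. h (2 ^ j * (2 * l))) \<le> 6 - 2 * l" using Suc by (intro Suc.IH) auto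
      then show ?thesis unfolding shift using Suc.prems by (simp add: h)
    next
      case False
      then have "(\<Sum>j<J. h (2 ^ j * (2 * l))) \<le> 4 * (2 * l) powr (- 1 / 2)" by (intro big) auto
      also have "\<dots> \<le> 4 * 1" using False by (intro mult_left_mono le1) auto
      finally show ?thesis unfolding shift using Suc.prems by (simp add: h)
    qed
  qed simp
  then have s: "(\<Sum>j<J. h (2 ^ j * l)) \<le> 6" if "l \<le> 1" using l that by fastforce
  show ?thesis
  proof (cases "l \<le> 1")
    case False
    have "l powr (- 1 / 2) \<le> 1" using False by (intro le1) simp
    then show ?thesis using big[of l J] False by linarith
  qed (rule s)
qed

context good_family begin

text \<open>This is where \<rho> < 1 enters the sum over scales: the ratio is below 1 because 1 -
  \<rho> is positive.\<close>

definition decay_ratio :: real where "decay_ratio = 2 powr (- real CARD('n) * (1 - \<rho>) / 2)"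

lemma decay_ratio: "0 < decay_ratio" "decay_ratio < 1"
proof -
  have "0 < real CARD('n) * (1 - \<rho>)" using \<rho> by simp
  then show "0 < decay_ratio" "decay_ratio < 1" unfolding decay_ratio_def using powr_less_mono[of "- real CARD('n) * (1 - \<rho>) / 2" 0 2] by auto
qed

lemma decay_ratio_power: "(2 ^ j) powr (- real CARD('n) * (1 - \<rho>) / 2) = decay_ratio ^ j"
proof -
  have "(2 ^ j) powr (- real CARD('n) * (1 - \<rho>) / 2) = (2 powr real j) powr (- real CARD('n) * (1 - \<rho>) / 2)"
    by (simp add: powr_realpow)
  also have "\<dots> = (2 powr (- real CARD('n) * (1 - \<rho>) / 2)) powr real j" by (simp only: powr_powr mult.commute)
  also have "\<dots> = decay_ratio ^ j" unfolding decay_ratio_def[symmetric] using decay_ratio(1) by (rule powr_realpow)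
  finally show ?thesis .
qed

lemma suminf_decay_ratio: "(\<Sum>j. ennreal (decay_ratio ^ j)) = ennreal (1 / (1 - decay_ratio))"
  using decay_ratio by (subst suminf_ennreal_eq[where x="1 / (1 - decay_ratio)"]) (auto intro: geometric_sums)

definition scale_gain :: "nat \<Rightarrow> real \<Rightarrow> real" where
  "scale_gain j l = (if 2 ^ j * l \<le> 1 then 2 ^ j * l else cube_gain j l)"

lemma suminf_scale_gain:
  assumes l: "0 < l"
  shows "(\<Sum>j. ennreal (scale_gain j l)) \<le> ennreal (1 / (1 - decay_ratio) + 6)"
proof -
  define h where "h t = (if t \<le> 1 then t else t powr (- 1 / 2))" for t :: real
  have g: "scale_gain j l \<le> decay_ratio ^ j + h (2 ^ j * l)" for j
  proof (cases "2 ^ j * l \<le> 1")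
    case True
    then show ?thesis using decay_ratio(1) by (simp add: scale_gain_def h_def)
  next
    case False
    \<comment> \<open>Beyond 2^j l = 1 the power -n/2 is at most the power -1/2, so the one
      numerical sum of \<open>sum_scales_le\<close> covers all dimensions.\<close>
    have "1 \<le> real CARD('n)" using zero_less_card_finite[where 'a='n] by linarith
    then have "(2 ^ j * l) powr (- real CARD('n) / 2) \<le> (2 ^ j * l) powr (- 1 / 2)"
      using False by (intro powr_mono) auto
    moreover have "scale_gain j l = decay_ratio ^ j + (2 ^ j * l) powr (- real CARD('n) / 2)" "h (2 ^ j * l) = (2 ^ j * l) powr (- 1 / 2)"
      using False by (simp_all only: scale_gain_def h_def cube_gain_def decay_ratio_power if_False)
    ultimately show ?thesis by linarith
  qed
  have h0: "0 \<le> h (2 ^ j * l)" for j using l by (simp add: h_def)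
  have "(\<Sum>j. ennreal (h (2 ^ j * l))) \<le> ennreal 6"
  proof (rule suminf_le_const)
    fix J
    have "(\<Sum>j<J. ennreal (h (2 ^ j * l))) = ennreal (\<Sum>j<J. h (2 ^ j * l))" using h0 by simp
    also have "\<dots> \<le> ennreal 6" by (intro ennreal_leI sum_scales_le l) (simp add: h_def)
    finally show "(\<Sum>j<J. ennreal (h (2 ^ j * l))) \<le> ennreal 6" .
  qed simp
  then have "(\<Sum>j. ennreal (decay_ratio ^ j)) + (\<Sum>j. ennreal (h (2 ^ j * l))) \<le> ennreal (1 / (1 - decay_ratio)) + ennreal 6"
    unfolding suminf_decay_ratio by (rule add_left_mono)
  moreover have "(\<Sum>j. ennreal (scale_gain j l)) \<le> (\<Sum>j. ennreal (decay_ratio ^ j) + ennreal (h (2 ^ j * l)))"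
    using g h0 decay_ratio(1) by (intro suminf_le) (auto simp flip: ennreal_plus intro!: ennreal_leI)
  moreover have "(\<Sum>j. ennreal (decay_ratio ^ j) + ennreal (h (2 ^ j * l))) = (\<Sum>j. ennreal (decay_ratio ^ j)) + (\<Sum>j. ennreal (h (2 ^ j * l)))"
    by (rule suminf_add[symmetric]) auto
  moreover have "ennreal (1 / (1 - decay_ratio)) + ennreal 6 = ennreal (1 / (1 - decay_ratio) + 6)"
    using decay_ratio(2) by (intro ennreal_plus[symmetric]) auto
  ultimately show ?thesis by simp
qed

text \<open>For integrable \<open>f\<close> the series converges absolutely almost everywhere, by
  \<open>dyadic_op_summable_AE\<close>. This is the function that will represent the
  distribution.\<close>

definition dyadic_sum :: "(real^'n \<Rightarrow> complex) \<Rightarrow> real^'n \<Rightarrow> complex" where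
  "dyadic_sum f x = (\<Sum>j. dyadic_op j f x)"

text \<open>Its purpose is to be an integrable majorant of all partial sums, for dominated
  convergence in \<open>dyadic_sum_pairing\<close>.\<close>

definition dyadic_sum_abs :: "(real^'n \<Rightarrow> complex) \<Rightarrow> real^'n \<Rightarrow> real" where
  "dyadic_sum_abs f x = (\<Sum>j. norm (dyadic_op j f x))"

lemma dyadic_op_norm_sum_finite:
  assumes f: "integrable lborel f"
  shows "(\<integral>\<^sup>+x. (\<Sum>j. ennreal (norm (dyadic_op j f x))) \<partial>lborel) < \<infinity>"
proof -
  have [measurable]: "f \<in> borel_measurable borel" using f by auto
  obtain C where C: "0 \<le> C" "\<And>j f. f \<in> borel_measurable borel \<Longrightarrow>
    (\<integral>\<^sup>+x. ennreal (norm (dyadic_op j f x)) \<partial>lborel) \<le> ennreal (C * (2 ^ j) powr (- real CARD('n) * (1 - \<rho>) / 2)) * (\<integral>\<^sup>+y. ennreal (norm (f y)) \<partial>lborel)"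
    using dyadic_op_L1 by blast
  let ?F = "\<integral>\<^sup>+y. ennreal (norm (f y)) \<partial>lborel"
  have "(\<integral>\<^sup>+x. (\<Sum>j. ennreal (norm (dyadic_op j f x))) \<partial>lborel) = (\<Sum>j. \<integral>\<^sup>+x. ennreal (norm (dyadic_op j f x)) \<partial>lborel)"
    by (rule nn_integral_suminf) measurable
  also have "\<dots> \<le> (\<Sum>j. ennreal (decay_ratio ^ j) * (ennreal C * ?F))"
  proof (rule suminf_le)
    fix j
    have "ennreal (C * decay_ratio ^ j) * ?F = ennreal (decay_ratio ^ j) * (ennreal C * ?F)"
      using C(1) by (simp only: ennreal_mult' mult_ac)
    then show "(\<integral>\<^sup>+x. ennreal (norm (dyadic_op j f x)) \<partial>lborel) \<le> ennreal (decay_ratio ^ j) * (ennreal C * ?F)"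
      using C(2)[of f j] unfolding decay_ratio_power by simp
  qed auto
  also have "\<dots> = ennreal (1 / (1 - decay_ratio)) * (ennreal C * ?F)" by (simp only: ennreal_suminf_multc suminf_decay_ratio)
  also have "\<dots> < \<infinity>" using f by (simp add: integrable_iff_bounded ennreal_mult_less_top)
  finally show ?thesis .
qed

text \<open>A series of nonnegative functions whose integrals have a finite sum converges almost
  everywhere.\<close>

lemma dyadic_op_summable_AE:
  assumes f: "integrable lborel f"
  shows "AE x in lborel. summable (\<lambda>j. norm (dyadic_op j f x))"
proof -
  have [measurable]: "f \<in> borel_measurable borel" using f by auto
  have "AE x in lborel. (\<Sum>j. ennreal (norm (dyadic_op j f x))) \<noteq> \<infinity>"
    by (rule nn_integral_PInf_AE) (use dyadic_op_norm_sum_finite[OF f] in auto)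
  then show ?thesis
    by eventually_elim (auto intro!: summable_suminf_not_top)
qed

lemma dyadic_sum_measurable [measurable (raw)]:
  assumes [measurable]: "f \<in> borel_measurable borel"
  shows "dyadic_sum f \<in> borel_measurable borel" "dyadic_sum_abs f \<in> borel_measurable borel"
  unfolding dyadic_sum_def dyadic_sum_abs_def by measurable

lemma dyadic_sum_abs_integrable:
  assumes f: "integrable lborel f"
  shows "integrable lborel (dyadic_sum_abs f)"
proof (rule integrableI_bounded)
  have [measurable]: "f \<in> borel_measurable borel" using f by auto
  show "dyadic_sum_abs f \<in> borel_measurable lborel" by measurable
  have "(\<integral>\<^sup>+x. ennreal (norm (dyadic_sum_abs f x)) \<partial>lborel) = (\<integral>\<^sup>+x. (\<Sum>j. ennreal (norm (dyadic_op j f x))) \<partial>lborel)"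
  proof (rule nn_integral_cong_AE)
    show "AE x in lborel. ennreal (norm (dyadic_sum_abs f x)) = (\<Sum>j. ennreal (norm (dyadic_op j f x)))"
      using dyadic_op_summable_AE[OF f]
    proof eventually_elim
      case (elim x)
      then show ?case by (simp add: dyadic_sum_abs_def suminf_ennreal2 suminf_nonneg)
    qed
  qed
  also have "\<dots> < \<infinity>" by (rule dyadic_op_norm_sum_finite[OF f])
  finally show "(\<integral>\<^sup>+x. ennreal (norm (dyadic_sum_abs f x)) \<partial>lborel) < \<infinity>" .
qed

lemma dyadic_sum_le_dyadic_sum_abs:
  assumes f: "integrable lborel f"
  shows "AE x in lborel. norm (dyadic_sum f x) \<le> dyadic_sum_abs f x"
  using dyadic_op_summable_AE[OF f] unfolding dyadic_sum_def dyadic_sum_abs_def by eventually_elim (rule summable_norm)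

lemma dyadic_sum_integrable:
  assumes f: "integrable lborel f"
  shows "integrable lborel (dyadic_sum f)"
proof -
  have [measurable]: "f \<in> borel_measurable borel" using f by auto
  show ?thesis
  proof (rule Bochner_Integration.integrable_bound[OF dyadic_sum_abs_integrable[OF f]])
    show "AE x in lborel. norm (dyadic_sum f x) \<le> norm (dyadic_sum_abs f x)"
      using dyadic_sum_le_dyadic_sum_abs[OF f] by eventually_elim auto
  qed measurable
qed

text \<open>The constant subtracted is the sum of the values at x0 of the pieces with 2^j l \<le> 1.
  There are finitely many of these, so it exists even where the full series diverges. The finer
  pieces are estimated by their size alone.\<close>

lemma dyadic_sum_cube:
  "\<exists>C\<ge>0. \<forall>f p l x0. integrable lborel f \<longrightarrow> 0 < l \<longrightarrow> x0 \<in> cbox p (p + (\<chi> i. l)) \<longrightarrow>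
    (\<exists>c. (\<integral>\<^sup>+x\<in>cbox p (p + (\<chi> i. l)). ennreal (norm (dyadic_sum f x - c)) \<partial>lborel) \<le> ennreal (C * l ^ CARD('n)) * maximal f x0)"
proof -
  let ?n = "CARD('n)"
  obtain C1 where C1: "0 \<le> C1" "\<And>j f p l x0. f \<in> borel_measurable borel \<Longrightarrow> 0 < l \<Longrightarrow> x0 \<in> cbox p (p + (\<chi> i. l)) \<Longrightarrow>
    (\<integral>\<^sup>+x\<in>cbox p (p + (\<chi> i. l)). ennreal (norm (dyadic_op j f x)) \<partial>lborel) \<le> ennreal (C1 * (l ^ ?n * cube_gain j l)) * maximal f x0"
    using dyadic_op_cube by blast
  obtain C2 where C2: "0 \<le> C2" "\<And>j f p l x0. integrable lborel f \<Longrightarrow> 0 < l \<Longrightarrow> 2 ^ j * l \<le> 1 \<Longrightarrow> x0 \<in> cbox p (p + (\<chi> i. l)) \<Longrightarrow>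
    (\<integral>\<^sup>+x\<in>cbox p (p + (\<chi> i. l)). ennreal (norm (dyadic_op j f x - dyadic_op j f x0)) \<partial>lborel) \<le> ennreal (C2 * (l ^ ?n * (2 ^ j * l))) * maximal f x0"
    using dyadic_op_diff by blast
  define B where "B = 1 / (1 - decay_ratio) + 6"
  have B: "0 \<le> B" using decay_ratio by (simp add: B_def)
  show ?thesis
  proof (intro exI[of _ "(C1 + C2) * B"] conjI allI impI)
    show "0 \<le> (C1 + C2) * B" using C1 C2 B by simp
    fix f :: "real^'n \<Rightarrow> complex" and p x0 :: "real^'n" and l :: real
    assume f: "integrable lborel f" and l: "0 < l" and x0: "x0 \<in> cbox p (p + (\<chi> i. l))"
    let ?Q = "cbox p (p + (\<chi> i. l))"
    have [measurable]: "f \<in> borel_measurable borel" using f by auto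
    define cj where "cj j = (if 2 ^ j * l \<le> 1 then dyadic_op j f x0 else 0)" for j
    have fin: "finite {j. 2 ^ j * l \<le> 1}"
    proof -
      obtain k where k: "1 / l < 2 ^ k" using real_arch_pow[of 2 "1 / l"] by auto
      have "{j. 2 ^ j * l \<le> 1} \<subseteq> {..k}"
      proof safe
        fix j assume j: "2 ^ j * l \<le> 1"
        then have "2 ^ j \<le> 1 / l" using l by (simp add: field_simps)
        with k have "(2::real) ^ j < 2 ^ k" by linarith
        then show "j \<le> k" by simp
      qed
      then show ?thesis by (rule finite_subset) simp
    qed
    have cs: "summable cj" "(\<Sum>j. cj j) = (\<Sum>j\<in>{j. 2 ^ j * l \<le> 1}. dyadic_op j f x0)"
    proof -
      have "cj sums (\<Sum>j\<in>{j. 2 ^ j * l \<le> 1}. cj j)" by (rule sums_finite[OF fin]) (simp add: cj_def)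
      then have "cj sums (\<Sum>j\<in>{j. 2 ^ j * l \<le> 1}. dyadic_op j f x0)" by (simp add: cj_def)
      then show "summable cj" "(\<Sum>j. cj j) = (\<Sum>j\<in>{j. 2 ^ j * l \<le> 1}. dyadic_op j f x0)"
        by (auto simp: sums_iff)
    qed
    have cn': "summable (\<lambda>j. norm (cj j))" by (rule summable_finite[OF fin]) (simp add: cj_def)
    have each: "(\<integral>\<^sup>+x\<in>?Q. ennreal (norm (dyadic_op j f x - cj j)) \<partial>lborel) \<le> ennreal (scale_gain j l) * (ennreal ((C1 + C2) * l ^ ?n) * maximal f x0)" for j
    proof -
      have g0: "0 \<le> scale_gain j l" using l by (simp add: scale_gain_def cube_gain_def)
      have "(\<integral>\<^sup>+x\<in>?Q. ennreal (norm (dyadic_op j f x - cj j)) \<partial>lborel) \<le> ennreal ((C1 + C2) * (l ^ ?n * scale_gain j l)) * maximal f x0"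
      proof (cases "2 ^ j * l \<le> 1")
        case True
        then have "(\<integral>\<^sup>+x\<in>?Q. ennreal (norm (dyadic_op j f x - cj j)) \<partial>lborel) \<le> ennreal (C2 * (l ^ ?n * scale_gain j l)) * maximal f x0"
          using C2(2)[OF f l _ x0, of j] by (simp add: cj_def scale_gain_def)
        also have "\<dots> \<le> ennreal ((C1 + C2) * (l ^ ?n * scale_gain j l)) * maximal f x0"
          using C1(1) l g0 by (intro mult_right_mono ennreal_leI) auto
        finally show ?thesis .
      next
        case False
        then have "(\<integral>\<^sup>+x\<in>?Q. ennreal (norm (dyadic_op j f x - cj j)) \<partial>lborel) \<le> ennreal (C1 * (l ^ ?n * scale_gain j l)) * maximal f x0"
          using C1(2)[OF _ l x0, of f j] by (simp add: cj_def scale_gain_def)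
        also have "\<dots> \<le> ennreal ((C1 + C2) * (l ^ ?n * scale_gain j l)) * maximal f x0"
          using C2(1) l g0 by (intro mult_right_mono ennreal_leI) auto
        finally show ?thesis .
      qed
      also have "(C1 + C2) * (l ^ ?n * scale_gain j l) = scale_gain j l * ((C1 + C2) * l ^ ?n)" by (simp only: mult_ac)
      also have "ennreal (scale_gain j l * ((C1 + C2) * l ^ ?n)) = ennreal (scale_gain j l) * ennreal ((C1 + C2) * l ^ ?n)"
        using g0 by (rule ennreal_mult')
      finally show ?thesis by (simp only: mult.assoc)
    qed
    let ?c = "\<Sum>j\<in>{j. 2 ^ j * l \<le> 1}. dyadic_op j f x0"
    have "(\<integral>\<^sup>+x\<in>?Q. ennreal (norm (dyadic_sum f x - ?c)) \<partial>lborel) \<le> (\<integral>\<^sup>+x. (\<Sum>j. ennreal (norm (dyadic_op j f x - cj j)) * indicator ?Q x) \<partial>lborel)"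
    proof (rule nn_integral_mono_AE)
      show "AE x in lborel. ennreal (norm (dyadic_sum f x - ?c)) * indicator ?Q x \<le> (\<Sum>j. ennreal (norm (dyadic_op j f x - cj j)) * indicator ?Q x)"
        using dyadic_op_summable_AE[OF f]
      proof eventually_elim
        case (elim x)
        have s: "summable (\<lambda>j. norm (dyadic_op j f x - cj j))"
          by (rule summable_comparison_test[OF _ summable_add[OF elim cn']]) (auto intro!: exI[of _ 0] norm_triangle_ineq4)
        have "dyadic_sum f x - ?c = (\<Sum>j. dyadic_op j f x - cj j)"
          unfolding dyadic_sum_def cs(2)[symmetric] by (rule suminf_diff[OF summable_norm_cancel[OF elim] cs(1)])
        then have "norm (dyadic_sum f x - ?c) \<le> (\<Sum>j. norm (dyadic_op j f x - cj j))" using summable_norm[OF s] by simp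
        then have "ennreal (norm (dyadic_sum f x - ?c)) \<le> (\<Sum>j. ennreal (norm (dyadic_op j f x - cj j)))"
          using s by (subst suminf_ennreal2) (auto intro!: ennreal_leI)
        then show ?case by (auto simp: indicator_def)
      qed
    qed
    also have "\<dots> = (\<Sum>j. \<integral>\<^sup>+x\<in>?Q. ennreal (norm (dyadic_op j f x - cj j)) \<partial>lborel)"
      by (rule nn_integral_suminf) measurable
    also have "\<dots> \<le> (\<Sum>j. ennreal (scale_gain j l) * (ennreal ((C1 + C2) * l ^ ?n) * maximal f x0))"
      by (intro suminf_le each) auto
    also have "\<dots> = (\<Sum>j. ennreal (scale_gain j l)) * (ennreal ((C1 + C2) * l ^ ?n) * maximal f x0)"
      by (rule ennreal_suminf_multc)
    also have "\<dots> \<le> ennreal B * (ennreal ((C1 + C2) * l ^ ?n) * maximal f x0)"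
      unfolding B_def by (intro mult_right_mono suminf_scale_gain l) auto
    also have "\<dots> = ennreal ((C1 + C2) * B * l ^ ?n) * maximal f x0"
    proof -
      have "ennreal (B * ((C1 + C2) * l ^ ?n)) = ennreal B * ennreal ((C1 + C2) * l ^ ?n)" using B by (rule ennreal_mult')
      moreover have "(C1 + C2) * B * l ^ ?n = B * ((C1 + C2) * l ^ ?n)" by (simp only: mult_ac)
      ultimately show ?thesis by (simp only: mult.assoc)
    qed
    finally show "\<exists>c. (\<integral>\<^sup>+x\<in>?Q. ennreal (norm (dyadic_sum f x - c)) \<partial>lborel) \<le> ennreal ((C1 + C2) * B * l ^ ?n) * maximal f x0" by blast
  qed
qed

text \<open>In \<open>dyadic_sum_cube\<close> the point x0 may be any point of the cube, so the
  estimate holds at every x. The function u enters only through integrals, so equality almost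
  everywhere is enough.\<close>

lemma sharp_maximal_dyadic_sum:
  "\<exists>C\<ge>0. \<forall>f u x. integrable lborel f \<longrightarrow> (AE y in lborel. u y = dyadic_sum f y) \<longrightarrow> sharp_maximal u x \<le> ennreal C * maximal f x"
proof -
  obtain C where C: "0 \<le> C" "\<And>f p l x0. integrable lborel f \<Longrightarrow> 0 < l \<Longrightarrow> x0 \<in> cbox p (p + (\<chi> i. l)) \<Longrightarrow>
    (\<exists>c. (\<integral>\<^sup>+x\<in>cbox p (p + (\<chi> i. l)). ennreal (norm (dyadic_sum f x - c)) \<partial>lborel) \<le> ennreal (C * l ^ CARD('n)) * maximal f x0)"
    using dyadic_sum_cube by blast
  show ?thesis
  proof (intro exI conjI allI impI)
    show "0 \<le> C" by fact
    fix f u :: "real^'n \<Rightarrow> complex" and x assume f: "integrable lborel f" and u: "AE y in lborel. u y = dyadic_sum f y"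
    show "sharp_maximal u x \<le> ennreal C * maximal f x"
      unfolding sharp_maximal_def
    proof (rule SUP_least)
      fix Q assume "Q \<in> cubes_through x"
      then obtain p l where l: "0 < l" and Q: "Q = cbox p (p + (\<chi> i. l))" and x: "x \<in> cbox p (p + (\<chi> i. l))"
        by (auto simp: cubes_through_def)
      obtain c where c: "(\<integral>\<^sup>+x\<in>Q. ennreal (norm (dyadic_sum f x - c)) \<partial>lborel) \<le> ennreal (C * l ^ CARD('n)) * maximal f x"
        using C(2)[OF f l x] unfolding Q by blast
      have "cube_mean Q (\<lambda>y. u y - c) = (\<integral>\<^sup>+x\<in>Q. ennreal (norm (u x - c)) \<partial>lborel) / ennreal (l ^ CARD('n))"
        unfolding cube_mean_def nn_integral_completion using emeasure_cube[of l p] l by (simp add: Q)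
      also have "(\<integral>\<^sup>+x\<in>Q. ennreal (norm (u x - c)) \<partial>lborel) = (\<integral>\<^sup>+x\<in>Q. ennreal (norm (dyadic_sum f x - c)) \<partial>lborel)"
        by (rule nn_integral_cong_AE) (use u in eventually_elim, simp)
      also have "\<dots> / ennreal (l ^ CARD('n)) \<le> (ennreal (C * l ^ CARD('n)) * maximal f x) / ennreal (l ^ CARD('n))"
        by (rule divide_right_mono_ennreal[OF c])
      also have "\<dots> = ennreal C * maximal f x"
      proof -
        have "ennreal (C * l ^ CARD('n)) * maximal f x = (ennreal C * maximal f x) * ennreal (l ^ CARD('n))"
          using C(1) by (simp only: ennreal_mult' mult_ac)
        then show ?thesis using l by (simp add: mult_divide_eq_ennreal)
      qed
      finally show "(INF c. cube_mean Q (\<lambda>y. u y - c)) \<le> ennreal C * maximal f x"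
        by (intro INF_lower2[of c]) auto
    qed
  qed
qed

end

section \<open>The pieces on the Fourier side and their pairing with test functions\<close>

lemma dyadic_cut_integrable_bound:
  fixes i :: "'n::finite"
  assumes "symb \<rho> i N A \<mu> b" "\<rho> \<le> 1" "- \<mu> \<le> 2 * real M"
  shows "\<exists>D\<ge>0. \<forall>b. symb \<rho> i N A \<mu> b \<longrightarrow> (\<forall>\<xi>. norm (b \<xi> * dyadic_cut M j \<xi>) \<le> D * japanese \<xi> powr (- 2 * real CARD('n)))"
proof -
  let ?s = "- 2 * real CARD('n) - \<mu>"
  obtain C where C: "0 \<le> C" "\<And>j b. symb \<rho> i N A \<mu> b \<Longrightarrow> symb \<rho> i N (C * (2 ^ j) powr (- ?s)) (\<mu> + ?s) (\<lambda>\<xi>. b \<xi> * dyadic_cut M j \<xi>)"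
    using symb_mult_dyadic_cut[of \<rho> ?s M i N A \<mu>] assms by force
  show ?thesis
  proof (intro exI conjI allI impI)
    show "0 \<le> C * (2 ^ j) powr (- ?s)" using C by simp
    fix b \<xi> assume "symb \<rho> i N A \<mu> b"
    from symb_bound[OF C(2)[OF this, of j], of \<xi>]
    show "norm (b \<xi> * dyadic_cut M j \<xi>) \<le> C * (2 ^ j) powr (- ?s) * japanese \<xi> powr (- 2 * real CARD('n))" by simp
  qed
qed

context good_family begin

text \<open>The counterpart of \<open>adjoint_fourier\<close> for the Borel version, over
  \<open>lborel\<close> instead of its completion.\<close>

definition adj_symbol :: "(real^'n \<Rightarrow> complex) \<Rightarrow> real^'n \<Rightarrow> complex" where
  "adj_symbol f \<xi> = (LINT y|lborel. exp (- \<i> * complex_of_real (y \<bullet> \<xi>)) * a y \<xi> * f y)"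

lemma adj_symbol_measurable [measurable (raw)]:
  assumes [measurable]: "f \<in> borel_measurable borel"
  shows "adj_symbol f \<in> borel_measurable borel"
  unfolding adj_symbol_def by measurable

lemma a_symb: "symb \<rho> i num_derivs A m (a y)"
  using a_good by (simp add: good_def)

lemma A_nonneg: "0 \<le> A"
  using symb_nonneg[OF a_symb] .

lemma norm_a_le: "norm (a y \<xi>) \<le> A"
proof -
  have "norm (a y \<xi>) \<le> A * japanese \<xi> powr m" by (rule symb_bound[OF a_symb])
  also have "\<dots> \<le> A * japanese \<xi> powr 0" using \<rho> A_nonneg by (intro mult_left_mono japanese_powr_mono) (auto simp: m_def mult_nonneg_nonneg)
  finally show ?thesis by simp
qed

lemma norm_adj_symbol_le:
  assumes f: "integrable lborel f"
  shows "norm (adj_symbol f \<xi>) \<le> A * (LINT y|lborel. norm (f y))"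
proof -
  have "norm (adj_symbol f \<xi>) \<le> (LINT y|lborel. norm (exp (- \<i> * complex_of_real (y \<bullet> \<xi>)) * a y \<xi> * f y))"
    unfolding adj_symbol_def by (rule integral_norm_bound)
  also have "\<dots> \<le> (LINT y|lborel. A * norm (f y))"
  proof (rule integral_mono')
    show "integrable lborel (\<lambda>y. A * norm (f y))" using f by simp
    show "norm (exp (- \<i> * complex_of_real (y \<bullet> \<xi>)) * a y \<xi> * f y) \<le> A * norm (f y)" for y
      using norm_a_le by (auto simp: norm_mult intro!: mult_right_mono)
    show "0 \<le> A * norm (f y)" for y using A_nonneg by simp
  qed
  finally show ?thesis by simp
qed

text \<open>The cut supplies decay of order -2n in \<xi>, so the double integral in y and \<xi>
  converges absolutely and Fubini applies. The bare order -n(1 - \<rho>), which is above -n, does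
  not give this.\<close>

lemma dyadic_cut_adj_symbol_integrable:
  assumes f: "integrable lborel f"
  shows "integrable lborel (\<lambda>\<xi>. dyadic_cut num_derivs j \<xi> * adj_symbol f \<xi>)"
    and "dyadic_op j f x = complex_of_real inv_const * FT (\<lambda>\<xi>. dyadic_cut num_derivs j \<xi> * adj_symbol f \<xi>) x"
proof -
  have [measurable]: "f \<in> borel_measurable borel" using f by auto
  \<comment> \<open>\<open>D\<close> does not depend on the symbol, so one bound serves every
    y.\<close>
  obtain D where D: "0 \<le> D" "\<And>b \<xi>. symb \<rho> (undefined::'n) num_derivs A m b \<Longrightarrow> norm (b \<xi> * dyadic_cut num_derivs j \<xi>) \<le> D * japanese \<xi> powr (- 2 * real CARD('n))"
    using dyadic_cut_integrable_bound[OF a_symb[of undefined], where M=num_derivs and j=j] \<rho> M_le by force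
  have int: "integrable (lborel \<Otimes>\<^sub>M lborel) (\<lambda>(y, \<xi>). exp (\<i> * complex_of_real ((x - y) \<bullet> \<xi>)) * (a y \<xi> * dyadic_cut num_derivs j \<xi>) * f y)" for x
  proof (rule Bochner_Integration.integrable_bound)
    show "integrable (lborel \<Otimes>\<^sub>M lborel) (\<lambda>p. f (fst p) * complex_of_real (D * japanese (snd p :: real^'n) powr (- 2 * real CARD('n))))"
      by (rule integrable_prod_tensor[OF f]) (intro integrable_of_real integrable_mult_right integrable_japanese_powr)
    show "AE p in lborel \<Otimes>\<^sub>M lborel. norm (case p of (y, \<xi>) \<Rightarrow> exp (\<i> * complex_of_real ((x - y) \<bullet> \<xi>)) * (a y \<xi> * dyadic_cut num_derivs j \<xi>) * f y)
      \<le> norm (f (fst p) * complex_of_real (D * japanese (snd p) powr (- 2 * real CARD('n))))"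
    proof (rule AE_I2)
      fix p :: "(real^'n) \<times> (real^'n)"
      have "norm (a (fst p) (snd p) * dyadic_cut num_derivs j (snd p)) * norm (f (fst p)) \<le> (D * japanese (snd p) powr (- 2 * real CARD('n))) * norm (f (fst p))"
        by (intro mult_right_mono D(2) a_symb) simp
      moreover have "norm (complex_of_real (D * japanese (snd p) powr (- 2 * real CARD('n)))) = D * japanese (snd p) powr (- 2 * real CARD('n))"
        using D(1) by (simp only: norm_of_real) simp
      ultimately show "norm (case p of (y, \<xi>) \<Rightarrow> exp (\<i> * complex_of_real ((x - y) \<bullet> \<xi>)) * (a y \<xi> * dyadic_cut num_derivs j \<xi>) * f y)
      \<le> norm (f (fst p) * complex_of_real (D * japanese (snd p) powr (- 2 * real CARD('n))))"
        by (simp only: case_prod_beta norm_mult[of _ "f _"] norm_mult[of "exp _"] norm_mult[of "f _"] norm_exp_i_times mult_1 mult.commute[of _ "norm (f _)"])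
    qed
  qed measurable
  have inner: "(LINT y|lborel. exp (\<i> * complex_of_real ((x - y) \<bullet> \<xi>)) * (a y \<xi> * dyadic_cut num_derivs j \<xi>) * f y) = exp (\<i> * complex_of_real (x \<bullet> \<xi>)) * (dyadic_cut num_derivs j \<xi> * adj_symbol f \<xi>)" for x \<xi>
  proof -
    have "(LINT y|lborel. exp (\<i> * complex_of_real ((x - y) \<bullet> \<xi>)) * (a y \<xi> * dyadic_cut num_derivs j \<xi>) * f y)
      = (LINT y|lborel. (exp (\<i> * complex_of_real (x \<bullet> \<xi>)) * dyadic_cut num_derivs j \<xi>) * (exp (- \<i> * complex_of_real (y \<bullet> \<xi>)) * a y \<xi> * f y))"
    proof (rule Bochner_Integration.integral_cong[OF refl])
      fix y
      have "exp (\<i> * complex_of_real ((x - y) \<bullet> \<xi>)) = exp (\<i> * complex_of_real (x \<bullet> \<xi>)) * exp (- \<i> * complex_of_real (y \<bullet> \<xi>))"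
        by (simp add: inner_diff_left algebra_simps flip: exp_add)
      then show "exp (\<i> * complex_of_real ((x - y) \<bullet> \<xi>)) * (a y \<xi> * dyadic_cut num_derivs j \<xi>) * f y = (exp (\<i> * complex_of_real (x \<bullet> \<xi>)) * dyadic_cut num_derivs j \<xi>) * (exp (- \<i> * complex_of_real (y \<bullet> \<xi>)) * a y \<xi> * f y)"
        by (simp only: mult_ac)
    qed
    also have "\<dots> = (exp (\<i> * complex_of_real (x \<bullet> \<xi>)) * dyadic_cut num_derivs j \<xi>) * adj_symbol f \<xi>"
      unfolding adj_symbol_def by (rule integral_mult_right_zero)
    finally show ?thesis by (simp only: mult.assoc)
  qed
  \<comment> \<open>At x = 0 the phase is trivial, which isolates the integrability claim.\<close>
  have int0: "integrable lborel (\<lambda>\<xi>. exp (\<i> * complex_of_real (0 \<bullet> \<xi>)) * (dyadic_cut num_derivs j \<xi> * adj_symbol f \<xi>))"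
    using lborel_pair.integrable_snd[OF int[of 0]] unfolding inner .
  then show "integrable lborel (\<lambda>\<xi>. dyadic_cut num_derivs j \<xi> * adj_symbol f \<xi>)" by simp
  have "(LINT y|lborel. dyadic_ker j (a y) (x - y) * f y) = (LINT y|lborel. LINT \<xi>|lborel. exp (\<i> * complex_of_real ((x - y) \<bullet> \<xi>)) * (a y \<xi> * dyadic_cut num_derivs j \<xi>) * f y)"
    unfolding dyadic_ker_def FT_def by (simp only: integral_mult_left_zero)
  also have "\<dots> = (LINT \<xi>|lborel. LINT y|lborel. exp (\<i> * complex_of_real ((x - y) \<bullet> \<xi>)) * (a y \<xi> * dyadic_cut num_derivs j \<xi>) * f y)"
    by (rule lborel_pair.Fubini_integral[OF int, symmetric])
  also have "\<dots> = FT (\<lambda>\<xi>. dyadic_cut num_derivs j \<xi> * adj_symbol f \<xi>) x"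
    unfolding inner FT_def ..
  finally show "dyadic_op j f x = complex_of_real inv_const * FT (\<lambda>\<xi>. dyadic_cut num_derivs j \<xi> * adj_symbol f \<xi>) x"
    by (simp only: dyadic_op_def inv_const_def)
qed

end

lemma FT_adjoint:
  fixes g h :: "real^'n::finite \<Rightarrow> complex"
  assumes g: "integrable lborel g" and h: "integrable lborel h"
  shows "(LINT x|lborel. FT g x * h x) = (LINT \<xi>|lborel. g \<xi> * FT h \<xi>)"
proof -
  have [measurable]: "g \<in> borel_measurable borel" "h \<in> borel_measurable borel" using g h by auto
  have int: "integrable (lborel \<Otimes>\<^sub>M lborel) (\<lambda>(x, \<xi>). exp (\<i> * complex_of_real (x \<bullet> \<xi>)) * g \<xi> * h x)"
    by (rule Bochner_Integration.integrable_bound[OF integrable_prod_tensor[OF h g]])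
       (auto simp: norm_mult case_prod_beta)
  have "(LINT x|lborel. FT g x * h x) = (LINT x|lborel. LINT \<xi>|lborel. exp (\<i> * complex_of_real (x \<bullet> \<xi>)) * g \<xi> * h x)"
    unfolding FT_def by (simp only: integral_mult_left_zero)
  also have "\<dots> = (LINT \<xi>|lborel. LINT x|lborel. exp (\<i> * complex_of_real (x \<bullet> \<xi>)) * g \<xi> * h x)"
    by (rule lborel_pair.Fubini_integral[OF int, symmetric])
  also have "\<dots> = (LINT \<xi>|lborel. LINT x|lborel. g \<xi> * (exp (\<i> * complex_of_real (\<xi> \<bullet> x)) * h x))"
    by (simp only: mult_ac inner_commute)
  also have "\<dots> = (LINT \<xi>|lborel. g \<xi> * FT h \<xi>)"
    unfolding FT_def by (simp only: integral_mult_right_zero)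
  finally show ?thesis .
qed

text \<open>The identity is first proved for partial sums, where \<open>FT_adjoint\<close> applies
  piece by piece. On the Fourier side they telescope to a low-pass factor that is bounded by 2 and
  tends to 1; on the other side \<open>dyadic_sum_abs f\<close> times the bound of \<phi> dominates.
  Both limits in J are then instances of dominated convergence.\<close>

lemma (in good_family) dyadic_sum_pairing:
  assumes f: "integrable lborel f" and \<phi>: "integrable lborel \<phi>" and F\<phi>: "integrable lborel (FT \<phi>)"
    and B: "\<And>x. norm (\<phi> x) \<le> B"
  shows "(LINT \<xi>|lborel. adj_symbol f \<xi> * (complex_of_real inv_const * FT \<phi> \<xi>)) = (LINT x|lborel. dyadic_sum f x * \<phi> x)"
proof -
  have [measurable]: "f \<in> borel_measurable borel" "\<phi> \<in> borel_measurable borel" using f \<phi> by auto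
  have B0: "0 \<le> B" using order_trans[OF norm_ge_zero B] .
  have Tint: "integrable lborel (dyadic_op j f)" for j
  proof -
    have "integrable lborel (dyadic_sum_abs f)" by (rule dyadic_sum_abs_integrable[OF f])
    then show ?thesis
    proof (rule Bochner_Integration.integrable_bound)
      show "AE x in lborel. norm (dyadic_op j f x) \<le> norm (dyadic_sum_abs f x)"
        using dyadic_op_summable_AE[OF f]
      proof eventually_elim
        case (elim x)
        have "norm (dyadic_op j f x) = (\<Sum>k\<in>{j}. norm (dyadic_op k f x))" by simp
        also have "\<dots> \<le> dyadic_sum_abs f x" unfolding dyadic_sum_abs_def by (rule sum_le_suminf[OF elim]) auto
        finally show ?case by simp
      qed
    qed measurable
  qed
  have T\<phi>: "integrable lborel (\<lambda>x. dyadic_op j f x * \<phi> x)" for j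
  proof (rule Bochner_Integration.integrable_bound)
    show "integrable lborel (\<lambda>x. B * norm (dyadic_op j f x))" using Tint by simp
    show "AE x in lborel. norm (dyadic_op j f x * \<phi> x) \<le> norm (B * norm (dyadic_op j f x))"
      using B B0 by (intro AE_I2) (auto simp: norm_mult mult.commute intro!: mult_right_mono)
  qed measurable
  have AF: "integrable lborel (\<lambda>\<xi>. norm (FT \<phi> \<xi>) * (A * (LINT y|lborel. norm (f y))))" using F\<phi> by simp
  have piece: "(LINT \<xi>|lborel. dyadic_cut num_derivs j \<xi> * adj_symbol f \<xi> * (complex_of_real inv_const * FT \<phi> \<xi>)) = (LINT x|lborel. dyadic_op j f x * \<phi> x)" for j
  proof -
    have "(LINT x|lborel. dyadic_op j f x * \<phi> x) = (LINT x|lborel. complex_of_real inv_const * (FT (\<lambda>\<xi>. dyadic_cut num_derivs j \<xi> * adj_symbol f \<xi>) x * \<phi> x))"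
      by (simp only: dyadic_cut_adj_symbol_integrable(2)[OF f] mult.assoc)
    also have "\<dots> = complex_of_real inv_const * (LINT x|lborel. FT (\<lambda>\<xi>. dyadic_cut num_derivs j \<xi> * adj_symbol f \<xi>) x * \<phi> x)"
      by (rule integral_mult_right_zero)
    also have "\<dots> = complex_of_real inv_const * (LINT \<xi>|lborel. dyadic_cut num_derivs j \<xi> * adj_symbol f \<xi> * FT \<phi> \<xi>)"
      by (simp only: FT_adjoint[OF dyadic_cut_adj_symbol_integrable(1)[OF f] \<phi>])
    also have "\<dots> = (LINT \<xi>|lborel. complex_of_real inv_const * (dyadic_cut num_derivs j \<xi> * adj_symbol f \<xi> * FT \<phi> \<xi>))"
      by (rule integral_mult_right_zero[symmetric])
    finally show ?thesis by (simp only: mult_ac)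
  qed
  have Af1: "norm (adj_symbol f \<xi> * (complex_of_real inv_const * FT \<phi> \<xi>)) \<le> inv_const * (norm (FT \<phi> \<xi>) * (A * (LINT y|lborel. norm (f y))))" for \<xi>
  proof -
    have "norm (adj_symbol f \<xi> * (complex_of_real inv_const * FT \<phi> \<xi>)) = inv_const * (norm (FT \<phi> \<xi>) * norm (adj_symbol f \<xi>))"
      using inv_const_nonneg by (simp add: norm_mult)
    also have "\<dots> \<le> inv_const * (norm (FT \<phi> \<xi>) * (A * (LINT y|lborel. norm (f y))))"
      using inv_const_nonneg norm_adj_symbol_le[OF f] by (intro mult_left_mono) auto
    finally show ?thesis .
  qed
  have P: "integrable lborel (\<lambda>\<xi>. dyadic_cut num_derivs j \<xi> * adj_symbol f \<xi> * (complex_of_real inv_const * FT \<phi> \<xi>))" for j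
  proof (rule Bochner_Integration.integrable_bound)
    show "integrable lborel (\<lambda>\<xi>. 4 * (inv_const * (norm (FT \<phi> \<xi>) * (A * (LINT y|lborel. norm (f y))))))" using AF by simp
    show "AE \<xi> in lborel. norm (dyadic_cut num_derivs j \<xi> * adj_symbol f \<xi> * (complex_of_real inv_const * FT \<phi> \<xi>)) \<le> norm (4 * (inv_const * (norm (FT \<phi> \<xi>) * (A * (LINT y|lborel. norm (f y))))))"
    proof (rule AE_I2)
      fix \<xi> :: "real^'n"
      \<comment> \<open>At most two low-pass factors occur, each of modulus at most 2.\<close>
      have "norm (dyadic_cut num_derivs j \<xi>) \<le> 4"
        using norm_low_pass_le[of num_derivs "2 ^ j" \<xi>] norm_low_pass_le[of num_derivs "2 ^ (j - 1)" \<xi>] norm_low_pass_le[of num_derivs 1 \<xi>]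
          norm_triangle_ineq4[of "low_pass num_derivs (2 ^ j) \<xi>" "low_pass num_derivs (2 ^ (j - 1)) \<xi>"]
        unfolding dyadic_cut_def by (auto split: if_splits)
      then have "norm (dyadic_cut num_derivs j \<xi>) * norm (adj_symbol f \<xi> * (complex_of_real inv_const * FT \<phi> \<xi>)) \<le> 4 * (inv_const * (norm (FT \<phi> \<xi>) * (A * (LINT y|lborel. norm (f y)))))"
        by (intro mult_mono Af1) auto
      then show "norm (dyadic_cut num_derivs j \<xi> * adj_symbol f \<xi> * (complex_of_real inv_const * FT \<phi> \<xi>)) \<le> norm (4 * (inv_const * (norm (FT \<phi> \<xi>) * (A * (LINT y|lborel. norm (f y))))))"
        by (simp only: norm_mult mult.assoc real_norm_def)
    qed
  qed measurable
  have partial: "(LINT \<xi>|lborel. low_pass num_derivs (2 ^ J) \<xi> * (adj_symbol f \<xi> * (complex_of_real inv_const * FT \<phi> \<xi>))) = (LINT x|lborel. (\<Sum>j\<le>J. dyadic_op j f x) * \<phi> x)" for J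
  proof -
    have "(LINT \<xi>|lborel. low_pass num_derivs (2 ^ J) \<xi> * (adj_symbol f \<xi> * (complex_of_real inv_const * FT \<phi> \<xi>))) = (LINT \<xi>|lborel. (\<Sum>j\<le>J. dyadic_cut num_derivs j \<xi> * adj_symbol f \<xi> * (complex_of_real inv_const * FT \<phi> \<xi>)))"
      by (simp only: sum_dyadic_cut[symmetric] sum_distrib_right mult.assoc)
    also have "\<dots> = (\<Sum>j\<le>J. LINT \<xi>|lborel. dyadic_cut num_derivs j \<xi> * adj_symbol f \<xi> * (complex_of_real inv_const * FT \<phi> \<xi>))"
      by (rule Bochner_Integration.integral_sum) (rule P)
    also have "\<dots> = (\<Sum>j\<le>J. LINT x|lborel. dyadic_op j f x * \<phi> x)" by (simp only: piece)
    also have "\<dots> = (LINT x|lborel. (\<Sum>j\<le>J. dyadic_op j f x * \<phi> x))"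
      by (rule Bochner_Integration.integral_sum[symmetric]) (rule T\<phi>)
    finally show ?thesis by (simp only: sum_distrib_right)
  qed
  have L1: "(\<lambda>J. LINT \<xi>|lborel. low_pass num_derivs (2 ^ J) \<xi> * (adj_symbol f \<xi> * (complex_of_real inv_const * FT \<phi> \<xi>))) \<longlonglongrightarrow> (LINT \<xi>|lborel. adj_symbol f \<xi> * (complex_of_real inv_const * FT \<phi> \<xi>))"
  proof (rule integral_dominated_convergence[where w="\<lambda>\<xi>. 2 * (inv_const * (norm (FT \<phi> \<xi>) * (A * (LINT y|lborel. norm (f y)))))"])
    show "integrable lborel (\<lambda>\<xi>. 2 * (inv_const * (norm (FT \<phi> \<xi>) * (A * (LINT y|lborel. norm (f y))))))" using AF by simp
    show "AE \<xi> in lborel. (\<lambda>J. low_pass num_derivs (2 ^ J) \<xi> * (adj_symbol f \<xi> * (complex_of_real inv_const * FT \<phi> \<xi>))) \<longlonglongrightarrow> adj_symbol f \<xi> * (complex_of_real inv_const * FT \<phi> \<xi>)"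
    proof (rule AE_I2)
      fix \<xi> :: "real^'n"
      have "(\<lambda>J. low_pass num_derivs (2 ^ J) \<xi> * (adj_symbol f \<xi> * (complex_of_real inv_const * FT \<phi> \<xi>))) \<longlonglongrightarrow> 1 * (adj_symbol f \<xi> * (complex_of_real inv_const * FT \<phi> \<xi>))"
        by (intro tendsto_mult tendsto_const low_pass_tendsto) (simp add: num_derivs_def)
      then show "(\<lambda>J. low_pass num_derivs (2 ^ J) \<xi> * (adj_symbol f \<xi> * (complex_of_real inv_const * FT \<phi> \<xi>))) \<longlonglongrightarrow> adj_symbol f \<xi> * (complex_of_real inv_const * FT \<phi> \<xi>)" by simp
    qed
    show "AE \<xi> in lborel. norm (low_pass num_derivs (2 ^ J) \<xi> * (adj_symbol f \<xi> * (complex_of_real inv_const * FT \<phi> \<xi>))) \<le> 2 * (inv_const * (norm (FT \<phi> \<xi>) * (A * (LINT y|lborel. norm (f y)))))" for J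
      unfolding norm_mult[of "low_pass _ _ _"] by (intro AE_I2 mult_mono Af1 norm_low_pass_le) auto
  qed measurable
  have L2: "(\<lambda>J. LINT x|lborel. (\<Sum>j\<le>J. dyadic_op j f x) * \<phi> x) \<longlonglongrightarrow> (LINT x|lborel. dyadic_sum f x * \<phi> x)"
  proof (rule integral_dominated_convergence[where w="\<lambda>x. dyadic_sum_abs f x * B"])
    show "integrable lborel (\<lambda>x. dyadic_sum_abs f x * B)" using dyadic_sum_abs_integrable[OF f] by simp
    show "AE x in lborel. (\<lambda>J. (\<Sum>j\<le>J. dyadic_op j f x) * \<phi> x) \<longlonglongrightarrow> dyadic_sum f x * \<phi> x"
      using dyadic_op_summable_AE[OF f]
    proof eventually_elim
      case (elim x)
      have "(\<lambda>J. \<Sum>j\<le>J. dyadic_op j f x) \<longlonglongrightarrow> dyadic_sum f x"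
        unfolding dyadic_sum_def by (rule summable_LIMSEQ'[OF summable_norm_cancel[OF elim]])
      then show ?case by (intro tendsto_mult tendsto_const)
    qed
    show "AE x in lborel. norm ((\<Sum>j\<le>J. dyadic_op j f x) * \<phi> x) \<le> dyadic_sum_abs f x * B" for J
      using dyadic_op_summable_AE[OF f]
    proof eventually_elim
      case (elim x)
      have "norm (\<Sum>j\<le>J. dyadic_op j f x) \<le> (\<Sum>j\<le>J. norm (dyadic_op j f x))" by (rule norm_sum)
      also have "\<dots> \<le> dyadic_sum_abs f x" unfolding dyadic_sum_abs_def by (rule sum_le_suminf[OF elim]) auto
      finally have "norm (\<Sum>j\<le>J. dyadic_op j f x) \<le> dyadic_sum_abs f x" .
      moreover have "0 \<le> dyadic_sum_abs f x" using calculation norm_ge_zero order_trans by blast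
      ultimately show ?case unfolding norm_mult by (intro mult_mono B) auto
    qed
  qed measurable
  show ?thesis using LIMSEQ_unique[OF L1] L2 unfolding partial by blast
qed

section \<open>Test functions\<close>

text \<open>Functions of this shape, with \<open>s\<close> and \<open>k\<close> fixed, are closed under differentiation.\<close>

definition bump1 :: "real \<Rightarrow> real poly \<Rightarrow> real poly \<Rightarrow> nat \<Rightarrow> real \<Rightarrow> real" where
  "bump1 k s p N t = (if poly s t > 0 then poly p t / poly s t ^ N * exp (- (1 / (k * poly s t))) else 0)"

text \<open>Numerator of the derivative over the common denominator \<open>s ^ (N + 2)\<close>: the
  three terms come from p, from the power of s, and from the exponent -1/(k s).\<close>

definition bump1_num :: "real \<Rightarrow> real poly \<Rightarrow> real poly \<Rightarrow> nat \<Rightarrow> real poly" where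
  "bump1_num k s p N = pderiv p * s ^ 2 - smult (real N) (p * pderiv s * s) + smult (1 / k) (p * pderiv s)"

lemma inverse_powr_minus:
  assumes "0 < (v::real)"
  shows "(1 / v) powr (- real n) = v ^ n"
proof -
  have "(1 / v) powr (- real n) = inverse ((1 / v) ^ n)"
    unfolding powr_minus using assms by (subst powr_realpow) auto
  then show ?thesis by (simp add: power_one_over inverse_eq_divide)
qed

text \<open>The exponential beats the pole: N powers of s cancel the denominator, and two more are
  kept to make the function differentiable at the zeros of s.\<close>

lemma bump1_le:
  assumes k: "0 < k"
  shows "\<exists>C\<ge>0. \<forall>t. \<bar>bump1 k s p N t\<bar> \<le> C * \<bar>poly p t\<bar> * (max 0 (poly s t))\<^sup>2"
proof -
  obtain C where C: "C \<ge> 0" "\<And>u. 0 < u \<Longrightarrow> exp (- u) \<le> C * u powr (- real (N + 2))"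
    using exp_le_powr[of "real (N + 2)"] by auto
  show ?thesis
  proof (intro exI conjI allI)
    show "0 \<le> C * k ^ (N + 2)" using C k by simp
    fix t
    show "\<bar>bump1 k s p N t\<bar> \<le> C * k ^ (N + 2) * \<bar>poly p t\<bar> * (max 0 (poly s t))\<^sup>2"
    proof (cases "poly s t > 0")
      case True
      let ?s = "poly s t"
      have "exp (- (1 / (k * ?s))) \<le> C * (1 / (k * ?s)) powr (- real (N + 2))" using True k by (intro C(2)) simp
      also have "(1 / (k * ?s)) powr (- real (N + 2)) = (k * ?s) ^ (N + 2)"
        by (rule inverse_powr_minus) (use True k in simp)
      finally have e: "exp (- (1 / (k * ?s))) \<le> C * (k * ?s) ^ (N + 2)" .
      have "\<bar>bump1 k s p N t\<bar> = \<bar>poly p t\<bar> / ?s ^ N * exp (- (1 / (k * ?s)))"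
        using True by (simp add: bump1_def abs_mult)
      also have "\<dots> \<le> \<bar>poly p t\<bar> / ?s ^ N * (C * (k * ?s) ^ (N + 2))"
        using True by (intro mult_left_mono e) auto
      also have "\<dots> = C * k ^ (N + 2) * \<bar>poly p t\<bar> * ?s\<^sup>2"
        using True by (simp add: power_mult_distrib power_add power2_eq_square field_simps)
      finally show ?thesis using True by simp
    qed (use C k in \<open>simp add: bump1_def\<close>)
  qed
qed

lemma bump1_deriv:
  assumes k: "0 < k"
  shows "(bump1 k s p N has_real_derivative bump1 k s (bump1_num k s p N) (N + 2) t) (at t)"
proof (cases "poly s t > 0")
  case True
  let ?f = "\<lambda>t. poly p t / poly s t ^ N * exp (- (1 / (k * poly s t)))"
  have op: "open {t. poly s t > 0}" by (intro open_Collect_less continuous_intros)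
  have s0: "poly s t \<noteq> 0" using True by simp
  have d: "(?f has_real_derivative
     ((poly (pderiv p) t * poly s t ^ N - poly p t * (real N * poly s t ^ (N - 1) * poly (pderiv s) t)) / (poly s t ^ N * poly s t ^ N)) * exp (- (1 / (k * poly s t)))
      + poly p t / poly s t ^ N * (exp (- (1 / (k * poly s t))) * (poly (pderiv s) t / (k * (poly s t)\<^sup>2)))) (at t)"
    using s0 k
    by (auto intro!: derivative_eq_intros simp: power2_eq_square field_simps)
  have N1: "real N * poly s t ^ (N - 1) * poly s t = real N * poly s t ^ N"
    by (cases N) auto
  have "((poly (pderiv p) t * poly s t ^ N - poly p t * (real N * poly s t ^ (N - 1) * poly (pderiv s) t)) / (poly s t ^ N * poly s t ^ N)) * exp (- (1 / (k * poly s t)))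
      + poly p t / poly s t ^ N * (exp (- (1 / (k * poly s t))) * (poly (pderiv s) t / (k * (poly s t)\<^sup>2)))
    = bump1 k s (bump1_num k s p N) (N + 2) t"
  proof -
    let ?S = "poly s t" and ?P = "poly p t" and ?S' = "poly (pderiv s) t" and ?P' = "poly (pderiv p) t" and ?E = "exp (- (1 / (k * poly s t)))"
    have "real N * ?S ^ (N - 1) = real N * ?S ^ N / ?S" using N1 s0 by (simp add: field_simps)
    then have eq1: "(?P' * ?S ^ N - ?P * (real N * ?S ^ (N - 1) * ?S')) / (?S ^ N * ?S ^ N) = (?P' * ?S - real N * ?P * ?S') / ?S / ?S ^ N"
      using s0 by (cases N) (simp_all add: field_simps)
    have "u / c * e + v / c * (e * (q / d)) = (u + v * q / d) / c * e" for u c e v q d :: real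
      by (simp add: add_divide_distrib algebra_simps)
    then have "((?P' * ?S ^ N - ?P * (real N * ?S ^ (N - 1) * ?S')) / (?S ^ N * ?S ^ N)) * ?E + ?P / ?S ^ N * (?E * (?S' / (k * ?S\<^sup>2)))
       = ((?P' * ?S - real N * ?P * ?S') / ?S + ?P * ?S' / (k * ?S\<^sup>2)) / ?S ^ N * ?E"
      unfolding eq1 by this
    also have "(?P' * ?S - real N * ?P * ?S') / ?S + ?P * ?S' / (k * ?S\<^sup>2) = (?P' * ?S\<^sup>2 - real N * (?P * ?S' * ?S) + 1 / k * (?P * ?S')) / ?S\<^sup>2"
      using s0 k by (simp add: field_simps power2_eq_square)
    also have "?P' * ?S\<^sup>2 - real N * (?P * ?S' * ?S) + 1 / k * (?P * ?S') = poly (bump1_num k s p N) t"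
      by (simp add: bump1_num_def)
    also have "poly (bump1_num k s p N) t / ?S\<^sup>2 / ?S ^ N = poly (bump1_num k s p N) t / ?S ^ (N + 2)"
      by (simp only: divide_divide_eq_left power_add mult.commute)
    finally show ?thesis
      using True by (simp only: bump1_def if_True)
  qed
  with d have "(?f has_real_derivative bump1 k s (bump1_num k s p N) (N + 2) t) (at t)" by simp
  then show ?thesis
    by (rule has_field_derivative_transform_within_open[OF _ op]) (use True in \<open>auto simp: bump1_def\<close>)
next
  case False
  obtain C where C: "C \<ge> 0" "\<And>t. \<bar>bump1 k s p N t\<bar> \<le> C * \<bar>poly p t\<bar> * (max 0 (poly s t))\<^sup>2"
    using bump1_le[OF k] by blast
  \<comment> \<open>At a point with s t \<le> 0 the function vanishes, and a positive s y is at most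
    s y - s t. The square in \<open>bump1_le\<close> therefore leaves, beside the difference
    quotient of s, one factor that tends to 0.\<close>
  have "((\<lambda>y. (bump1 k s p N y - bump1 k s p N t) / (y - t)) \<longlongrightarrow> 0) (at t)"
  proof (rule Lim_null_comparison)
    show "\<forall>\<^sub>F y in at t. norm ((bump1 k s p N y - bump1 k s p N t) / (y - t)) \<le> C * \<bar>poly p y\<bar> * \<bar>poly s y - poly s t\<bar> * \<bar>(poly s y - poly s t) / (y - t)\<bar>"
    proof (rule always_eventually, rule allI)
      fix y
      have z: "bump1 k s p N t = 0" using False by (simp add: bump1_def)
      have "\<bar>bump1 k s p N y\<bar> \<le> C * \<bar>poly p y\<bar> * (max 0 (poly s y))\<^sup>2" by (rule C(2))
      also have "\<dots> \<le> C * \<bar>poly p y\<bar> * \<bar>poly s y - poly s t\<bar>\<^sup>2"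
        using C(1) False by (intro mult_left_mono power_mono) auto
      finally have "\<bar>bump1 k s p N y\<bar> / \<bar>y - t\<bar> \<le> C * \<bar>poly p y\<bar> * \<bar>poly s y - poly s t\<bar>\<^sup>2 / \<bar>y - t\<bar>"
        by (rule divide_right_mono) simp
      then show "norm ((bump1 k s p N y - bump1 k s p N t) / (y - t)) \<le> C * \<bar>poly p y\<bar> * \<bar>poly s y - poly s t\<bar> * \<bar>(poly s y - poly s t) / (y - t)\<bar>"
        by (simp add: z abs_divide power2_eq_square mult.assoc)
    qed
    have "((\<lambda>y. (poly s y - poly s t) / (y - t)) \<longlongrightarrow> poly (pderiv s) t) (at t)"
      using poly_DERIV[of s t] by (simp add: has_field_derivative_iff)
    moreover have "((\<lambda>y. poly s y) \<longlongrightarrow> poly s t) (at t)" "((\<lambda>y. poly p y) \<longlongrightarrow> poly p t) (at t)"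
    proof -
      have "isCont (poly s) t" "isCont (poly p) t" by simp_all
      then show "((\<lambda>y. poly s y) \<longlongrightarrow> poly s t) (at t)" "((\<lambda>y. poly p y) \<longlongrightarrow> poly p t) (at t)"
        by (simp_all only: isCont_def)
    qed
    ultimately have "((\<lambda>y. C * \<bar>poly p y\<bar> * \<bar>poly s y - poly s t\<bar> * \<bar>(poly s y - poly s t) / (y - t)\<bar>) \<longlongrightarrow> C * \<bar>poly p t\<bar> * \<bar>poly s t - poly s t\<bar> * \<bar>poly (pderiv s) t\<bar>) (at t)"
      by (intro tendsto_intros)
    then show "((\<lambda>y. C * \<bar>poly p y\<bar> * \<bar>poly s y - poly s t\<bar> * \<bar>(poly s y - poly s t) / (y - t)\<bar>) \<longlongrightarrow> 0) (at t)" by simp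
  qed
  then show ?thesis using False by (simp add: has_field_derivative_iff bump1_def)
qed

definition bump :: "real \<Rightarrow> ('n::finite \<Rightarrow> real poly) \<Rightarrow> ('n \<Rightarrow> real poly) \<Rightarrow> ('n \<Rightarrow> nat) \<Rightarrow> real^'n \<Rightarrow> complex" where
  "bump k s p N x = complex_of_real (\<Prod>i\<in>UNIV. bump1 k (s i) (p i) (N i) (x $ i))"

lemma bump_differentiable:
  fixes x :: "real^'n::finite"
  assumes k: "0 < k"
  shows "bump k s p N differentiable (at x)"
proof -
  have "(\<lambda>x. bump1 k (s i) (p i) (N i) (x $ i)) differentiable (at x)" for i and x :: "real^'n"
  proof -
    have "bump1 k (s i) (p i) (N i) differentiable (at (x $ i))"
      using bump1_deriv[OF k, of "s i" "p i" "N i" "x $ i"] unfolding has_field_derivative_def differentiable_def by blast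
    then have "bump1 k (s i) (p i) (N i) \<circ> (\<lambda>x. x $ i) differentiable (at x)"
      by (rule differentiable_chain_at[OF bounded_linear_imp_differentiable[OF bounded_linear_vec_nth]])
    then show ?thesis by (simp add: o_def)
  qed
  then have "\<forall>i. \<exists>D. ((\<lambda>x. bump1 k (s i) (p i) (N i) (x $ i)) has_derivative D) (at x)"
    unfolding differentiable_def by blast
  then obtain D where D: "\<And>i. ((\<lambda>x. bump1 k (s i) (p i) (N i) (x $ i)) has_derivative D i) (at x)" by metis
  have "((\<lambda>x. complex_of_real (\<Prod>i\<in>UNIV. bump1 k (s i) (p i) (N i) (x $ i))) has_derivative
      (\<lambda>y. complex_of_real (\<Sum>i\<in>UNIV. D i y * (\<Prod>j\<in>UNIV - {i}. bump1 k (s j) (p j) (N j) (x $ j))))) (at x)"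
    by (intro has_derivative_of_real has_derivative_prod D)
  then show ?thesis unfolding bump_def differentiable_def by blast
qed

text \<open>Only the j-th factor involves the coordinate being differentiated, so the family
  reproduces itself; iterating this gives smoothness.\<close>

lemma partial_deriv_bump:
  assumes k: "0 < k"
  shows "partial_deriv j (bump k s p N) = bump k s (p(j := bump1_num k (s j) (p j) (N j))) (N(j := N j + 2))"
proof
  fix x :: "real^'a"
  define R where "R = (\<Prod>i\<in>UNIV - {j}. bump1 k (s i) (p i) (N i) (x $ i))"
  have f: "bump k s p N (x + t *\<^sub>R axis j 1) = complex_of_real (bump1 k (s j) (p j) (N j) (x $ j + t) * R)" for t
  proof -
    have "(\<Prod>i\<in>UNIV. bump1 k (s i) (p i) (N i) ((x + t *\<^sub>R axis j 1) $ i)) = bump1 k (s j) (p j) (N j) (x $ j + t) * (\<Prod>i\<in>UNIV - {j}. bump1 k (s i) (p i) (N i) ((x + t *\<^sub>R axis j 1) $ i))"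
      by (subst prod.remove[of _ j]) (auto simp: axis_def)
    also have "(\<Prod>i\<in>UNIV - {j}. bump1 k (s i) (p i) (N i) ((x + t *\<^sub>R axis j 1) $ i)) = R"
      unfolding R_def by (intro prod.cong) (auto simp: axis_def)
    finally show ?thesis by (simp add: bump_def)
  qed
  have "((\<lambda>t. bump1 k (s j) (p j) (N j) (x $ j + t)) has_real_derivative bump1 k (s j) (bump1_num k (s j) (p j) (N j)) (N j + 2) (x $ j)) (at 0)"
    using bump1_deriv[OF k, of "s j" "p j" "N j" "x $ j"] DERIV_shift[of "bump1 k (s j) (p j) (N j)" _ 0 "x $ j"] by (simp add: add.commute)
  then have "((\<lambda>t. bump1 k (s j) (p j) (N j) (x $ j + t) * R) has_real_derivative bump1 k (s j) (bump1_num k (s j) (p j) (N j)) (N j + 2) (x $ j) * R) (at 0)"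
    by (rule DERIV_cmult_right)
  then have "((\<lambda>t. bump k s p N (x + t *\<^sub>R axis j 1)) has_vector_derivative complex_of_real (bump1 k (s j) (bump1_num k (s j) (p j) (N j)) (N j + 2) (x $ j) * R)) (at 0)"
    unfolding f by (simp add: has_vector_derivative_complex_iff)
  then have "partial_deriv j (bump k s p N) x = complex_of_real (bump1 k (s j) (bump1_num k (s j) (p j) (N j)) (N j + 2) (x $ j) * R)"
    unfolding partial_deriv_def by (rule vector_derivative_at)
  also have "\<dots> = bump k s (p(j := bump1_num k (s j) (p j) (N j))) (N(j := N j + 2)) x"
    unfolding bump_def R_def by (subst prod.remove[of UNIV j]) (auto intro!: prod.cong)
  finally show "partial_deriv j (bump k s p N) x = bump k s (p(j := bump1_num k (s j) (p j) (N j))) (N(j := N j + 2)) x" .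
qed

lemma bump_smooth:
  assumes k: "0 < k"
  shows "smooth_fun (bump k s p N)"
proof -
  have "\<exists>p' N'. foldr partial_deriv is (bump k s p N) = bump k s p' N'" for "is"
  proof (induction "is")
    case (Cons i "is")
    then show ?case by (metis foldr.simps(2) comp_apply partial_deriv_bump[OF k])
  qed auto
  then show ?thesis unfolding smooth_fun_def using bump_differentiable[OF k] by metis
qed

text \<open>The polynomial (t - a_i)(b_i - t) is positive exactly between a_i and b_i if a_i < b_i,
  so the product lives on the open box; as k grows the exponents tend to 0 there and the functions
  to the indicator of the box.\<close>

definition box_bump :: "real^'n::finite \<Rightarrow> real^'n \<Rightarrow> nat \<Rightarrow> real^'n \<Rightarrow> complex" where
  "box_bump a b k = bump (real (Suc k)) (\<lambda>i. [:- (a $ i), 1:] * [:b $ i, -1:]) (\<lambda>_. 1) (\<lambda>_. 0)"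

lemma box_bump_eq:
  assumes ab: "\<And>i. a $ i < b $ i"
  shows "box_bump a b k x = (if x \<in> box a b then complex_of_real (\<Prod>i\<in>UNIV. exp (- (1 / (real (Suc k) * ((x $ i - a $ i) * (b $ i - x $ i)))))) else 0)"
proof -
  have pos: "0 < (x $ i - a $ i) * (b $ i - x $ i) \<longleftrightarrow> a $ i < x $ i \<and> x $ i < b $ i" for i
    using ab[of i] by (auto simp: zero_less_mult_iff)
  have ps: "poly ([:- (a $ i), 1:] * [:b $ i, -1:]) t = (t - a $ i) * (b $ i - t)" for i t
    by (simp only: poly_mult poly_pCons poly_0) (simp add: algebra_simps)
  show ?thesis
  proof (cases "x \<in> box a b")
    case True
    then show ?thesis unfolding box_bump_def bump_def bump1_def ps pos by (auto simp: mem_box_cart)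
  next
    case False
    then obtain i where "\<not> (a $ i < x $ i \<and> x $ i < b $ i)" by (auto simp: mem_box_cart)
    then have "(\<Prod>i\<in>UNIV. bump1 (real (Suc k)) ([:- (a $ i), 1:] * [:b $ i, -1:]) 1 0 (x $ i)) = 0"
      unfolding bump1_def ps pos by (intro prod_zero) auto
    then show ?thesis using False by (simp add: box_bump_def bump_def)
  qed
qed

lemma box_bump_test_fun:
  assumes ab: "\<And>i. a $ i < b $ i"
  shows "test_fun (box_bump a b k)"
  unfolding test_fun_def
proof
  show "smooth_fun (box_bump a b k)" unfolding box_bump_def by (rule bump_smooth) simp
  have "{x. box_bump a b k x \<noteq> 0} \<subseteq> box a b" using box_bump_eq[OF ab] by auto
  then have "bounded {x. box_bump a b k x \<noteq> 0}" using bounded_box bounded_subset by blast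
  then show "compact (closure {x. box_bump a b k x \<noteq> 0})" by (simp add: compact_closure)
qed

lemma box_bump_le:
  assumes ab: "\<And>i. a $ i < b $ i"
  shows "norm (box_bump a b k x) \<le> indicator (cbox a b) x"
proof (cases "x \<in> box a b")
  case True
  then have "norm (box_bump a b k x) = (\<Prod>i\<in>UNIV. exp (- (1 / (real (Suc k) * ((x $ i - a $ i) * (b $ i - x $ i))))))"
    by (simp only: box_bump_eq[OF ab] if_True norm_of_real) (simp add: prod_nonneg abs_of_nonneg)
  also have "\<dots> \<le> 1"
    using True by (intro prod_le_1) (auto simp: mem_box_cart less_imp_le)
  finally show ?thesis using True box_subset_cbox[of a b] by (auto simp: indicator_def)
next
  case False
  then show ?thesis using box_bump_eq[OF ab, of k x] by simp
qed

lemma box_bump_tendsto: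
  assumes ab: "\<And>i. a $ i < b $ i"
  shows "(\<lambda>k. box_bump a b k x) \<longlonglongrightarrow> indicator (box a b) x"
proof (cases "x \<in> box a b")
  case True
  have "(\<lambda>k. exp (- (1 / (real (Suc k) * c)))) \<longlonglongrightarrow> exp (- 0)" if "0 < c" for c :: real
  proof -
    have "(\<lambda>k. 1 / (real (Suc k) * c)) \<longlonglongrightarrow> 0" using that by real_asymp
    then show ?thesis by (intro tendsto_intros)
  qed
  then have "(\<lambda>k. complex_of_real (\<Prod>i\<in>UNIV. exp (- (1 / (real (Suc k) * ((x $ i - a $ i) * (b $ i - x $ i))))))) \<longlonglongrightarrow> complex_of_real (\<Prod>i\<in>(UNIV::'a set). exp (- 0))"
    using True by (intro tendsto_of_real tendsto_prod) (auto simp: mem_box_cart)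
  then show ?thesis using True by (simp add: box_bump_eq[OF ab])
qed (simp add: box_bump_eq[OF ab])

section \<open>Integrability of test functions and of their transforms\<close>

lemma smooth_fun_funpow:
  assumes "smooth_fun g"
  shows "(partial_deriv i ^^ k) g differentiable (at x)"
    and "continuous_on UNIV ((partial_deriv i ^^ k) g)"
    and "(\<lambda>t. (partial_deriv i ^^ k) g (x + t *\<^sub>R axis i 1)) differentiable (at 0)"
proof -
  have "foldr partial_deriv (replicate k i) g = (partial_deriv i ^^ k) g" by (induction k) auto
  then show d: "(partial_deriv i ^^ k) g differentiable (at x)" for x
    using assms unfolding smooth_fun_def by metis
  show "continuous_on UNIV ((partial_deriv i ^^ k) g)"
    by (intro continuous_at_imp_continuous_on ballI differentiable_imp_continuous_within d)
  have "(partial_deriv i ^^ k) g \<circ> (\<lambda>t. x + t *\<^sub>R axis i 1) differentiable (at 0)"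
    by (rule differentiable_chain_at) (use d[of x] in \<open>auto intro!: derivative_intros\<close>)
  then show "(\<lambda>t. (partial_deriv i ^^ k) g (x + t *\<^sub>R axis i 1)) differentiable (at 0)" by (simp add: o_def)
qed

text \<open>Off the closed set \<open>K\<close> the function is 0 on a whole neighbourhood along the
  axis, so its derivative is 0 there as well.\<close>

lemma funpow_zero_outside:
  assumes "closed K" "\<And>x. x \<notin> K \<Longrightarrow> g x = 0" "x \<notin> K"
  shows "(partial_deriv i ^^ k) g x = 0"
  using assms(3)
proof (induction k arbitrary: x)
  case 0 then show ?case using assms by simp
next
  case (Suc k)
  let ?h = "\<lambda>t. (partial_deriv i ^^ k) g (x + t *\<^sub>R axis i 1)"
  have op: "open {t::real. x + t *\<^sub>R axis i 1 \<notin> K}"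
  proof -
    have "open ((\<lambda>t::real. x + t *\<^sub>R axis i 1) -` (- K))"
      by (rule open_vimage) (use assms(1) in \<open>auto intro!: continuous_intros\<close>)
    then show ?thesis by (simp add: vimage_def)
  qed
  have "(?h has_vector_derivative 0) (at 0)"
    by (rule has_vector_derivative_transform_within_open[OF has_vector_derivative_const[of 0] op]) (use Suc in auto)
  moreover have "(partial_deriv i ^^ Suc k) g x = vector_derivative ?h (at 0)"
    by (simp only: funpow.simps o_apply partial_deriv_def[of i "(partial_deriv i ^^ k) g"])
  ultimately show ?case by (simp add: vector_derivative_at)
qed

text \<open>By compactness a test function is a symbol of every order, already with \<rho> = 0, that
  is, without asking derivatives to gain decay. This makes integration by parts available for
  it.\<close>

lemma test_fun_symb:
  fixes \<phi> :: "real^'n::finite \<Rightarrow> complex"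
  assumes "test_fun \<phi>"
  shows "\<exists>A. \<forall>i. symb 0 i N A \<mu> \<phi>"
proof -
  define K where "K = closure {x. \<phi> x \<noteq> 0}"
  have K: "compact K" and sm: "smooth_fun \<phi>" using assms by (auto simp: test_fun_def K_def)
  have out: "\<phi> x = 0" if "x \<notin> K" for x using that closure_subset[of "{x. \<phi> x \<noteq> 0}"] by (auto simp: K_def)
  have ex: "\<exists>B\<ge>0. \<forall>x. norm ((partial_deriv i ^^ k) \<phi> x) \<le> B * japanese x powr \<mu>" for i k
  proof -
    let ?q = "\<lambda>x. norm ((partial_deriv i ^^ k) \<phi> x) * japanese x powr (- \<mu>)"
    have "continuous_on K ?q"
      by (intro continuous_intros continuous_on_subset[OF smooth_fun_funpow(2)[OF sm]]) auto
    then have "bounded (?q ` K)" using K compact_continuous_image compact_imp_bounded by blast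
    then obtain B where B: "\<And>x. x \<in> K \<Longrightarrow> norm (?q x) \<le> B" unfolding bounded_iff by blast
    show ?thesis
    proof (intro exI conjI allI)
      show "0 \<le> max 0 B" by simp
      fix x
      show "norm ((partial_deriv i ^^ k) \<phi> x) \<le> max 0 B * japanese x powr \<mu>"
      proof (cases "x \<in> K")
        case True
        have "?q x * japanese x powr \<mu> \<le> max 0 B * japanese x powr \<mu>"
          using B[OF True] by (intro mult_right_mono) auto
        moreover have "?q x * japanese x powr \<mu> = norm ((partial_deriv i ^^ k) \<phi> x)"
          using japanese_pos[of x] by (simp add: mult.assoc flip: powr_add)
        ultimately show ?thesis by simp
      next
        case False
        then show ?thesis using funpow_zero_outside[OF compact_imp_closed[OF K] out] by simp
      qed
    qed
  qed
  define B where "B i k = (SOME B. 0 \<le> B \<and> (\<forall>x. norm ((partial_deriv i ^^ k) \<phi> x) \<le> B * japanese x powr \<mu>))" for i k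
  have B: "0 \<le> B i k" "norm ((partial_deriv i ^^ k) \<phi> x) \<le> B i k * japanese x powr \<mu>" for i k x
    using someI_ex[OF ex[where i=i and k=k]] by (auto simp: B_def)
  define A where "A = (\<Sum>i\<in>UNIV. \<Sum>k\<le>N. B i k)"
  have BA: "B i k \<le> A" if "k \<le> N" for i k
  proof -
    have "B i k \<le> (\<Sum>k\<le>N. B i k)" using B(1) that by (intro member_le_sum) auto
    also have "\<dots> \<le> A" unfolding A_def using B(1) by (intro member_le_sum sum_nonneg) auto
    finally show ?thesis .
  qed
  have "symb 0 i N A \<mu> \<phi>" for i
  proof (rule symb_of_funpow)
    fix k and \<xi> :: "real^'n" assume "k \<le> N"
    have "B i k * japanese \<xi> powr \<mu> \<le> A * japanese \<xi> powr \<mu>" by (intro mult_right_mono BA) (use \<open>k \<le> N\<close> in auto)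
    from order_trans[OF B(2) this] show "norm ((partial_deriv i ^^ k) \<phi> \<xi>) \<le> A * japanese \<xi> powr (\<mu> - 0 * real k)"
      by simp
  next
    fix k and \<xi> :: "real^'n"
    show "continuous_on UNIV ((partial_deriv i ^^ k) \<phi>)" by (rule smooth_fun_funpow(2)[OF sm])
    show "(\<lambda>t. (partial_deriv i ^^ k) \<phi> (\<xi> + t *\<^sub>R axis i 1)) differentiable (at 0)" by (rule smooth_fun_funpow(3)[OF sm])
  qed
  then show ?thesis by blast
qed

text \<open>Moments of order 2n in the single coordinates combine, by
  \<open>one_plus_norm_power_le\<close>, to decay of order -2n.\<close>

lemma integrable_of_power_bound:
  fixes g :: "real^'n::finite \<Rightarrow> complex"
  assumes [measurable]: "g \<in> borel_measurable borel" and C: "\<And>z. norm (g z) \<le> C0"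
    "\<And>i z. norm (g z) * \<bar>z $ i\<bar> ^ (2 * CARD('n)) \<le> C i"
  shows "integrable lborel g"
proof -
  let ?K = "2 * CARD('n)"
  define B where "B = (2 * real CARD('n)) ^ ?K * (C0 + (\<Sum>i\<in>UNIV. C i))"
  have le: "norm (g z) \<le> B * japanese z powr (- 2 * real CARD('n))" for z
  proof -
    have p: "0 < (1 + norm z) ^ ?K" by (intro zero_less_power) (simp add: add_pos_nonneg)
    have "norm (g z) * (1 + 1 * norm z) ^ ?K \<le> norm (g z) * ((2 * real CARD('n)) ^ ?K * (1 + (\<Sum>i\<in>UNIV. (1 * \<bar>z $ i\<bar>) ^ ?K)))"
      by (intro mult_left_mono one_plus_norm_power_le) auto
    also have "\<dots> = (2 * real CARD('n)) ^ ?K * (norm (g z) + (\<Sum>i\<in>UNIV. norm (g z) * \<bar>z $ i\<bar> ^ ?K))"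
      by (simp add: sum_distrib_left algebra_simps)
    also have "\<dots> \<le> B" unfolding B_def by (intro mult_left_mono add_mono sum_mono C) auto
    finally have "norm (g z) * (1 + norm z) ^ ?K \<le> B" by simp
    then have "norm (g z) \<le> B * (1 / (1 + 1 * norm z) ^ ?K)" using p by (simp add: pos_le_divide_eq)
    moreover have "0 \<le> B" using \<open>norm (g z) * (1 + norm z) ^ ?K \<le> B\<close> p by (meson mult_nonneg_nonneg norm_ge_zero order_trans less_imp_le)
    moreover have "1 / (1 + 1 * norm z) ^ ?K \<le> japanese z powr (- 2 * real CARD('n))"
      using one_plus_inverse_power_le_japanese[of 1 z "CARD('n)"] by simp
    ultimately show ?thesis by (meson mult_left_mono order_trans)
  qed
  show ?thesis
  proof (rule Bochner_Integration.integrable_bound)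
    show "integrable lborel (\<lambda>z::real^'n. B * japanese z powr (- 2 * real CARD('n)))"
      by (intro integrable_mult_right integrable_japanese_powr)
    show "AE z in lborel. norm (g z) \<le> norm (B * japanese z powr (- 2 * real CARD('n)))"
      by (intro AE_I2 order_trans[OF le]) simp
  qed measurable
qed

text \<open>Integrating by parts 2n times along each axis gives the moments required by
  \<open>integrable_of_power_bound\<close>.\<close>

lemma test_fun_FT_integrable:
  fixes \<phi> :: "real^'n::finite \<Rightarrow> complex"
  assumes "test_fun \<phi>"
  shows "integrable lborel \<phi>" "integrable lborel (FT \<phi>)" "\<exists>B. \<forall>x. norm (\<phi> x) \<le> B"
proof -
  let ?K = "2 * CARD('n)" and ?n = "- 2 * real CARD('n)"
  obtain A where A: "\<And>i. symb 0 i ?K A ?n \<phi>" using test_fun_symb[OF assms] by blast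
  show int: "integrable lborel \<phi>" using symb_integrable[OF A order_refl] .
  then have [measurable]: "\<phi> \<in> borel_measurable borel" by auto
  show "integrable lborel (FT \<phi>)"
  proof (rule integrable_of_power_bound)
    show "norm (FT \<phi> z) \<le> (LINT \<xi>|lborel. norm (\<phi> \<xi>))" for z by (rule norm_FT_le)
    show "norm (FT \<phi> z) * \<bar>z $ i\<bar> ^ (2 * CARD('n)) \<le> (LINT \<xi>|lborel. norm ((partial_deriv i ^^ ?K) \<phi> \<xi>))" for i z
    proof -
      have "norm (FT \<phi> z) * \<bar>z $ i\<bar> ^ ?K = norm (FT ((partial_deriv i ^^ ?K) \<phi>) z)"
        using FT_funpow[OF A[of i] order_refl, where z=z] by (simp add: norm_mult norm_power)
      then show ?thesis using norm_FT_le by simp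
    qed
  qed measurable
  show "\<exists>B. \<forall>x. norm (\<phi> x) \<le> B"
  proof (intro exI allI)
    fix x
    have "norm (\<phi> x) \<le> A * japanese x powr ?n" by (rule symb_bound[OF A])
    also have "\<dots> \<le> A * japanese x powr 0" using symb_nonneg[OF A] by (intro mult_left_mono japanese_powr_mono) auto
    finally show "norm (\<phi> x) \<le> A" by simp
  qed
qed

section \<open>Uniqueness of the representing function\<close>

lemma borel_version_complex:
  fixes g :: "'a \<Rightarrow> complex"
  assumes g: "g \<in> borel_measurable (completion M)"
  shows "\<exists>g'\<in>borel_measurable M. AE x in M. g x = g' x"
proof -
  have "(\<lambda>x. Re (g x)) \<in> borel_measurable (completion M)" "(\<lambda>x. Im (g x)) \<in> borel_measurable (completion M)"
    using g by (auto intro: measurable_compose[OF g])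
  from this[THEN completion_ex_borel_measurable_real]
  obtain r i where ri [measurable]: "r \<in> borel_measurable M" "i \<in> borel_measurable M"
    and ae: "AE x in M. Re (g x) = r x" "AE x in M. Im (g x) = i x"
    by blast
  show ?thesis
  proof (intro bexI)
    show "(\<lambda>x. Complex (r x) (i x)) \<in> borel_measurable M"
      unfolding Complex_eq by measurable
    show "AE x in M. g x = Complex (r x) (i x)"
      using ae by eventually_elim (auto simp: complex_eq_iff)
  qed
qed

text \<open>On a fixed box the function has an integrable Borel version. Boxes generate the Borel
  sets and are closed under intersection, so its vanishing integrals over boxes extend to all Borel
  sets, and it vanishes almost everywhere. Countably many boxes exhaust the space.\<close>

lemma AE_zero_of_boxes:
  fixes h :: "real^'n::finite \<Rightarrow> complex"
  assumes h: "locally_integrable h"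
    and z: "\<And>a b. (\<And>i. a $ i < b $ i) \<Longrightarrow> (LINT x|lebesgue. indicator (box a b) x *\<^sub>R h x) = 0"
  shows "AE x in lborel. h x = 0"
proof -
  have zero: "AE x in lborel. indicator (box c d) x *\<^sub>R h x = 0" if cd: "\<And>i. c $ i < d $ i" for c d :: "real^'n"
  proof -
    have "set_integrable lebesgue (cbox c d) h" using h unfolding locally_integrable_def by simp
    then have "set_integrable lebesgue (box c d) h"
      by (rule set_integrable_subset) (auto simp: box_subset_cbox)
    then have I: "integrable lebesgue (\<lambda>x. indicator (box c d) x *\<^sub>R h x)" by (simp add: set_integrable_def)
    then have "(\<lambda>x. indicator (box c d) x *\<^sub>R h x) \<in> borel_measurable lebesgue" by auto
    then obtain H where Hm [measurable]: "H \<in> borel_measurable borel" and H: "AE x in lborel. indicator (box c d) x *\<^sub>R h x = H x"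
      using borel_version_complex[of _ lborel] by auto
    have H': "AE x in lebesgue. indicator (box c d) x *\<^sub>R h x = H x" by (rule AE_completion[OF H])
    have Hi: "integrable lborel H"
    proof -
      have "integrable lebesgue H"
        by (rule integrable_cong_AE_imp[OF I]) (use H' in \<open>auto simp: measurable_completion elim: eventually_mono\<close>)
      then show ?thesis by (simp add: integrable_completion)
    qed
    have box0: "(LINT x|lborel. indicator (box a b) x *\<^sub>R H x) = 0" for a b
    proof -
      have "(LINT x|lborel. indicator (box a b) x *\<^sub>R H x) = (LINT x|lebesgue. indicator (box a b) x *\<^sub>R H x)"
        by (rule integral_completion[symmetric]) measurable
      also have "\<dots> = (LINT x|lebesgue. indicator (box a b \<inter> box c d) x *\<^sub>R h x)"
      proof (rule integral_cong_AE)
        show "AE x in lebesgue. indicator (box a b) x *\<^sub>R H x = indicator (box a b \<inter> box c d) x *\<^sub>R h x"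
          using H' by eventually_elim (auto simp: indicator_def split: if_splits)
        show "(\<lambda>x. indicator (box a b) x *\<^sub>R H x) \<in> borel_measurable lebesgue" by (rule measurable_completion) measurable
        have "(\<lambda>x. indicator (box a b) x *\<^sub>R (indicator (box c d) x *\<^sub>R h x)) \<in> borel_measurable lebesgue"
          by (intro borel_measurable_scaleR borel_measurable_indicator borel_measurable_integrable[OF I]) simp
        then show "(\<lambda>x. indicator (box a b \<inter> box c d) x *\<^sub>R h x) \<in> borel_measurable lebesgue"
          by (simp add: indicator_inter_arith)
      qed
      also have "\<dots> = 0"
      proof -
        \<comment> \<open>The intersection of two boxes is a box, possibly empty; this transfers the
          hypothesis on h to its restriction to the fixed box.\<close>
        define p q where "p = (\<chi> i. max (a $ i) (c $ i))" and "q = (\<chi> i. min (b $ i) (d $ i))"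
        have e: "box a b \<inter> box c d = box p q" by (auto simp: mem_box_cart p_def q_def)
        show ?thesis
        proof (cases "\<forall>i. p $ i < q $ i")
          case True then show ?thesis unfolding e by (intro z) auto
        next
          case False
          then have "box p q = {}" by (auto simp: mem_box_cart) (meson less_trans)
          then show ?thesis unfolding e by simp
        qed
      qed
      finally show ?thesis .
    qed
    \<comment> \<open>The total integral feeds the complement step of the induction over Borel
      sets.\<close>
    have UN0: "(LINT x|lborel. H x) = 0"
    proof -
      have "(LINT x|lborel. H x) = (LINT x|lborel. indicator (box c d) x *\<^sub>R H x)"
        by (rule integral_cong_AE) (use H in \<open>auto elim!: eventually_mono simp: indicator_def split: if_splits\<close>)
      then show ?thesis using box0 by simp
    qed
    have all: "(LINT x|lborel. indicator S x *\<^sub>R H x) = 0" if "S \<in> sets borel" for S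
    proof -
      have S: "S \<in> sigma_sets UNIV (range (\<lambda>(a, b). box a b :: (real^'n) set))"
        using that by (simp add: borel_eq_box)
      have si: "set_integrable lborel T H" if "T \<in> sets borel" for T
        unfolding set_integrable_def using that by (intro integrable_mult_indicator Hi) auto
      have st: "Int_stable (range (\<lambda>(a, b). box a b :: (real^'n) set))"
        by (auto simp: Int_stable_def box_Int_box)
      have sub: "range (\<lambda>(a, b). box a b :: (real^'n) set) \<subseteq> Pow UNIV" by simp
      have "set_lebesgue_integral lborel S H = 0"
        using st sub S
      proof (induction rule: sigma_sets_induct_disjoint)
        case (basic T)
        then show ?case using box0 by (auto simp: set_lebesgue_integral_def)
      next
        case empty
        then show ?case by (simp add: set_lebesgue_integral_def)
      next
        case (compl T)
        then have T: "T \<in> sets borel" by (simp add: borel_eq_box)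
        have "(LINT x|lborel. H x) = set_lebesgue_integral lborel UNIV H" by (simp add: set_lebesgue_integral_def)
        also have "\<dots> = set_lebesgue_integral lborel (T \<union> (UNIV - T)) H" by simp
        also have "\<dots> = set_lebesgue_integral lborel T H + set_lebesgue_integral lborel (UNIV - T) H"
          by (rule set_integral_Un) (use T in \<open>auto intro!: si\<close>)
        finally show ?case using compl UN0 by simp
      next
        case (union T)
        then have T: "T i \<in> sets borel" for i by (auto simp: borel_eq_box)
        have "(\<lambda>i. set_lebesgue_integral lborel (T i) H) sums set_lebesgue_integral lborel (\<Union>i. T i) H"
        proof -
          have "set_lebesgue_integral lborel (\<Union>i. T i) H = (\<Sum>i. set_lebesgue_integral lborel (T i) H)"
            by (rule lebesgue_integral_countable_add) (use T union in \<open>auto intro!: si simp: disjoint_family_on_def\<close>)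
          moreover have "(\<Sum>i. set_lebesgue_integral lborel (T i) H) = 0" using union by simp
          ultimately show ?thesis using union by (simp add: sums_iff)
        qed
        then show ?case using union by (simp add: sums_iff)
      qed
      then show ?thesis by (simp add: set_lebesgue_integral_def)
    qed
    have "AE x in lborel. H x = 0"
      by (rule sigma_finite_measure.density_zero[OF sigma_finite_lborel Hi]) (use all in \<open>simp add: set_lebesgue_integral_def\<close>)
    with H show ?thesis by eventually_elim simp
  qed
  have "AE x in lborel. \<forall>k::nat. indicator (box (\<chi> i. - real (Suc k)) (\<chi> i. real (Suc k))) x *\<^sub>R h x = 0"
    unfolding AE_all_countable by (intro allI zero) simp
  then show ?thesis
  proof eventually_elim
    case (elim x)
    obtain k where k: "norm x < real k" using reals_Archimedean2 by blast
    have "x \<in> box (\<chi> i. - real (Suc k)) (\<chi> i. real (Suc k))"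
      unfolding mem_box_cart
    proof
      fix i
      have "\<bar>x $ i\<bar> < real (Suc k)" using component_le_norm_cart[of x i] k by simp
      then show "(\<chi> i. - real (Suc k)) $ i < x $ i \<and> x $ i < (\<chi> i. real (Suc k)) $ i" by auto
    qed
    then show ?case using elim[rule_format, of k] by simp
  qed
qed

text \<open>The functions \<open>box_bump\<close> are admissible tests and converge boundedly to the
  indicator of a box, so the difference of two representatives has integral 0 over every
  box.\<close>

lemma represented_by_unique:
  fixes u v :: "real^'n::finite \<Rightarrow> complex"
  assumes u: "represented_by T u" and v: "represented_by T v"
  shows "AE x in lborel. u x = v x"
proof -
  have lu: "locally_integrable u" and lv: "locally_integrable v" using u v by (auto simp: represented_by_def)
  define h where "h x = u x - v x" for x
  have lh: "locally_integrable h" using lu lv unfolding locally_integrable_def h_def by (auto intro: set_integral_diff)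
  have z: "(LINT x|lebesgue. indicator (box a b) x *\<^sub>R h x) = 0" if ab: "\<And>i. a $ i < b $ i" for a b :: "real^'n"
  proof -
    have bm: "box_bump a b k \<in> borel_measurable borel" for k
      using test_fun_FT_integrable(1)[OF box_bump_test_fun[OF ab, of k]] by auto
    have I: "integrable lebesgue (\<lambda>x. box_bump a b k x * w x)" if w: "locally_integrable w" for w :: "real^'n \<Rightarrow> complex" and k
    proof -
      have "set_integrable lebesgue (cbox a b) w" using w unfolding locally_integrable_def by simp
      then have w': "integrable lebesgue (\<lambda>x. indicator (cbox a b) x *\<^sub>R w x)" by (simp add: set_integrable_def)
      \<comment> \<open>The bump vanishes off the closed box, so only the restriction of
        \<open>w\<close> to that box is involved, which local integrability controls.\<close>
      have e: "box_bump a b k x * w x = box_bump a b k x * (indicator (cbox a b) x *\<^sub>R w x)" for x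
        using box_bump_le[OF ab, of k x] by (auto simp: indicator_def split: if_splits)
      show ?thesis unfolding e
      proof (rule Bochner_Integration.integrable_bound[OF w'])
        show "AE x in lebesgue. norm (box_bump a b k x * (indicator (cbox a b) x *\<^sub>R w x)) \<le> norm (indicator (cbox a b) x *\<^sub>R w x)"
        proof (rule AE_I2)
          fix x
          have "norm (box_bump a b k x) \<le> 1" using box_bump_le[OF ab, of k x] by (cases "x \<in> cbox a b") auto
          then show "norm (box_bump a b k x * (indicator (cbox a b) x *\<^sub>R w x)) \<le> norm (indicator (cbox a b) x *\<^sub>R w x)"
            unfolding norm_mult by (intro mult_left_le_one_le) auto
        qed
        show "(\<lambda>x. box_bump a b k x * (indicator (cbox a b) x *\<^sub>R w x)) \<in> borel_measurable lebesgue"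
          by (rule borel_measurable_times) (use w' bm[of k] in \<open>auto intro: measurable_completion\<close>)
      qed
    qed
    have zk: "(LINT x|lebesgue. box_bump a b k x * h x) = 0" for k
    proof -
      have "distrib_of_fun u (box_bump a b k) = distrib_of_fun v (box_bump a b k)"
        using u v box_bump_test_fun[OF ab, of k] unfolding represented_by_def by metis
      moreover have "(LINT x|lebesgue. box_bump a b k x * h x) = (LINT x|lebesgue. box_bump a b k x * u x) - (LINT x|lebesgue. box_bump a b k x * v x)"
        using I[OF lu, of k] I[OF lv, of k] by (simp add: h_def right_diff_distrib)
      ultimately show ?thesis by (simp add: distrib_of_fun_def mult.commute)
    qed
    have "set_integrable lebesgue (cbox a b) h" using lh unfolding locally_integrable_def by simp
    then have hI: "integrable lebesgue (\<lambda>x. indicator (cbox a b) x *\<^sub>R h x)" by (simp add: set_integrable_def)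
    have "(\<lambda>k. LINT x|lebesgue. box_bump a b k x * h x) \<longlonglongrightarrow> (LINT x|lebesgue. indicator (box a b) x *\<^sub>R h x)"
    proof (rule integral_dominated_convergence[where w="\<lambda>x. norm (indicator (cbox a b) x *\<^sub>R h x)"])
      show "integrable lebesgue (\<lambda>x. norm (indicator (cbox a b) x *\<^sub>R h x))" using hI by (rule integrable_norm)
      show "(\<lambda>x. box_bump a b k x * h x) \<in> borel_measurable lebesgue" for k using I[OF lh, of k] by auto
      have "(\<lambda>x. indicator (box a b) x *\<^sub>R (indicator (cbox a b) x *\<^sub>R h x)) \<in> borel_measurable lebesgue"
        by (intro borel_measurable_scaleR borel_measurable_indicator borel_measurable_integrable[OF hI]) simp
      moreover have "indicator (box a b) x *\<^sub>R (indicator (cbox a b) x *\<^sub>R h x) = indicator (box a b) x *\<^sub>R h x" for x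
        using box_subset_cbox[of a b] by (auto simp: indicator_def)
      ultimately show "(\<lambda>x. indicator (box a b) x *\<^sub>R h x) \<in> borel_measurable lebesgue" by (simp only:)
      show "AE x in lebesgue. (\<lambda>k. box_bump a b k x * h x) \<longlonglongrightarrow> indicator (box a b) x *\<^sub>R h x"
      proof (rule AE_I2)
        fix x
        have "(\<lambda>k. box_bump a b k x * h x) \<longlonglongrightarrow> indicator (box a b) x * h x"
          by (intro tendsto_mult tendsto_const box_bump_tendsto[OF ab])
        then show "(\<lambda>k. box_bump a b k x * h x) \<longlonglongrightarrow> indicator (box a b) x *\<^sub>R h x"
          by (cases "x \<in> box a b") auto
      qed
      show "AE x in lebesgue. norm (box_bump a b k x * h x) \<le> norm (indicator (cbox a b) x *\<^sub>R h x)" for k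
      proof (rule AE_I2)
        fix x
        have "norm (box_bump a b k x) * norm (h x) \<le> indicator (cbox a b) x * norm (h x)"
          by (rule mult_right_mono[OF box_bump_le[OF ab]]) simp
        then show "norm (box_bump a b k x * h x) \<le> norm (indicator (cbox a b) x *\<^sub>R h x)" by (simp add: norm_mult)
      qed
    qed
    then show ?thesis unfolding zk by (simp add: LIMSEQ_const_iff)
  qed
  have "AE x in lborel. h x = 0" by (rule AE_zero_of_boxes[OF lh z])
  then show ?thesis by eventually_elim (simp add: h_def)
qed

text \<open>The seminorms of order 0 and of order 2n in single coordinates, taken without
  derivatives, supply the moments for \<open>integrable_of_power_bound\<close>.\<close>

lemma schwartz_integrable:
  fixes f :: "real^'n::finite \<Rightarrow> complex"
  assumes "schwartz_fun f"
  shows "integrable lborel f"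
proof -
  have sm: "smooth_fun f" and bd: "\<And>\<beta>. \<exists>C. \<forall>x. norm ((\<Prod>i\<in>UNIV. (x $ i) ^ \<beta> i) *\<^sub>R multi_deriv (\<lambda>_. 0) f x) \<le> C"
    using assms unfolding schwartz_fun_def by blast+
  have m0: "multi_deriv (\<lambda>_. 0) f = f"
  proof -
    have "foldr (\<lambda>i g. (partial_deriv i ^^ 0) g) xs f = f" for xs :: "'n list" by (induction xs) auto
    then show ?thesis by (simp add: multi_deriv_def)
  qed
  have "continuous_on UNIV ((partial_deriv undefined ^^ 0) f)" by (rule smooth_fun_funpow(2)[OF sm])
  then have m: "f \<in> borel_measurable borel" by (intro borel_measurable_continuous_onI) simp
  obtain C0 where C0: "\<And>x. norm (f x) \<le> C0" using bd[of "\<lambda>_. 0"] by (auto simp: m0)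
  have "\<exists>C. \<forall>x. norm (f x) * \<bar>x $ i\<bar> ^ (2 * CARD('n)) \<le> C" for i
  proof -
    have "(\<Prod>j\<in>UNIV. (x $ j) ^ (if j = i then 2 * CARD('n) else 0)) = (x $ i) ^ (2 * CARD('n))" for x :: "real^'n"
      by (subst prod.remove[of UNIV i]) auto
    then show ?thesis using bd[of "\<lambda>j. if j = i then 2 * CARD('n) else 0"]
      by (simp add: m0 norm_power abs_mult power_abs mult.commute)
  qed
  then obtain C where "\<And>i x. norm (f x) * \<bar>x $ i\<bar> ^ (2 * CARD('n)) \<le> C i" by metis
  then show ?thesis by (rule integrable_of_power_bound[OF m C0])
qed

section \<open>Borel version of a rough symbol\<close>

text \<open>A pure derivative along one axis does not see the enumeration behind
  \<open>coord_list\<close>: the axis occurs there exactly once, and the other blocks are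
  identities.\<close>

lemma multi_deriv_single: "multi_deriv (\<lambda>j. if j = i then k else 0) g = (partial_deriv i ^^ k) g"
proof -
  have "\<exists>is::'a list. distinct is \<and> set is = UNIV" using finite_distinct_list[of "UNIV :: 'a set"] by auto
  from someI_ex[OF this] have cl: "distinct (coord_list :: 'a list)" "set (coord_list :: 'a list) = UNIV"
    unfolding coord_list_def by auto
  have "foldr (\<lambda>j g. (partial_deriv j ^^ (if j = i then k else 0)) g) xs g = (if i \<in> set xs then (partial_deriv i ^^ k) g else g)"
    if "distinct xs" for xs
    using that by (induction xs) auto
  from this[OF cl(1)] show ?thesis by (simp add: multi_deriv_def cl(2))
qed

lemma multi_size_single: "multi_size (\<lambda>j. if j = i then k else 0) = k"
  by (simp add: multi_size_def)

text \<open>Completeness of Lebesgue measure: the part of a preimage inside the null set is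
  measurable whatever it is.\<close>

lemma lebesgue_measurable_of_AE_eq:
  fixes g g' :: "'a::euclidean_space \<Rightarrow> complex"
  assumes g': "g' \<in> borel_measurable lborel" and ae: "AE x in lborel. g x = g' x"
  shows "g \<in> borel_measurable lebesgue"
proof (rule measurableI)
  obtain Z where Z: "Z \<in> null_sets lborel" "{x \<in> space lborel. g x \<noteq> g' x} \<subseteq> Z"
    using ae by (auto elim!: AE_E simp: null_sets_def)
  fix S :: "complex set" assume S: "S \<in> sets borel"
  have "g -` S \<inter> Z \<in> null_sets lebesgue"
    by (rule null_sets_completion_subset[OF _ null_sets_completionI[OF Z(1)]]) auto
  then have "g -` S \<inter> Z \<in> sets lebesgue" by auto
  moreover have "g' -` S \<in> sets lborel" using measurable_sets[OF g' S] by simp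
  moreover have "Z \<in> sets lborel" using Z(1) by auto
  moreover have "g -` S \<inter> space lebesgue = (g' -` S - Z) \<union> (g -` S \<inter> Z)" using Z(2) by auto
  ultimately show "g -` S \<inter> space lebesgue \<in> sets lebesgue" by (metis sets.Diff sets.Un sets_completionI_sets)
qed simp

text \<open>For each \<xi> there is a null set of exceptional y, and it may vary with \<xi>;
  \<open>rough_symbol_borel_version\<close> removes this dependence.\<close>

lemma symbol_bound_AE:
  fixes a :: "real^'n::finite \<Rightarrow> real^'n \<Rightarrow> complex"
  assumes a: "a \<in> rough_symbols m \<rho>"
  shows "\<exists>C\<ge>0. \<forall>\<xi>. AE y in lborel. norm ((partial_deriv i ^^ k) (a y) \<xi>) \<le> C * japanese \<xi> powr (m - \<rho> * real k)"
proof -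
  obtain C where C: "\<And>\<xi>. Linf_norm (\<lambda>x. (partial_deriv i ^^ k) (a x) \<xi>) \<le> ereal (C * japanese \<xi> powr (m - \<rho> * real k))"
    using a[unfolded rough_symbols_def mem_Collect_eq, THEN conjunct2, THEN conjunct2, rule_format, of "\<lambda>j. if j = i then k else 0"]
    unfolding multi_deriv_single multi_size_single by blast
  show ?thesis
  proof (intro exI[of _ "max 0 C"] conjI allI)
    fix \<xi> :: "real^'n"
    have "AE y in lebesgue. ereal (norm ((partial_deriv i ^^ k) (a y) \<xi>)) \<le> Linf_norm (\<lambda>x. (partial_deriv i ^^ k) (a x) \<xi>)"
      unfolding Linf_norm_def by (rule esssup_AE)
    then have "AE y in lborel. ereal (norm ((partial_deriv i ^^ k) (a y) \<xi>)) \<le> Linf_norm (\<lambda>x. (partial_deriv i ^^ k) (a x) \<xi>)"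
      by (simp only: AE_completion_iff)
    then show "AE y in lborel. norm ((partial_deriv i ^^ k) (a y) \<xi>) \<le> max 0 C * japanese \<xi> powr (m - \<rho> * real k)"
    proof eventually_elim
      case (elim y)
      have "ereal (norm ((partial_deriv i ^^ k) (a y) \<xi>)) \<le> ereal (C * japanese \<xi> powr (m - \<rho> * real k))"
        using elim C[of \<xi>] by (rule order_trans)
      then have "norm ((partial_deriv i ^^ k) (a y) \<xi>) \<le> C * japanese \<xi> powr (m - \<rho> * real k)" by simp
      also have "\<dots> \<le> max 0 C * japanese \<xi> powr (m - \<rho> * real k)" by (intro mult_right_mono) auto
      finally show ?case .
    qed
  qed simp
qed

text \<open>A Lebesgue measurable function on the product need not have measurable sections; almost all of
  them are, and continuity in \<open>\<xi>\<close> makes a countable dense set of good frequencies sufficient.\<close>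

lemma borel_sections_dense:
  fixes a :: "real^'n::finite \<Rightarrow> real^'n \<Rightarrow> complex"
  assumes a: "(\<lambda>(x, \<xi>). a x \<xi>) \<in> borel_measurable lebesgue"
  shows "\<exists>d :: nat \<Rightarrow> real^'n. (\<forall>X. open X \<longrightarrow> X \<noteq> {} \<longrightarrow> (\<exists>n. d n \<in> X)) \<and>
     (\<forall>n. \<exists>g\<in>borel_measurable lborel. AE y in lborel. a y (d n) = g y)"
proof -
  define E where "E = {\<xi>. \<exists>g\<in>borel_measurable lborel. AE y in lborel. a y \<xi> = g y}"
  obtain a' where a' [measurable]: "a' \<in> borel_measurable borel" and ae: "AE p in lborel. (case p of (x, \<xi>) \<Rightarrow> a x \<xi>) = a' p"
    using borel_version_complex[OF a] by auto
  obtain Z where Z: "Z \<in> null_sets (lborel :: ((real^'n) \<times> (real^'n)) measure)" "{p \<in> space lborel. (case p of (x, \<xi>) \<Rightarrow> a x \<xi>) \<noteq> a' p} \<subseteq> Z"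
    using ae by (auto elim!: AE_E simp: null_sets_def)
  have Zeq: "a x \<xi> = a' (x, \<xi>)" if "(x, \<xi>) \<notin> Z" for x \<xi>
    using subsetD[OF Z(2), of "(x, \<xi>)"] that by auto
  have "Z \<in> sets (lborel \<Otimes>\<^sub>M lborel)" using null_setsD2[OF Z(1)] by (simp only: lborel_prod)
  then have Zc: "space (lborel \<Otimes>\<^sub>M lborel) - Z \<in> sets (lborel \<Otimes>\<^sub>M lborel)" by (rule sets.compl_sets)
  have "AE p in lborel \<Otimes>\<^sub>M lborel. p \<notin> Z"
    unfolding lborel_prod by (rule AE_not_in[OF Z(1)])
  then have "AE x in lborel. AE \<xi> in lborel. (x, \<xi>) \<notin> Z" by (rule lborel_pair.AE_pair)
  \<comment> \<open>Exchanging the two quantifiers requires an exceptional set that is measurable in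
    the product, hence the Borel set \<open>Z\<close>.\<close>
  then have "AE \<xi> in lborel. AE x in lborel. (x, \<xi>) \<notin> Z"
    by (subst (asm) lborel_pair.AE_commute) (use Zc in \<open>auto simp: set_diff_eq\<close>)
  then have EE: "AE \<xi> in lborel. \<xi> \<in> E"
  proof eventually_elim
    case (elim \<xi>)
    have "(\<lambda>y. a' (y, \<xi>)) \<in> borel_measurable lborel"
      using measurable_compose[OF measurable_Pair1'[of \<xi> borel borel] ] a' by (simp add: borel_prod)
    moreover have "AE y in lborel. a y \<xi> = a' (y, \<xi>)"
      using elim by eventually_elim (rule Zeq)
    ultimately show ?case unfolding E_def by (auto intro!: bexI[of _ "\<lambda>y. a' (y, \<xi>)"])
  qed
  \<comment> \<open>The complement of \<open>E\<close> is null, so it contains no nonempty open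
    set.\<close>
  have meet: "X \<inter> E \<noteq> {}" if X: "open X" "X \<noteq> {}" for X
  proof
    assume XE: "X \<inter> E = {}"
    have "AE \<xi> in lborel. \<xi> \<notin> X" using EE by eventually_elim (use XE in blast)
    then have "AE \<xi> in lebesgue. \<xi> \<in> - X" by (intro AE_completion) simp
    then have "x \<in> - X" for x using X(1) by (intro mem_closed_if_AE_lebesgue) auto
    then show False using X(2) by auto
  qed
  obtain B :: "(real^'n) set set" where B: "countable B" "topological_basis B" using ex_countable_basis by blast
  \<comment> \<open>One good frequency is picked from each nonempty member of a countable
    basis.\<close>
  define D where "D = (\<lambda>b. SOME x. x \<in> b \<inter> E) ` {b \<in> B. b \<noteq> {}}"
  have DE: "(SOME x. x \<in> b \<inter> E) \<in> b \<inter> E" if "b \<in> B" "b \<noteq> {}" for b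
  proof -
    have "b \<inter> E \<noteq> {}" by (rule meet[OF topological_basis_open[OF B(2) that(1)] that(2)])
    then have "\<exists>x. x \<in> b \<inter> E" by blast
    then show ?thesis by (rule someI_ex)
  qed
  have dn: "\<exists>d\<in>D. d \<in> X" if X: "open X" "X \<noteq> {}" for X
  proof -
    obtain x where "x \<in> X" using X by auto
    then obtain b where b: "b \<in> B" "x \<in> b" "b \<subseteq> X" using topological_basisE[OF B(2) X(1)] by metis
    then show ?thesis using DE[of b] unfolding D_def by blast
  qed
  have "D \<noteq> {}" using dn[of UNIV] by auto
  moreover have cD: "countable D" unfolding D_def using B(1) by (intro countable_image) (auto intro: countable_subset)
  ultimately have r: "range (from_nat_into D) = D" by (simp add: range_from_nat_into)
  show ?thesis
  proof (intro exI[of _ "from_nat_into D"] conjI allI impI)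
    fix X :: "(real^'n) set" assume "open X" "X \<noteq> {}"
    from dn[OF this] show "\<exists>n. from_nat_into D n \<in> X" using r by (metis imageE)
  next
    fix n
    have "from_nat_into D n \<in> D" using rangeI[of "from_nat_into D" n] unfolding r .
    moreover have "D \<subseteq> E" unfolding D_def using DE by blast
    ultimately have "from_nat_into D n \<in> E" by blast
    then show "\<exists>g\<in>borel_measurable lborel. AE y in lborel. a y (from_nat_into D n) = g y" by (simp add: E_def)
  qed
qed

text \<open>The second variable is replaced by the first point of the dense sequence within distance
  1/(n + 1). This gives a function assembled from countably many measurable sections, and continuity
  in the second variable yields the limit.\<close>

lemma caratheodory_measurable:
  fixes b :: "'a::euclidean_space \<Rightarrow> 'c::euclidean_space \<Rightarrow> complex"
  assumes c: "\<And>y. continuous_on UNIV (b y)" and m: "\<And>n. (\<lambda>y. b y (d n)) \<in> borel_measurable borel"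
    and d: "\<And>X. open X \<Longrightarrow> X \<noteq> {} \<Longrightarrow> \<exists>n::nat. d n \<in> X"
  shows "(\<lambda>p. b (fst p) (snd p)) \<in> borel_measurable (borel \<Otimes>\<^sub>M borel)"
proof -
  define idx where "idx n \<xi> = (LEAST k. dist (d k) \<xi> < 1 / real (Suc n))" for n \<xi>
  have idx: "dist (d (idx n \<xi>)) \<xi> < 1 / real (Suc n)" for n \<xi>
  proof -
    have "\<exists>k. d k \<in> ball \<xi> (1 / real (Suc n))" by (rule d) auto
    then have "\<exists>k. dist (d k) \<xi> < 1 / real (Suc n)" by (auto simp: dist_commute)
    then show ?thesis unfolding idx_def by (rule LeastI_ex)
  qed
  have [measurable]: "idx n \<in> borel \<rightarrow>\<^sub>M count_space UNIV" for n unfolding idx_def by measurable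
  show ?thesis
  proof (rule borel_measurable_LIMSEQ_metric[where f="\<lambda>n p. b (fst p) (d (idx n (snd p)))"])
    show "(\<lambda>p. b (fst p) (d (idx n (snd p)))) \<in> borel_measurable (borel \<Otimes>\<^sub>M borel)" for n
    proof (rule measurable_compose_countable[where f="\<lambda>k p. b (fst p) (d k)" and g="\<lambda>p. idx n (snd p)"])
      show "(\<lambda>p. b (fst p) (d k)) \<in> borel_measurable (borel \<Otimes>\<^sub>M borel)" for k
        by (rule measurable_compose[OF measurable_fst m])
      show "(\<lambda>p. idx n (snd p)) \<in> borel \<Otimes>\<^sub>M borel \<rightarrow>\<^sub>M count_space UNIV" by measurable
    qed
    fix p :: "'a \<times> 'c"
    have lim: "(\<lambda>n. d (idx n (snd p))) \<longlonglongrightarrow> snd p"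
    proof (rule metric_tendsto_imp_tendsto[where f="\<lambda>n. 1 / real (Suc n)" and a=0])
      show "(\<lambda>n. 1 / real (Suc n)) \<longlonglongrightarrow> 0" by real_asymp
      show "\<forall>\<^sub>F n in sequentially. dist (d (idx n (snd p))) (snd p) \<le> dist (1 / real (Suc n)) 0"
        using idx by (intro always_eventually allI less_imp_le) (simp add: dist_real_def)
    qed
    have cont: "isCont (b (fst p)) (snd p)" using c[of "fst p"] by (simp add: continuous_on_eq_continuous_at)
    show "(\<lambda>n. b (fst p) (d (idx n (snd p)))) \<longlonglongrightarrow> b (fst p) (snd p)"
      by (rule isCont_tendsto_compose[OF cont lim])
  qed
qed

text \<open>The conditions along the dense sequence are countably many, so one null set of y serves
  them all. Continuity of the derivatives in \<xi> carries the bounds from the sequence to every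
  \<xi>, and on the null set the symbol is set to 0.\<close>

lemma rough_symbol_borel_version:
  fixes a :: "real^'n::finite \<Rightarrow> real^'n \<Rightarrow> complex"
  assumes a: "a \<in> rough_symbols m \<rho>"
  shows "\<exists>A a'. (\<lambda>p. a' (fst p) (snd p)) \<in> borel_measurable (borel \<Otimes>\<^sub>M borel) \<and>
    (\<forall>y i. symb \<rho> i N A m (a' y)) \<and> (AE y in lborel. \<forall>\<xi>. a y \<xi> = a' y \<xi>)"
proof -
  have sm: "smooth_fun (a y)" for y
    using a by (simp add: rough_symbols_def)
  have am: "(\<lambda>(x, \<xi>). a x \<xi>) \<in> borel_measurable lebesgue"
    using a by (simp add: rough_symbols_def)
  obtain d :: "nat \<Rightarrow> real^'n" where d: "\<And>X. open X \<Longrightarrow> X \<noteq> {} \<Longrightarrow> \<exists>n. d n \<in> X"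
    and dg: "\<And>n. \<exists>g\<in>borel_measurable lborel. AE y in lborel. a y (d n) = g y"
    using borel_sections_dense[OF am] by blast
  have "\<forall>n. \<exists>g. g \<in> borel_measurable lborel \<and> (AE y in lborel. a y (d n) = g y)" using dg by blast
  from choice[OF this] obtain g where g: "\<And>n. g n \<in> borel_measurable lborel" and gae: "\<And>n. AE y in lborel. a y (d n) = g n y" by blast
  define C where "C i k = (SOME C. 0 \<le> C \<and> (\<forall>\<xi>. AE y in lborel. norm ((partial_deriv i ^^ k) (a y) \<xi>) \<le> C * japanese \<xi> powr (m - \<rho> * real k)))" for i k
  have C0: "0 \<le> C i k" and C: "AE y in lborel. norm ((partial_deriv i ^^ k) (a y) \<xi>) \<le> C i k * japanese \<xi> powr (m - \<rho> * real k)" for i k \<xi>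
    using someI_ex[OF symbol_bound_AE[OF a, where i=i and k=k]] by (auto simp: C_def)
  define A where "A = (\<Sum>i\<in>UNIV. \<Sum>k\<le>N. C i k)"
  have CA: "C i k \<le> A" if "k \<le> N" for i k
  proof -
    have "C i k \<le> (\<Sum>k\<le>N. C i k)" using C0 that by (intro member_le_sum) auto
    also have "\<dots> \<le> A" unfolding A_def using C0 by (intro member_le_sum sum_nonneg) auto
    finally show ?thesis .
  qed
  have b_ae: "AE y in lborel. \<forall>n. \<forall>i. \<forall>k. norm ((partial_deriv i ^^ k) (a y) (d n)) \<le> C i k * japanese (d n) powr (m - \<rho> * real k)"
    unfolding AE_all_countable by (intro allI C)
  have g_ae: "AE y in lborel. \<forall>n. a y (d n) = g n y" unfolding AE_all_countable using gae by blast
  define P where "P = (\<lambda>y. (\<forall>n. a y (d n) = g n y) \<and> (\<forall>n i k. norm ((partial_deriv i ^^ k) (a y) (d n)) \<le> C i k * japanese (d n) powr (m - \<rho> * real k)))"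
  have "AE y in lborel. P y"
    using b_ae g_ae by (simp only: P_def AE_conj_iff)
  then obtain Z where Z: "Z \<in> null_sets lborel" and Zs: "{y \<in> space lborel. \<not> P y} \<subseteq> Z"
    unfolding eventually_ae_filter by blast
  have ZP: "P y" if "y \<notin> Z" for y using that Zs by auto
  have Zg: "a y (d n) = g n y" and Zb: "norm ((partial_deriv i ^^ k) (a y) (d n)) \<le> C i k * japanese (d n) powr (m - \<rho> * real k)" if "y \<notin> Z" for y n i k
    using ZP[OF that] by (auto simp: P_def)
  have [measurable]: "Z \<in> sets borel" using Z by auto
  define a' where "a' y = (if y \<in> Z then (\<lambda>_. 0) else a y)" for y
  have sA: "symb \<rho> i N A m (a y)" if y: "y \<notin> Z" for y i
  proof (rule symb_of_funpow)
    fix k and \<xi> :: "real^'n" assume k: "k \<le> N"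
    let ?D = "(partial_deriv i ^^ k) (a y)" and ?w = "\<lambda>\<xi>::real^'n. A * japanese \<xi> powr (m - \<rho> * real k)"
    show cD: "continuous_on UNIV ?D" by (rule smooth_fun_funpow(2)[OF sm])
    have "closed {\<xi>. norm (?D \<xi>) \<le> ?w \<xi>}"
      by (intro closed_Collect_le continuous_intros cD) auto
    then have op: "open (- {\<xi>. norm (?D \<xi>) \<le> ?w \<xi>})" by (rule open_Compl)
    have "- {\<xi>. norm (?D \<xi>) \<le> ?w \<xi>} = {}"
    proof (rule ccontr)
      assume "- {\<xi>. norm (?D \<xi>) \<le> ?w \<xi>} \<noteq> {}"
      from d[OF op this] obtain n where n: "\<not> norm (?D (d n)) \<le> ?w (d n)" by auto
      have "norm (?D (d n)) \<le> C i k * japanese (d n) powr (m - \<rho> * real k)" by (rule Zb[OF y])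
      also have "\<dots> \<le> ?w (d n)" by (intro mult_right_mono CA k) auto
      finally show False using n by simp
    qed
    then show "norm (?D \<xi>) \<le> ?w \<xi>" by auto
  next
    fix k and \<xi> :: "real^'n"
    show "(\<lambda>t. (partial_deriv i ^^ k) (a y) (\<xi> + t *\<^sub>R axis i 1)) differentiable (at 0)"
      by (rule smooth_fun_funpow(3)[OF sm])
  qed
  \<comment> \<open>A point off the null set shows that \<open>A\<close> is nonnegative and yields
    the zero symbol as a multiple of \<open>a y0\<close>.\<close>
  obtain y0 where y0: "y0 \<notin> Z"
  proof (cases "Z = UNIV")
    case True
    then have "emeasure lborel (UNIV :: (real^'n) set) = 0" using Z by (simp add: null_sets_def)
    then show ?thesis by simp
  qed (use that in blast)
  have "symb \<rho> i N A m (a' y)" for y i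
  proof (cases "y \<in> Z")
    case True
    have "symb \<rho> i N (2 ^ N * norm (0::complex) * A) m (\<lambda>\<xi>. 0 * a y0 \<xi>)" by (rule symb_cmult[OF sA[OF y0]])
    then have "symb \<rho> i N 0 m (a' y)" using True by (simp add: a'_def)
    then show ?thesis by (rule symb_mono) (use symb_nonneg[OF sA[OF y0]] in auto)
  qed (simp add: a'_def sA)
  moreover have "(\<lambda>p. a' (fst p) (snd p)) \<in> borel_measurable (borel \<Otimes>\<^sub>M borel)"
  proof (rule caratheodory_measurable)
    show "continuous_on UNIV (a' y)" for y using smooth_fun_funpow(2)[OF sm[of y], where k=0 and i=undefined] by (simp add: a'_def)
    have "a' y (d n) = (if y \<in> Z then 0 else g n y)" for y n using Zg by (simp add: a'_def)
    then show "(\<lambda>y. a' y (d n)) \<in> borel_measurable borel" for n using g[of n] by simp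
  qed (rule d)
  moreover have "AE y in lborel. \<forall>\<xi>. a y \<xi> = a' y \<xi>"
    using AE_not_in[OF Z] by eventually_elim (simp add: a'_def)
  ultimately show ?thesis by blast
qed

theorem theorem1p7:
  fixes a :: "real^'n::finite \<Rightarrow> real^'n \<Rightarrow> complex" and \<rho> :: real
  assumes "0 < \<rho>" and "\<rho> < 1"
    and "a \<in> rough_symbols (- real CARD('n) * (1 - \<rho>)) \<rho>"
  shows "\<exists>C\<ge>0. \<forall>f. schwartz_fun f \<longrightarrow>
           (\<exists>u. represented_by (adjoint_op a f) u) \<and>
           (\<forall>u. represented_by (adjoint_op a f) u \<longrightarrow>
              (\<forall>x. sharp_maximal u x \<le> ennreal C * maximal f x))"
proof -
  \<comment> \<open>The number of derivatives is \<open>num_derivs\<close>, spelled out before the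
    locale is interpreted.\<close>
  obtain A a' where a'm: "(\<lambda>p. a' (fst p) (snd p)) \<in> borel_measurable (borel \<Otimes>\<^sub>M borel)"
    and a's: "\<And>y i. symb \<rho> i (2 * CARD('n) + 1) A (- real CARD('n) * (1 - \<rho>)) (a' y)"
    and a'ae: "AE y in lborel. \<forall>\<xi>. a y \<xi> = a' y \<xi>"
    using rough_symbol_borel_version[OF assms(3)] by blast
  interpret S: scale_params "TYPE('n)" \<rho> A by standard (use assms in auto)
  interpret good_family "TYPE('n)" \<rho> A a'
    by standard (use a'm a's in \<open>auto simp: S.good_def S.m_def S.num_derivs_def\<close>)
  obtain C where C: "0 \<le> C" "\<And>f u x. integrable lborel f \<Longrightarrow> AE y in lborel. u y = dyadic_sum f y \<Longrightarrow> sharp_maximal u x \<le> ennreal C * maximal f x"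
    using sharp_maximal_dyadic_sum by blast
  have rep: "represented_by (adjoint_op a f) (dyadic_sum f)" if f: "integrable lborel f" for f
  proof -
    have [measurable]: "f \<in> borel_measurable borel" using f by auto
    \<comment> \<open>One null set of y serves every \<xi>, so the two transforms agree at each
      frequency and not just almost everywhere.\<close>
    have af: "adjoint_fourier a f \<xi> = adj_symbol f \<xi>" for \<xi>
    proof -
      let ?g = "\<lambda>y. exp (- \<i> * complex_of_real (y \<bullet> \<xi>)) * a y \<xi> * f y" and ?g' = "\<lambda>y. exp (- \<i> * complex_of_real (y \<bullet> \<xi>)) * a' y \<xi> * f y"
      have eq: "AE y in lborel. ?g y = ?g' y" using a'ae by eventually_elim simp
      have m: "?g' \<in> borel_measurable lborel" by measurable
      have "(LINT y|lebesgue. ?g y) = (LINT y|lebesgue. ?g' y)"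
        by (rule integral_cong_AE[OF lebesgue_measurable_of_AE_eq[OF m eq] measurable_completion[OF m] AE_completion[OF eq]])
      also have "\<dots> = (LINT y|lborel. ?g' y)" by (rule integral_completion[OF m])
      finally show ?thesis by (simp add: adjoint_fourier_def adj_symbol_def)
    qed
    have u0i: "integrable lebesgue (dyadic_sum f)" using dyadic_sum_integrable[OF f] by (subst integrable_completion) auto
    have "locally_integrable (dyadic_sum f)"
      unfolding locally_integrable_def set_integrable_def
      by (intro allI impI integrable_mult_indicator u0i) (auto dest: compact_imp_closed)
    moreover have "adjoint_op a f \<phi> = distrib_of_fun (dyadic_sum f) \<phi>" if \<phi>: "test_fun \<phi>" for \<phi>
    proof -
      note t = test_fun_FT_integrable[OF \<phi>]
      have [measurable]: "\<phi> \<in> borel_measurable borel" using t(1) by auto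
      obtain B where B: "\<And>x. norm (\<phi> x) \<le> B" using t(3) by blast
      have "inv_fourier \<phi> \<xi> = complex_of_real inv_const * FT \<phi> \<xi>" for \<xi>
        unfolding inv_fourier_def FT_def inv_const_def by (subst integral_completion) (simp_all add: inner_commute)
      then have "adjoint_op a f \<phi> = (LINT \<xi>|lebesgue. adj_symbol f \<xi> * (complex_of_real inv_const * FT \<phi> \<xi>))"
        by (simp only: adjoint_op_def inv_fourier_distrib_def distrib_of_fun_def af)
      also have "\<dots> = (LINT \<xi>|lborel. adj_symbol f \<xi> * (complex_of_real inv_const * FT \<phi> \<xi>))"
        by (rule integral_completion) measurable
      also have "\<dots> = (LINT x|lborel. dyadic_sum f x * \<phi> x)" by (rule dyadic_sum_pairing[OF f t(1,2) B])
      also have "\<dots> = (LINT x|lebesgue. dyadic_sum f x * \<phi> x)"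
        by (rule integral_completion[symmetric]) measurable
      finally show ?thesis by (simp only: distrib_of_fun_def)
    qed
    ultimately show ?thesis by (simp add: represented_by_def)
  qed
  show ?thesis
  proof (intro exI[of _ C] conjI allI impI)
    show "0 \<le> C" by (rule C(1))
    fix f :: "real^'n \<Rightarrow> complex" assume "schwartz_fun f"
    then have f: "integrable lborel f" by (rule schwartz_integrable)
    show "\<exists>u. represented_by (adjoint_op a f) u" using rep[OF f] by blast
    fix u x assume "represented_by (adjoint_op a f) u"
    \<comment> \<open>Here u is an arbitrary representative; uniqueness identifies it with the
      constructed one up to a null set.\<close>
    then have "AE y in lborel. u y = dyadic_sum f y" using rep[OF f] by (rule represented_by_unique)
    then show "sharp_maximal u x \<le> ennreal C * maximal f x" by (rule C(2)[OF f])
  qed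
qed

end
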